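(* Assume: (1) the graph $G=(V,E)$ is connected, the gossip selection is i.i.d. as described in the context, and $\pi_{ji}>0$ whenever $\{i,j\}\in E$ (with $\pi_{ji}=0$ otherwise); (2) every component set $\mathcal{X}_i^j$ ($j\in I_i$, $i\in V$) is closed and convex; every $f_i:\mathbb{R}^d\to\mathbb{R}$ is convex and differentiable with $\|\nabla f_i(x)-\nabla f_i(y)\|\le L_i\|x-y\|$ for all $x,y\in\mathbb{R}^d$; and there is a constant $G_f$ with $\|\nabla f_i(x)\|\le G_f$ for all $x\in\mathcal{X}$ and $i\in V$; (3) there is a constant $c>0$ such that for all $i\in V$, $k\ge 1$ and $x\in\mathbb{R}^d$, $\mathrm{dist}^2(x,\mathcal{X})\le c\,\mathsf{E}\big[\mathrm{dist}^2(x,\mathcal{X}_i^{\Omega_i(k)})\mid \Omega_\ell(t),\,t\in[1,k),\,\ell\in V\big]$. Assume the optimal set $\mathcal{X}^*=\{x\in\mathcal{X}\mid f(x)=f^*\}$, where $f^*=\min_{x\in\mathcal{X}}f(x)$, is nonempty, and let $\{x_i(k)\}$ be generated by the GRP algorithm with stepsizes $\alpha_i(k)=1/\Gamma_i(k)$. Then the sequences $\{x_i(k)\}$, $i\in V$, converge to some (common) random point $x^\star$ in the optimal set $\mathcal{X}^*$ with probability 1, i.e. $\lim_{k\to\infty}x_i(k)=x^\star$ w.p.1 for all $i\in V$.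
   Context: Problem. $G=(V,E)$ is an undirected graph without self-loops on $V=\{1,\dots,m\}$ (the agents). Agent $i$ has a function $f_i:\mathbb{R}^d\to\mathbb{R}$ and a set $\mathcal{X}_i=\bigcap_{j\in I_i}\mathcal{X}_i^j\subseteq\mathbb{R}^d$, where $I_i$ is a (possibly infinite) index set. Put $f=\sum_{i=1}^m f_i$ and $\mathcal{X}=\bigcap_{i=1}^m\mathcal{X}_i$, assumed nonempty. The problem is to minimize $f$ over $\mathcal{X}$. $\|\cdot\|$ is the Euclidean norm, $\mathrm{dist}(x,\mathcal{Y})=\min_{v\in\mathcal{Y}}\|v-x\|$, and $\Pi_{\mathcal{Y}}[x]$ is the Euclidean projection of $x$ on the closed convex set $\mathcal{Y}$. Gossip model. $[\pi_{ij}]$ is a nonnegative row-stochastic $m\times m$ matrix with $\pi_{ij}>0$ only if $\{i,j\}\in E$. At each time $k\ge1$ exactly one agent $I_k$, uniformly distributed on $V$, wakes up, and it contacts the agent $J_k$, where $\Pr(J_k=j\mid I_k=i)=\pi_{ij}$. The pairs $(I_k,J_k)$, $k\ge1$, are i.i.d. GRP algorithm. Agents start from (possibly random) vectors $x_i(0)\in\mathbb{R}^d$. For $k\ge1$, with $W(k)=I-\tfrac12(e_{I_k}-e_{J_k})(e_{I_k}-e_{J_k})'$, set $v_i(k)=\sum_{j=1}^m[W(k)]_{ij}x_j(k-1)$. If $i\in\{I_k,J_k\}$ then $x_i(k)=\Pi_{\mathcal{X}_i^{\Omega_i(k)}}[v_i(k)-\alpha_i(k)\nabla f_i(v_i(k))]$;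 otherwise $x_i(k)=v_i(k)$ ($=x_i(k-1)$). Here $\Omega_i(k)$ is a random variable with values in $I_i$ and $\alpha_i(k)>0$ is a stepsize. The initial vectors, the gossip sequence $\{(I_k,J_k)\}$ and the collection $\{\Omega_i(k)\}$ are mutually independent. $\Gamma_i(k)$ is the number of updates agent $i$ has performed up to and including time $k$, i.e. the number of $t\in\{1,\dots,k\}$ with $i\in\{I_t,J_t\}$. *)

theory Defs
  imports "HOL-Probability.Probability"
begin

text \<open>Undirected graphs without self-loops whose vertices are all elements of a finite type:
  an edge is a two-element set of vertices.\<close>

definition simple_graph :: "'v set set \<Rightarrow> bool" where
  "simple_graph E \<longleftrightarrow> (\<forall>e\<in>E. card e = 2)"

definition connected_graph :: "'v set set \<Rightarrow> bool" where
  "connected_graph E \<longleftrightarrow> (\<forall>i j. (i, j) \<in> {(a, b). {a, b} \<in> E}\<^sup>*)"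

text \<open>Entry \<open>(a, b)\<close> of the outer product \<open>u u'\<close> is \<open>u $ a * u $ b\<close>; here \<open>u = e\<^sub>i - e\<^sub>j\<close>.\<close>

definition gossip_matrix :: "'v::finite \<Rightarrow> 'v \<Rightarrow> real^'v^'v" where
  "gossip_matrix i j = mat 1 - (1/2) *\<^sub>R (\<chi> a b. (axis i 1 - axis j 1) $ a * (axis i 1 - axis j 1) $ b)"

definition num_updates :: "(nat \<Rightarrow> 'v) \<Rightarrow> (nat \<Rightarrow> 'v) \<Rightarrow> 'v \<Rightarrow> nat \<Rightarrow> nat" where
  "num_updates I J i k = card {t \<in> {1..k}. i \<in> {I t, J t}}"

text \<open>The law of the pairs: the waking agent is uniform, the contacted agent has conditional
  law \<open>P i\<close>, and the pairs at times \<open>k \<ge> 1\<close> are independent (identical distribution follows from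
  the prescribed law).\<close>

definition gossip_selection ::
    "'w measure \<Rightarrow> ('v::finite \<Rightarrow> 'v \<Rightarrow> real) \<Rightarrow> (nat \<Rightarrow> 'w \<Rightarrow> 'v) \<Rightarrow> (nat \<Rightarrow> 'w \<Rightarrow> 'v) \<Rightarrow> bool" where
  "gossip_selection M P I J \<longleftrightarrow>
     prob_space.indep_vars M (\<lambda>_. count_space UNIV) (\<lambda>k \<omega>. (I k \<omega>, J k \<omega>)) {1..} \<and>
     (\<forall>k\<ge>1. \<forall>i. \<P>(\<omega> in M. I k \<omega> = i) = 1 / real CARD('v)) \<and>
     (\<forall>k\<ge>1. \<forall>i j. \<P>(\<omega> in M. J k \<omega> = j \<bar> I k \<omega> = i) = P i j)"

text \<open>Agent \<open>i\<close> has the component sets \<open>X i j\<close> for \<open>j\<close> in the index set \<open>space (N i)\<close>; the measure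
  \<open>N i\<close> only serves to equip this set with a sigma-algebra.\<close>

definition feasible_set :: "('v \<Rightarrow> 'j measure) \<Rightarrow> ('v \<Rightarrow> 'j \<Rightarrow> 'a set) \<Rightarrow> 'a set" where
  "feasible_set N X = (\<Inter>i. \<Inter>j\<in>space (N i). X i j)"

definition optimal_set :: "('a \<Rightarrow> real) \<Rightarrow> 'a set \<Rightarrow> 'a set" where
  "optimal_set f S = {x. is_arg_min f (\<lambda>y. y \<in> S) x}"

text \<open>The sigma-algebra generated by the family \<open>Y k\<close>, \<open>k \<in> K\<close> (trivial for empty \<open>K\<close>).\<close>

definition generated_sigma :: "'w measure \<Rightarrow> ('k \<Rightarrow> 'b measure) \<Rightarrow> ('k \<Rightarrow> 'w \<Rightarrow> 'b) \<Rightarrow> 'k set \<Rightarrow> 'w measure" where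
  "generated_sigma M N Y K = sigma (space M) (\<Union>k\<in>K. {Y k -` A \<inter> space M | A. A \<in> sets (N k)})"

definition past_choices ::
    "'w measure \<Rightarrow> ('v \<Rightarrow> 'j measure) \<Rightarrow> ('v \<Rightarrow> nat \<Rightarrow> 'w \<Rightarrow> 'j) \<Rightarrow> nat \<Rightarrow> 'w measure" where
  "past_choices M N \<Omega> k = generated_sigma M (\<lambda>(l, t). N l) (\<lambda>(l, t). \<Omega> l t) (UNIV \<times> {1..<k})"

text \<open>Mutual independence of the initial vectors, the gossip sequence and the collection of all
  \<open>\<Omega> i k\<close>, i.e. of the three sigma-algebras they generate; nothing is required within each group.\<close>

definition independent_sources ::
    "'w measure \<Rightarrow> ('v \<Rightarrow> 'j measure) \<Rightarrow> ('v \<Rightarrow> 'w \<Rightarrow> 'a::topological_space) \<Rightarrow>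
     (nat \<Rightarrow> 'w \<Rightarrow> 'v) \<Rightarrow> (nat \<Rightarrow> 'w \<Rightarrow> 'v) \<Rightarrow> ('v \<Rightarrow> nat \<Rightarrow> 'w \<Rightarrow> 'j) \<Rightarrow> bool" where
  "independent_sources M N x0 I J \<Omega> \<longleftrightarrow>
     prob_space.indep_sets M
       (\<lambda>s. [sets (generated_sigma M (\<lambda>_. borel) x0 UNIV),
             sets (generated_sigma M (\<lambda>_. count_space UNIV) (\<lambda>k \<omega>. (I k \<omega>, J k \<omega>)) {1..}),
             sets (generated_sigma M (\<lambda>(l, t). N l) (\<lambda>(l, t). \<Omega> l t) (UNIV \<times> {1..}))] ! s)
       {..<3}"

text \<open>One sample path of the algorithm: \<open>C i k\<close> is the set on which agent \<open>i\<close> projects at time \<open>k\<close>,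
  \<open>g i\<close> is the gradient of its objective function and \<open>\<alpha> i k\<close> its stepsize.\<close>

definition grp_path ::
    "(nat \<Rightarrow> 'v::finite) \<Rightarrow> (nat \<Rightarrow> 'v) \<Rightarrow> ('v \<Rightarrow> nat \<Rightarrow> 'a::euclidean_space set) \<Rightarrow> ('v \<Rightarrow> 'a \<Rightarrow> 'a) \<Rightarrow>
     ('v \<Rightarrow> nat \<Rightarrow> real) \<Rightarrow> ('v \<Rightarrow> nat \<Rightarrow> 'a) \<Rightarrow> bool" where
  "grp_path I J C g \<alpha> x \<longleftrightarrow>
     (\<forall>k\<ge>1. \<forall>i.
        let v = (\<Sum>j\<in>UNIV. gossip_matrix (I k) (J k) $ i $ j *\<^sub>R x j (k - 1))
        in x i k = (if i \<in> {I k, J k} then closest_point (C i k) (v - \<alpha> i k *\<^sub>R g i v) else v))"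

end

theory Submission
  imports Defs "HOL-Real_Asymp.Real_Asymp"
begin

text \<open>Let \<open>D\<close> be the sum of the squared distances of the iterates to their mean, and \<open>S\<close> that of their
  squared distances to the feasible set. By set regularity and connectivity, some combination \<open>S + \<kappa> D\<close>
  contracts in expectation up to an error of order \<open>1 / k ^ 2\<close>, so that \<open>k powr (3/4) * (S + D)\<close> is
  almost surely summable. By Hoeffding's inequality and Borel--Cantelli, the number of updates of each
  agent by time \<open>k\<close> is almost surely \<open>\<gamma> * k + O(k powr (3/4))\<close>.

  These two facts imply convergence deterministically, without martingale arguments: the stepsizes
  used by an agent up to time \<open>k\<close> add up to the harmonic number of its update count, which differs from
  \<open>harm k + ln \<gamma>\<close> only by \<open>O(k powr (- 1/4))\<close>. Summing by parts, the random weights of the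
  objective functions may be replaced by the common weight \<open>1 / k\<close>, because the projected mean moves
  by at most a multiple of \<open>sqrt (S + D) + 1 / k\<close> per step. Hence the squared distances to every optimal
  point converge, the objective values have the optimal value as a limit point, and so the iterates
  converge to one optimal point.\<close>

section \<open>Projections and projected gradient steps\<close>

text \<open>The obstacle is the stepsizes: they are random, differ between the two active agents,
  and depend on the pair drawn in the same step. Expectations are therefore taken only for S +
  \<kappa> D, where an upper bound of order 1/k on the stepsizes suffices; objective values are
  handled path by path.

  Set regularity is assumed at fixed points and given past choices alone, but it is applied at a
  point that depends on the initial vectors and on the pairs, including the current one.
  Independence of the three sources enlarges the conditioning, and approximation by simple functions
  replaces fixed points by random ones.

  The exponent 3/4 has two roles. As the size of the fluctuations of an update count it must exceed
  1/2, so that Hoeffding's bounds are summable. As the weight of S + D it must be below 1, so that k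
  powr (3/4 - 2) is summable. Together they must make k powr (- 1/4) * sqrt (S + D) summable; by
  Cauchy-Schwarz this reduces to the summability of k powr (- 1/2 - 3/4).\<close>

lemma infdist_eq_dist_closest_point:
  fixes C :: "'a::euclidean_space set"
  assumes "closed C" "C \<noteq> {}"
  shows "infdist v C = dist v (closest_point C v)"
  using setdist_closest_point[OF assms] by (simp add: infdist_eq_setdist)

lemma norm_closest_point_diff_le:
  fixes C :: "'a::euclidean_space set"
  assumes "closed C" "convex C" "y \<in> C"
  shows "norm (closest_point C z - y) \<le> norm (z - y)"
proof -
  have "dist (closest_point C z) (closest_point C y) \<le> dist z y"
    using assms by (intro closest_point_lipschitz) auto
  then show ?thesis
    using assms by (simp add: closest_point_self dist_norm)
qed

lemma norm_closest_point_diff_sq_le: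
  fixes C :: "'a::euclidean_space set"
  assumes "closed C" "convex C" "y \<in> C"
  shows "(norm (closest_point C z - y))\<^sup>2 \<le> (norm (z - y))\<^sup>2 - (norm (closest_point C z - z))\<^sup>2"
proof -
  let ?u = "closest_point C z"
  have "inner (z - ?u) (y - ?u) \<le> 0"
    using assms by (intro closest_point_dot)
  moreover have "(norm (z - y))\<^sup>2 = (norm (?u - z))\<^sup>2 + (norm (?u - y))\<^sup>2 - 2 * inner (z - ?u) (y - ?u)"
    by (simp add: power2_norm_eq_inner inner_diff_left inner_diff_right inner_commute)
  ultimately show ?thesis by linarith
qed

text \<open>The projection inequality gains the squared distance from
  \<open>v - \<alpha> *\<^sub>R h\<close> to its projection, whereas set regularity speaks of the
  distance from \<open>v\<close>. Passing from one to the other costs half of the gain and a second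
  copy of \<open>\<alpha>\<^sup>2 * (norm h)\<^sup>2\<close>.\<close>

lemma projected_step_le:
  fixes C :: "'a::euclidean_space set"
  assumes C: "closed C" "convex C" "y \<in> C"
  shows "(norm (closest_point C (v - \<alpha> *\<^sub>R h) - y))\<^sup>2
    \<le> (norm (v - y))\<^sup>2 - 2 * \<alpha> * inner h (v - y) + 2 * \<alpha>\<^sup>2 * (norm h)\<^sup>2 - (infdist v C)\<^sup>2 / 2"
proof -
  let ?z = "v - \<alpha> *\<^sub>R h"
  let ?u = "closest_point C ?z"
  have uC: "?u \<in> C" using C closest_point_in_set by blast
  have "infdist v C \<le> dist v ?u" by (rule infdist_le[OF uC])
  also have "\<dots> \<le> norm (?u - ?z) + norm (\<alpha> *\<^sub>R h)"
  proof -
    have "v - ?u = - (?u - ?z) + \<alpha> *\<^sub>R h" by simp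
    then show ?thesis unfolding dist_norm by (metis norm_minus_cancel norm_triangle_ineq)
  qed
  finally have "(infdist v C)\<^sup>2 \<le> (norm (?u - ?z) + norm (\<alpha> *\<^sub>R h))\<^sup>2"
    by (intro power_mono infdist_nonneg)
  also have "\<dots> \<le> 2 * (norm (?u - ?z))\<^sup>2 + 2 * (norm (\<alpha> *\<^sub>R h))\<^sup>2"
    using zero_le_power2[of "norm (?u - ?z) - norm (\<alpha> *\<^sub>R h)"] by (simp add: power2_sum power2_diff)
  finally have "(infdist v C)\<^sup>2 / 2 \<le> (norm (?u - ?z))\<^sup>2 + \<alpha>\<^sup>2 * (norm h)\<^sup>2"
    by (simp add: power_mult_distrib)
  moreover have "(norm (?z - y))\<^sup>2 = (norm (v - y))\<^sup>2 - 2 * \<alpha> * inner h (v - y) + \<alpha>\<^sup>2 * (norm h)\<^sup>2"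
    unfolding power2_norm_eq_inner
    by (simp add: inner_diff_left inner_diff_right inner_commute algebra_simps power2_eq_square)
  ultimately show ?thesis
    using norm_closest_point_diff_sq_le[OF C, of ?z] by linarith
qed

text \<open>Restricted to the line through \<open>p\<close> and \<open>v\<close>, \<open>f\<close>
  is a convex function of one real variable and lies above its tangent at 0.\<close>

lemma convex_on_gradient_ineq:
  fixes f :: "'a::real_inner \<Rightarrow> real"
  assumes "convex_on UNIV f" and "GDERIV f p :> h"
  shows "f v \<ge> f p + inner h (v - p)"
proof -
  define \<phi> where "\<phi> t = f (p + t *\<^sub>R (v - p))" for t :: real
  have "convex_on UNIV \<phi>"
  proof (rule convex_onI)
    fix t x y :: real assume t: "0 < t" "t < 1"
    have "p + ((1 - t) * x + t * y) *\<^sub>R (v - p)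
      = (1 - t) *\<^sub>R (p + x *\<^sub>R (v - p)) + t *\<^sub>R (p + y *\<^sub>R (v - p))"
      by (simp add: algebra_simps)
    then show "\<phi> ((1 - t) *\<^sub>R x + t *\<^sub>R y) \<le> (1 - t) * \<phi> x + t * \<phi> y"
      unfolding \<phi>_def using convex_onD[OF assms(1), of t "p + x *\<^sub>R (v - p)" "p + y *\<^sub>R (v - p)"] t
      by simp
  qed simp
  moreover have "(\<phi> has_real_derivative inner (v - p) h) (at 0)"
  proof -
    have "((\<lambda>t. p + t *\<^sub>R (v - p)) has_derivative (\<lambda>t. t *\<^sub>R (v - p))) (at 0)"
      by (auto intro!: derivative_eq_intros)
    moreover have "(f has_derivative (\<lambda>u. inner u h)) (at (p + 0 *\<^sub>R (v - p)))"
      using assms(2) by (simp add: gderiv_def)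
    ultimately have "(f \<circ> (\<lambda>t. p + t *\<^sub>R (v - p)) has_derivative (\<lambda>u. inner u h) \<circ> (\<lambda>t. t *\<^sub>R (v - p))) (at 0)"
      by (rule diff_chain_at)
    then show ?thesis
      by (simp add: has_field_derivative_def \<phi>_def[abs_def] o_def mult.commute[of _ "inner (v - p) h"])
  qed
  ultimately have "\<phi> 1 - \<phi> 0 \<ge> inner (v - p) h * (1 - 0)"
    by (intro convex_on_imp_above_tangent[where A = UNIV]) (auto simp: has_field_derivative_at_within)
  then show ?thesis by (simp add: \<phi>_def inner_commute)
qed

section \<open>Averaging\<close>

definition mean :: "('v::finite \<Rightarrow> 'a::real_vector) \<Rightarrow> 'a" where
  "mean x = (1 / real CARD('v)) *\<^sub>R (\<Sum>i\<in>UNIV. x i)"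

definition disagreement :: "('v::finite \<Rightarrow> 'a::real_normed_vector) \<Rightarrow> real" where
  "disagreement x = (\<Sum>i\<in>UNIV. (norm (x i - mean x))\<^sup>2)"

definition infeasibility :: "'a::metric_space set \<Rightarrow> ('v::finite \<Rightarrow> 'a) \<Rightarrow> real" where
  "infeasibility Y x = (\<Sum>i\<in>UNIV. (infdist (x i) Y)\<^sup>2)"

lemma disagreement_nonneg: "disagreement x \<ge> 0"
  by (simp add: disagreement_def sum_nonneg)

lemma infeasibility_nonneg: "infeasibility Y x \<ge> 0"
  by (simp add: infeasibility_def sum_nonneg)

lemma norm_diff_mean_sq_le: "(norm (x i - mean x))\<^sup>2 \<le> disagreement x"
  unfolding disagreement_def by (rule member_le_sum) auto

lemma infdist_sq_le: "(infdist (x i) Y)\<^sup>2 \<le> infeasibility Y x"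
  unfolding infeasibility_def by (rule member_le_sum) auto

lemma sum_diff_mean:
  fixes x :: "'v::finite \<Rightarrow> 'a::real_vector"
  shows "(\<Sum>i\<in>UNIV. x i - mean x) = 0"
  by (simp add: sum_subtractf mean_def sum_constant_scaleR)

text \<open>The cross term vanishes because deviations from the mean sum to 0. Hence any convenient
  reference point, such as the mean before a step or the value of one agent, may replace the mean in
  upper bounds.\<close>

lemma disagreement_le_sum:
  fixes x :: "'v::finite \<Rightarrow> 'a::real_inner"
  shows "disagreement x \<le> (\<Sum>i\<in>UNIV. (norm (x i - c))\<^sup>2)"
proof -
  have "(\<Sum>i\<in>UNIV. (norm (x i - c))\<^sup>2) =
      (\<Sum>i\<in>UNIV. (norm (x i - mean x))\<^sup>2 + 2 * inner (x i - mean x) (mean x - c) + (norm (mean x - c))\<^sup>2)"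
    by (rule sum.cong)
       (auto simp: power2_norm_eq_inner inner_diff_left inner_diff_right inner_commute algebra_simps)
  also have "\<dots> = disagreement x + 2 * inner (\<Sum>i\<in>UNIV. x i - mean x) (mean x - c)
      + (\<Sum>i\<in>(UNIV::'v set). (norm (mean x - c))\<^sup>2)"
    by (simp add: sum.distrib disagreement_def inner_sum_left sum_distrib_left)
  also have "\<dots> \<ge> disagreement x" unfolding sum_diff_mean by simp
  finally show ?thesis .
qed

lemma norm_mean_sq_le:
  fixes x :: "'v::finite \<Rightarrow> 'a::real_inner"
  shows "(norm (mean x - c))\<^sup>2 \<le> (\<Sum>i\<in>UNIV. (norm (x i - c))\<^sup>2)"
proof -
  have "mean x - c = (1 / real CARD('v)) *\<^sub>R (\<Sum>i\<in>UNIV. x i - c)"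
    by (simp add: mean_def sum_subtractf sum_constant_scaleR scaleR_diff_right)
  then have "(norm (mean x - c))\<^sup>2 = (norm (\<Sum>i\<in>UNIV. x i - c))\<^sup>2 / (real CARD('v))\<^sup>2"
    by (simp add: power_divide)
  also have "\<dots> \<le> (real CARD('v) * (\<Sum>i\<in>UNIV. (norm (x i - c))\<^sup>2)) / (real CARD('v))\<^sup>2"
  proof (rule divide_right_mono)
    have "(norm (\<Sum>i\<in>UNIV. x i - c))\<^sup>2 \<le> (\<Sum>i\<in>UNIV. 1 * norm (x i - c))\<^sup>2"
      by (intro power_mono) (auto intro: norm_sum)
    also have "\<dots> \<le> (\<Sum>i\<in>(UNIV::'v set). 1\<^sup>2) * (\<Sum>i\<in>UNIV. (norm (x i - c))\<^sup>2)"
      by (rule Cauchy_Schwarz_ineq_sum)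
    finally show "(norm (\<Sum>i\<in>UNIV. x i - c))\<^sup>2 \<le> real CARD('v) * (\<Sum>i\<in>UNIV. (norm (x i - c))\<^sup>2)" by simp
  qed simp
  also have "\<dots> = (\<Sum>i\<in>UNIV. (norm (x i - c))\<^sup>2) / real CARD('v)"
    by (simp add: power2_eq_square)
  also have "\<dots> \<le> (\<Sum>i\<in>UNIV. (norm (x i - c))\<^sup>2) / 1"
    by (intro divide_left_mono sum_nonneg) (auto simp: Suc_le_eq)
  finally show ?thesis by simp
qed

text \<open>Young's inequality. A small \<open>\<theta>\<close> keeps the leading factor close to 1,
  so that a contraction can absorb it.\<close>

lemma norm_add_sq_le:
  fixes u v :: "'a::real_inner"
  assumes "\<theta> > 0"
  shows "(norm (u + v))\<^sup>2 \<le> (1 + \<theta>) * (norm u)\<^sup>2 + (1 + 1 / \<theta>) * (norm v)\<^sup>2"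
proof -
  have "0 \<le> (norm (\<theta> *\<^sub>R u - v))\<^sup>2 / \<theta>" using assms by simp
  also have "\<dots> = \<theta> * (norm u)\<^sup>2 - 2 * inner u v + (norm v)\<^sup>2 / \<theta>"
    using assms unfolding power2_norm_eq_inner
    by (simp add: inner_diff_left inner_diff_right inner_commute field_simps power2_eq_square)
  finally show ?thesis
    by (simp add: power2_norm_eq_inner inner_add_left inner_add_right inner_commute algebra_simps)
qed

text \<open>The parallelogram law; the subtracted term is the decrease of disagreement achieved by
  one exchange.\<close>

lemma norm_midpoint_sq:
  fixes u v y :: "'a::real_inner"
  shows "2 * (norm ((1/2) *\<^sub>R (u + v) - y))\<^sup>2
    = (norm (u - y))\<^sup>2 + (norm (v - y))\<^sup>2 - (norm (u - v))\<^sup>2 / 2"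
  by (simp add: power2_norm_eq_inner inner_diff_left inner_diff_right inner_add_left inner_add_right
      inner_commute field_simps)

lemma infdist_midpoint_sq_le:
  fixes Y :: "'a::euclidean_space set"
  assumes "closed Y" "convex Y" "Y \<noteq> {}"
  shows "2 * (infdist ((1/2) *\<^sub>R (u + v)) Y)\<^sup>2 \<le> (infdist u Y)\<^sup>2 + (infdist v Y)\<^sup>2"
proof -
  let ?p = "closest_point Y u" and ?q = "closest_point Y v"
  have "?p \<in> Y" "?q \<in> Y" using assms closest_point_in_set by blast+
  then have "(1/2) *\<^sub>R ?p + (1/2) *\<^sub>R ?q \<in> Y"
    using assms by (intro convexD) auto
  then have "infdist ((1/2) *\<^sub>R (u + v)) Y \<le> norm ((1/2) *\<^sub>R (u + v) - ((1/2) *\<^sub>R ?p + (1/2) *\<^sub>R ?q))"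
    by (intro order_trans[OF infdist_le]) (auto simp: dist_norm)
  also have "\<dots> = norm ((u - ?p) + (v - ?q)) / 2"
  proof -
    have "(1/2) *\<^sub>R (u + v) - ((1/2) *\<^sub>R ?p + (1/2) *\<^sub>R ?q) = (1/2) *\<^sub>R ((u - ?p) + (v - ?q))"
      by (simp add: algebra_simps)
    then show ?thesis by simp
  qed
  finally have "(infdist ((1/2) *\<^sub>R (u + v)) Y)\<^sup>2 \<le> (norm ((u - ?p) + (v - ?q)) / 2)\<^sup>2"
    by (intro power_mono infdist_nonneg)
  also have "\<dots> \<le> ((norm (u - ?p))\<^sup>2 + (norm (v - ?q))\<^sup>2) / 2"
    using norm_add_sq_le[of 1 "u - ?p" "v - ?q"] by (simp add: power_divide)
  finally show ?thesis
    using assms by (simp add: infdist_eq_dist_closest_point dist_norm)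
qed

section \<open>Connectivity\<close>

text \<open>Induction along the path: the last edge has positive weight, so its squared difference
  is bounded by the weighted sum, and Young's inequality joins it to the rest of the path.\<close>

lemma norm_diff_sq_le_of_path:
  fixes E :: "'v::finite set set"
  assumes "(i, j) \<in> {(a, b). {a, b} \<in> E}\<^sup>*"
    and pos: "\<And>a b. {a, b} \<in> E \<Longrightarrow> q a b > 0" and nonneg: "\<And>a b. q a b \<ge> (0::real)"
  shows "\<exists>C\<ge>0. \<forall>x::'v \<Rightarrow> 'a::real_inner.
    (norm (x i - x j))\<^sup>2 \<le> C * (\<Sum>a\<in>UNIV. \<Sum>b\<in>UNIV. q a b * (norm (x a - x b))\<^sup>2)"
  using assms(1)
proof (induction rule: rtrancl_induct)
  case base
  show ?case by (rule exI[of _ 0]) simp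
next
  case (step j k)
  then obtain C where C: "C \<ge> 0"
    "\<And>x::'v \<Rightarrow> 'a. (norm (x i - x j))\<^sup>2 \<le> C * (\<Sum>a\<in>UNIV. \<Sum>b\<in>UNIV. q a b * (norm (x a - x b))\<^sup>2)"
    by blast
  have q: "q j k > 0" using step(2) pos by simp
  have "(norm (x i - x k))\<^sup>2 \<le> (2 * C + 2 / q j k) * (\<Sum>a\<in>UNIV. \<Sum>b\<in>UNIV. q a b * (norm (x a - x b))\<^sup>2)"
    for x :: "'v \<Rightarrow> 'a"
  proof -
    let ?Q = "\<Sum>a\<in>UNIV. \<Sum>b\<in>UNIV. q a b * (norm (x a - x b))\<^sup>2"
    have "q j k * (norm (x j - x k))\<^sup>2 \<le> (\<Sum>b\<in>UNIV. q j b * (norm (x j - x b))\<^sup>2)"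
      by (rule member_le_sum) (auto simp: nonneg)
    also have "\<dots> \<le> ?Q"
      by (rule member_le_sum[where f = "\<lambda>a. \<Sum>b\<in>UNIV. q a b * (norm (x a - x b))\<^sup>2"])
         (auto simp: nonneg intro!: sum_nonneg)
    finally have "(norm (x j - x k))\<^sup>2 \<le> 1 / q j k * ?Q" using q by (simp add: field_simps)
    moreover have "(norm (x i - x k))\<^sup>2 \<le> 2 * (norm (x i - x j))\<^sup>2 + 2 * (norm (x j - x k))\<^sup>2"
      using norm_add_sq_le[of 1 "x i - x j" "x j - x k"] by simp
    ultimately show ?thesis using C(2)[of x] by (simp add: algebra_simps)
  qed
  moreover have "2 * C + 2 / q j k \<ge> 0" using C q by simp
  ultimately show ?case by blast
qed

text \<open>A spectral gap estimate for the weighted graph, obtained from paths to one fixed agent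
  \<open>i0\<close>. The constant is not sharp; \<open>\<delta> \<le> 1\<close> keeps the later
  contraction factors nonnegative.\<close>

lemma disagreement_le_of_connected:
  fixes E :: "'v::finite set set"
  assumes conn: "connected_graph E"
    and pos: "\<And>a b. {a, b} \<in> E \<Longrightarrow> q a b > 0" and nonneg: "\<And>a b. q a b \<ge> (0::real)"
  obtains \<delta> where "0 < \<delta>" "\<delta> \<le> 1"
    "\<And>x::'v \<Rightarrow> 'a::real_inner.
      \<delta> * disagreement x \<le> (\<Sum>a\<in>UNIV. \<Sum>b\<in>UNIV. q a b * (norm (x a - x b))\<^sup>2) / 2"
proof -
  fix i0 :: 'v
  have "\<exists>C\<ge>0. \<forall>x::'v \<Rightarrow> 'a.
    (norm (x i - x i0))\<^sup>2 \<le> C * (\<Sum>a\<in>UNIV. \<Sum>b\<in>UNIV. q a b * (norm (x a - x b))\<^sup>2)" for i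
  proof (rule norm_diff_sq_le_of_path[where E = E])
    show "(i, i0) \<in> {(a, b). {a, b} \<in> E}\<^sup>*"
      using conn unfolding connected_graph_def by blast
  qed (fact pos nonneg)+
  then have "\<forall>i. \<exists>C. C \<ge> 0 \<and> (\<forall>x::'v \<Rightarrow> 'a.
    (norm (x i - x i0))\<^sup>2 \<le> C * (\<Sum>a\<in>UNIV. \<Sum>b\<in>UNIV. q a b * (norm (x a - x b))\<^sup>2))"
    by (intro allI) simp
  from choice[OF this] obtain C where C: "\<And>i. C i \<ge> 0" "\<And>i (x::'v \<Rightarrow> 'a).
    (norm (x i - x i0))\<^sup>2 \<le> C i * (\<Sum>a\<in>UNIV. \<Sum>b\<in>UNIV. q a b * (norm (x a - x b))\<^sup>2)"
    by auto
  \<comment> \<open>The added 1 excludes division by 0 and makes \<open>1 / (2 * B)\<close> at most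
    1.\<close>
  define B where "B = (\<Sum>i\<in>UNIV. C i) + 1"
  have B: "B \<ge> 1" using C(1) by (simp add: B_def sum_nonneg)
  show thesis
  proof (rule that[of "1 / (2 * B)"])
    fix x :: "'v \<Rightarrow> 'a"
    let ?Q = "\<Sum>a\<in>UNIV. \<Sum>b\<in>UNIV. q a b * (norm (x a - x b))\<^sup>2"
    have Q: "?Q \<ge> 0" by (intro sum_nonneg mult_nonneg_nonneg nonneg) auto
    have "disagreement x \<le> (\<Sum>i\<in>UNIV. (norm (x i - x i0))\<^sup>2)" by (rule disagreement_le_sum)
    also have "\<dots> \<le> (\<Sum>i\<in>UNIV. C i * ?Q)" by (intro sum_mono C)
    also have "\<dots> = (\<Sum>i\<in>UNIV. C i) * ?Q" by (rule sum_distrib_right[symmetric])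
    also have "\<dots> \<le> B * ?Q" using Q by (intro mult_right_mono) (auto simp: B_def)
    finally show "1 / (2 * B) * disagreement x \<le> ?Q / 2" using B by (simp add: field_simps)
  qed (use B in auto)
qed

section \<open>One step of the algorithm\<close>

text \<open>One update, detached from time and randomness. The averaging matrix acts as the midpoint
  on the two active agents and as the identity elsewhere, so only \<open>w\<close> occurs, and the
  stepsizes may be arbitrary.\<close>

definition gossip_step ::
    "'v \<Rightarrow> 'v \<Rightarrow> ('v \<Rightarrow> 'a::euclidean_space set) \<Rightarrow> ('v \<Rightarrow> 'a \<Rightarrow> 'a) \<Rightarrow> ('v \<Rightarrow> real) \<Rightarrow> ('v \<Rightarrow> 'a) \<Rightarrow> ('v \<Rightarrow> 'a) \<Rightarrow> bool" where
  "gossip_step a b C g \<alpha> x x' \<longleftrightarrow>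
     (\<forall>i. x' i = (let w = (1/2) *\<^sub>R (x a + x b) in
        if i \<in> {a, b} then closest_point (C i) (w - \<alpha> i *\<^sub>R g i w) else x i))"

lemma gossip_matrix_average:
  fixes x :: "'v::finite \<Rightarrow> 'a::real_vector"
  shows "(\<Sum>j\<in>UNIV. gossip_matrix a b $ i $ j *\<^sub>R x j) =
    (if i \<in> {a, b} then (1/2) *\<^sub>R (x a + x b) else x i)"
proof -
  have "gossip_matrix a b $ i $ j *\<^sub>R x j =
      (if j = i then x j else 0) -
      (1/2 * (of_bool (i = a) - of_bool (i = b))) *\<^sub>R ((if j = a then x j else 0) - (if j = b then x j else 0))" for j
    using scaleR_left_diff_distrib[of 1 "1/2" "x j"] by (auto simp: gossip_matrix_def mat_def axis_def)
  then have "(\<Sum>j\<in>UNIV. gossip_matrix a b $ i $ j *\<^sub>R x j) =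
      x i - (1/2 * (of_bool (i = a) - of_bool (i = b))) *\<^sub>R (x a - x b)"
    by (simp add: sum_subtractf flip: scaleR_right.sum)
  moreover have half: "u - (1/2) *\<^sub>R (u - v) = (1/2) *\<^sub>R (u + v)" for u v :: 'a
  proof -
    have "u - (1/2) *\<^sub>R (u - v) = (u - (1/2) *\<^sub>R u) + (1/2) *\<^sub>R v"
      by (simp add: scaleR_diff_right)
    also have "u - (1/2) *\<^sub>R u = (1/2) *\<^sub>R u" using scaleR_left_diff_distrib[of 1 "1/2" u] by simp
    finally show ?thesis by (simp add: scaleR_add_right)
  qed
  moreover have "x b - (- 1 / 2) *\<^sub>R (x a - x b) = (1/2) *\<^sub>R (x a + x b)"
    using half[of "x b" "x a"] by (simp add: algebra_simps)
  \<comment> \<open>For \<open>a = b\<close> the matrix is the identity, and the midpoint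
    degenerates to \<open>x a\<close>.\<close>
  moreover have "(1/2) *\<^sub>R (x a + x a) = x a" by (rule scaleR_half_double)
  ultimately show ?thesis
    by (cases "a = b"; cases "i = a"; cases "i = b") simp_all
qed

lemma grp_path_step:
  assumes "grp_path I J C g \<alpha> x" "k \<ge> 1"
  shows "gossip_step (I k) (J k) (\<lambda>i. C i k) g (\<lambda>i. \<alpha> i k) (\<lambda>i. x i (k - 1)) (\<lambda>i. x i k)"
  using assms unfolding grp_path_def gossip_step_def gossip_matrix_average Let_def by auto

lemma sum_split_pair:
  fixes F :: "'v::finite \<Rightarrow> 'b::ab_group_add"
  assumes "a \<noteq> b"
  shows "(\<Sum>i\<in>UNIV. F i) = (\<Sum>i\<in>UNIV - {a, b}. F i) + (F a + F b)"
proof -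
  have "(\<Sum>i\<in>UNIV. F i) = (\<Sum>i\<in>UNIV - {a, b}. F i) + (\<Sum>i\<in>{a, b}. F i)"
    by (subst sum.subset_diff[of "{a, b}" UNIV]) auto
  then show ?thesis using assms by simp
qed

section \<open>Deterministic estimates for one update of a convex problem\<close>

locale convex_problem =
  fixes Y :: "'a::euclidean_space set" and f :: "'v::finite \<Rightarrow> 'a \<Rightarrow> real" and g :: "'v \<Rightarrow> 'a \<Rightarrow> 'a"
    and L G :: real
  assumes Y: "closed Y" "convex Y" "Y \<noteq> {}"
    and convex: "\<And>i. convex_on UNIV (f i)"
    and gradient: "\<And>i y. GDERIV (f i) y :> g i y"
    and lipschitz: "\<And>i y z. norm (g i y - g i z) \<le> L * norm (y - z)"
    and bounded_gradient: "\<And>i y. y \<in> Y \<Longrightarrow> norm (g i y) \<le> G"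
    and L_nonneg: "L \<ge> 0"
begin

lemma G_nonneg: "G \<ge> 0"
  using Y(3) bounded_gradient norm_ge_zero order_trans by blast

lemma closest_point_in_Y: "closest_point Y v \<in> Y"
  using Y closest_point_in_set by blast

lemma norm_gradient_le: "norm (g i v) \<le> G + L * infdist v Y"
proof -
  let ?p = "closest_point Y v"
  have "norm (g i v) \<le> norm (g i ?p) + norm (g i v - g i ?p)"
    by (metis norm_triangle_sub add.commute)
  also have "\<dots> \<le> G + L * norm (v - ?p)"
    by (intro add_mono lipschitz bounded_gradient closest_point_in_Y)
  finally show ?thesis using Y by (simp add: infdist_eq_dist_closest_point dist_norm)
qed

lemma gradient_ineq: "f i v \<ge> f i p + inner (g i p) (v - p)"
  by (rule convex_on_gradient_ineq[OF convex gradient])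

text \<open>One-sided on purpose: convexity involves only the gradient at \<open>p\<close>, which is
  bounded by \<open>G\<close> because \<open>p\<close> is feasible, so \<open>v\<close> may lie
  anywhere.\<close>

lemma f_diff_ge:
  assumes "p \<in> Y"
  shows "f i v - f i p \<ge> - G * norm (v - p)"
proof -
  have "\<bar>inner (g i p) (v - p)\<bar> \<le> norm (g i p) * norm (v - p)" by (rule Cauchy_Schwarz_ineq2)
  also have "\<dots> \<le> G * norm (v - p)" by (intro mult_right_mono bounded_gradient assms) auto
  finally show ?thesis using gradient_ineq[of i p v] by linarith
qed

lemma f_lipschitz_on_Y:
  assumes "p \<in> Y" "q \<in> Y"
  shows "\<bar>f i p - f i q\<bar> \<le> G * norm (p - q)"
  using f_diff_ge[OF assms(1), of q i] f_diff_ge[OF assms(2), of p i]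
  by (simp add: norm_minus_commute abs_le_iff)

text \<open>\<open>\<tau>\<close> is a common bound for the two stepsizes in use. Distinct agents
  are assumed because a self-contact has probability 0.\<close>

context
  fixes a b :: 'v and C :: "'v \<Rightarrow> 'a set" and \<alpha> :: "'v \<Rightarrow> real" and x x' :: "'v \<Rightarrow> 'a" and \<tau> :: real
  assumes step: "gossip_step a b C g \<alpha> x x'" and ab: "a \<noteq> b"
    and C: "\<And>i. closed (C i)" "\<And>i. convex (C i)" "\<And>i. Y \<subseteq> C i"
    and \<alpha>: "\<And>i. i \<in> {a, b} \<Longrightarrow> 0 \<le> \<alpha> i" "\<And>i. i \<in> {a, b} \<Longrightarrow> \<alpha> i \<le> \<tau>"
begin

abbreviation (input) "w \<equiv> (1/2) *\<^sub>R (x a + x b)"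

lemma \<tau>_nonneg: "\<tau> \<ge> 0"
  using \<alpha>[of a] by simp

lemma step_active: "i \<in> {a, b} \<Longrightarrow> x' i = closest_point (C i) (w - \<alpha> i *\<^sub>R g i w)"
  and step_idle: "i \<notin> {a, b} \<Longrightarrow> x' i = x i"
  using step unfolding gossip_step_def Let_def by auto

lemma infdist_midpoint_sq: "2 * (infdist w Y)\<^sup>2 \<le> (infdist (x a) Y)\<^sup>2 + (infdist (x b) Y)\<^sup>2"
  using infdist_midpoint_sq_le Y by blast

lemma step_dist_le:
  assumes "y \<in> Y" "i \<in> {a, b}"
  shows "(norm (x' i - y))\<^sup>2 \<le> (norm (w - y))\<^sup>2 - 2 * \<alpha> i * inner (g i w) (w - y)
    + 2 * \<tau>\<^sup>2 * (G + L * infdist w Y)\<^sup>2 - (infdist w (C i))\<^sup>2 / 2"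
proof -
  have "(\<alpha> i)\<^sup>2 * (norm (g i w))\<^sup>2 \<le> \<tau>\<^sup>2 * (G + L * infdist w Y)\<^sup>2"
    using \<alpha>[OF assms(2)] by (intro mult_mono power_mono norm_gradient_le) auto
  moreover have "(norm (x' i - y))\<^sup>2 \<le> (norm (w - y))\<^sup>2 - 2 * \<alpha> i * inner (g i w) (w - y)
    + 2 * (\<alpha> i)\<^sup>2 * (norm (g i w))\<^sup>2 - (infdist w (C i))\<^sup>2 / 2"
    unfolding step_active[OF assms(2)] using assms C by (intro projected_step_le) auto
  ultimately show ?thesis by linarith
qed

text \<open>The projection of \<open>w\<close> on \<open>Y\<close> lies in every \<open>C i\<close>
  and serves as an intermediate point: projecting on \<open>C i\<close> brings nothing farther away
  from it, so only the length of the gradient step is added.\<close>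

lemma step_displacement:
  assumes "i \<in> {a, b}"
  shows "norm (x' i - w) \<le> 2 * infdist w Y + \<tau> * (G + L * infdist w Y)"
proof -
  let ?p = "closest_point Y w"
  have p: "norm (w - ?p) = infdist w Y" using Y by (simp add: infdist_eq_dist_closest_point dist_norm)
  have "norm (x' i - ?p) \<le> norm ((w - \<alpha> i *\<^sub>R g i w) - ?p)"
    unfolding step_active[OF assms] using C closest_point_in_Y[of w]
    by (intro norm_closest_point_diff_le) auto
  also have "\<dots> \<le> norm (w - ?p) + norm (\<alpha> i *\<^sub>R g i w)"
    using norm_triangle_ineq4[of "w - ?p" "\<alpha> i *\<^sub>R g i w"] by (simp add: algebra_simps)
  finally have "norm (x' i - ?p) \<le> infdist w Y + norm (\<alpha> i *\<^sub>R g i w)" using p by simp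
  moreover have "norm (x' i - w) \<le> norm (x' i - ?p) + norm (w - ?p)"
    using norm_triangle_ineq4[of "x' i - ?p" "w - ?p"] by simp
  moreover have "norm (\<alpha> i *\<^sub>R g i w) \<le> \<tau> * (G + L * infdist w Y)"
    using \<alpha>[OF assms] norm_gradient_le[of i w] by (auto intro!: mult_mono)
  ultimately show ?thesis using p by linarith
qed

text \<open>Distances are compared at the projection of \<open>w\<close> on \<open>Y\<close>. The
  gradient step contributes a term linear in \<open>G\<close>, one linear in \<open>L\<close> and a
  quadratic one; each uses up at most a third of \<open>\<eta>\<close>, the bound on
  \<open>\<tau>\<close> being what gives \<open>\<tau> * L \<le> \<eta> / 6\<close>.\<close>

lemma step_infdist_sq_le:
  assumes i: "i \<in> {a, b}" and \<eta>: "0 < \<eta>" "\<eta> \<le> 1" and \<tau>: "\<tau> \<le> \<eta> / (6 * (L + 1))"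
  shows "(infdist (x' i) Y)\<^sup>2 \<le> (1 + \<eta>) * (infdist w Y)\<^sup>2 + (3 / \<eta> + 4) * G\<^sup>2 * \<tau>\<^sup>2 - (infdist w (C i))\<^sup>2 / 2"
proof -
  let ?p = "closest_point Y w" and ?d = "infdist w Y"
  have d: "?d \<ge> 0" by (rule infdist_nonneg)
  have p: "norm (w - ?p) = ?d" using Y by (simp add: infdist_eq_dist_closest_point dist_norm)
  have \<tau>L: "\<tau> * L \<le> \<eta> / 6"
  proof -
    have "\<tau> * (L + 1) \<le> \<eta> / 6"
      using \<tau> L_nonneg by (simp add: field_simps)
    then show ?thesis using \<tau>_nonneg by (simp add: algebra_simps)
  qed
  have "(infdist (x' i) Y)\<^sup>2 \<le> (norm (x' i - ?p))\<^sup>2"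
    using infdist_le[OF closest_point_in_Y, of "x' i" w] by (intro power_mono infdist_nonneg) (simp add: dist_norm)
  moreover have "\<dots> \<le> ?d\<^sup>2 - 2 * \<alpha> i * inner (g i w) (w - ?p) + 2 * \<tau>\<^sup>2 * (G + L * ?d)\<^sup>2 - (infdist w (C i))\<^sup>2 / 2"
    using step_dist_le[OF closest_point_in_Y[of w] i] p by simp
  moreover have "- 2 * \<alpha> i * inner (g i w) (w - ?p) \<le> 2 * (\<tau> * ((G + L * ?d) * ?d))"
  proof -
    have "\<bar>inner (g i w) (w - ?p)\<bar> \<le> norm (g i w) * ?d"
      using Cauchy_Schwarz_ineq2[of "g i w" "w - ?p"] p by simp
    also have "\<dots> \<le> (G + L * ?d) * ?d" by (intro mult_right_mono norm_gradient_le d)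
    finally have "- inner (g i w) (w - ?p) \<le> (G + L * ?d) * ?d" by linarith
    then have "\<alpha> i * (- inner (g i w) (w - ?p)) \<le> \<alpha> i * ((G + L * ?d) * ?d)"
      using \<alpha>[OF i] by (intro mult_left_mono)
    also have "\<dots> \<le> \<tau> * ((G + L * ?d) * ?d)"
      using \<alpha>[OF i] d G_nonneg L_nonneg by (intro mult_right_mono) auto
    finally show ?thesis by (simp only: mult_minus_right mult_minus_left mult.assoc)
  qed
  moreover have "2 * (\<tau> * ((G + L * ?d) * ?d)) = 2 * (\<tau> * G) * ?d + 2 * (\<tau> * L) * ?d\<^sup>2"
    by (simp add: algebra_simps power2_eq_square)
  ultimately have *: "(infdist (x' i) Y)\<^sup>2 \<le> ?d\<^sup>2 + 2 * (\<tau> * G) * ?d + 2 * (\<tau> * L) * ?d\<^sup>2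
      + 2 * \<tau>\<^sup>2 * (G + L * ?d)\<^sup>2 - (infdist w (C i))\<^sup>2 / 2"
    by linarith
  have "2 * (\<tau> * G) * ?d \<le> 3 / \<eta> * G\<^sup>2 * \<tau>\<^sup>2 + \<eta> / 3 * ?d\<^sup>2"
  proof -
    have "0 \<le> 3 / \<eta> * (\<tau> * G - \<eta> / 3 * ?d)\<^sup>2" using \<eta> by simp
    also have "\<dots> = 3 / \<eta> * G\<^sup>2 * \<tau>\<^sup>2 + \<eta> / 3 * ?d\<^sup>2 - 2 * (\<tau> * G) * ?d"
      using \<eta> by (simp add: power2_eq_square field_simps)
    finally show ?thesis by simp
  qed
  moreover have "2 * (\<tau> * L) * ?d\<^sup>2 \<le> \<eta> / 3 * ?d\<^sup>2"
    using \<tau>L by (intro mult_right_mono) auto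
  moreover have "2 * \<tau>\<^sup>2 * (G + L * ?d)\<^sup>2 \<le> 4 * G\<^sup>2 * \<tau>\<^sup>2 + \<eta> / 3 * ?d\<^sup>2"
  proof -
    have "(G + L * ?d)\<^sup>2 \<le> 2 * G\<^sup>2 + 2 * (L * ?d)\<^sup>2"
      using zero_le_power2[of "G - L * ?d"] by (simp add: power2_sum power2_diff)
    then have "2 * \<tau>\<^sup>2 * (G + L * ?d)\<^sup>2 \<le> 2 * \<tau>\<^sup>2 * (2 * G\<^sup>2 + 2 * (L * ?d)\<^sup>2)"
      by (intro mult_left_mono) auto
    also have "\<dots> = 4 * G\<^sup>2 * \<tau>\<^sup>2 + 4 * (\<tau> * L)\<^sup>2 * ?d\<^sup>2"
      by (simp add: power_mult_distrib algebra_simps)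
    also have "4 * (\<tau> * L)\<^sup>2 * ?d\<^sup>2 \<le> \<eta> / 3 * ?d\<^sup>2"
    proof (rule mult_right_mono)
      have "(\<tau> * L)\<^sup>2 \<le> (\<eta> / 6)\<^sup>2" using \<tau>L \<tau>_nonneg L_nonneg by (intro power_mono) auto
      also have "\<dots> \<le> \<eta> / 36" using \<eta> by (simp add: power2_eq_square)
      finally show "4 * (\<tau> * L)\<^sup>2 \<le> \<eta> / 3" using \<eta> by simp
    qed simp
    finally show ?thesis by simp
  qed
  moreover have "(1 + \<eta>) * ?d\<^sup>2 + (3 / \<eta> + 4) * G\<^sup>2 * \<tau>\<^sup>2 =
    ?d\<^sup>2 + \<eta> / 3 * ?d\<^sup>2 + \<eta> / 3 * ?d\<^sup>2 + \<eta> / 3 * ?d\<^sup>2 + (3 / \<eta> * G\<^sup>2 * \<tau>\<^sup>2 + 4 * G\<^sup>2 * \<tau>\<^sup>2)"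
    by (simp add: algebra_simps)
  ultimately show ?thesis using * by linarith
qed

text \<open>Measured from the old mean, replacing two values by their midpoint gains half of their
  squared difference. Projection and gradient then move the active agents away from
  \<open>w\<close>, and Young's inequality charges this movement separately.\<close>

lemma step_disagreement_le:
  assumes \<theta>: "\<theta> > 0"
  shows "disagreement x' \<le> (1 + \<theta>) * (disagreement x - (norm (x a - x b))\<^sup>2 / 2)
    + (1 + 1 / \<theta>) * ((norm (x' a - w))\<^sup>2 + (norm (x' b - w))\<^sup>2)"
proof -
  let ?m = "mean x"
  have active: "(norm (x' i - ?m))\<^sup>2 \<le> (1 + \<theta>) * (norm (w - ?m))\<^sup>2 + (1 + 1 / \<theta>) * (norm (x' i - w))\<^sup>2" for i
    using norm_add_sq_le[OF \<theta>, of "w - ?m" "x' i - w"] by simp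
  have idle: "(\<Sum>i\<in>UNIV - {a, b}. (norm (x' i - ?m))\<^sup>2) \<le> (1 + \<theta>) * (\<Sum>i\<in>UNIV - {a, b}. (norm (x i - ?m))\<^sup>2)"
    unfolding sum_distrib_left using \<theta> by (intro sum_mono) (auto simp: step_idle mult_le_cancel_right1)
  have "disagreement x' \<le> (\<Sum>i\<in>UNIV. (norm (x' i - ?m))\<^sup>2)" by (rule disagreement_le_sum)
  also have "\<dots> = (\<Sum>i\<in>UNIV - {a, b}. (norm (x' i - ?m))\<^sup>2) + ((norm (x' a - ?m))\<^sup>2 + (norm (x' b - ?m))\<^sup>2)"
    by (rule sum_split_pair[OF ab])
  also have "\<dots> \<le> (1 + \<theta>) * (\<Sum>i\<in>UNIV - {a, b}. (norm (x i - ?m))\<^sup>2) + ((1 + \<theta>) * (2 * (norm (w - ?m))\<^sup>2)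
      + (1 + 1 / \<theta>) * ((norm (x' a - w))\<^sup>2 + (norm (x' b - w))\<^sup>2))"
    using idle active[of a] active[of b] by (simp add: algebra_simps)
  also have "2 * (norm (w - ?m))\<^sup>2 = (norm (x a - ?m))\<^sup>2 + (norm (x b - ?m))\<^sup>2 - (norm (x a - x b))\<^sup>2 / 2"
    by (rule norm_midpoint_sq)
  also have "(1 + \<theta>) * (\<Sum>i\<in>UNIV - {a, b}. (norm (x i - ?m))\<^sup>2) + ((1 + \<theta>) * \<dots>
      + (1 + 1 / \<theta>) * ((norm (x' a - w))\<^sup>2 + (norm (x' b - w))\<^sup>2)) =
      (1 + \<theta>) * (disagreement x - (norm (x a - x b))\<^sup>2 / 2)
    + (1 + 1 / \<theta>) * ((norm (x' a - w))\<^sup>2 + (norm (x' b - w))\<^sup>2)"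
    unfolding disagreement_def sum_split_pair[OF ab, of "\<lambda>i. (norm (x i - ?m))\<^sup>2"]
    by (simp add: algebra_simps)
  finally show ?thesis .
qed

text \<open>When \<open>c\<close> is the constant of the set regularity assumption, the last sum has nonpositive
  conditional expectation given the past and the active pair.\<close>

lemma step_potential_le:
  assumes c: "c \<ge> 1" and \<delta>: "0 < \<delta>" "\<delta> \<le> 1" and \<tau>: "\<tau> \<le> 1 / (24 * c * (L + 1))"
  defines "\<kappa> \<equiv> 1 / (16 * c * (1 + 2 / \<delta>) * (2 + L)\<^sup>2)"
  shows "infeasibility Y x' + \<kappa> * disagreement x'
    \<le> infeasibility Y x - ((infdist (x a) Y)\<^sup>2 + (infdist (x b) Y)\<^sup>2) / (8 * c)
      + \<kappa> * (1 + \<delta> / 2) * (disagreement x - (norm (x a - x b))\<^sup>2 / 2)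
      + (2 * (12 * c + 4) * G\<^sup>2 + 4 * \<kappa> * (1 + 2 / \<delta>) * G\<^sup>2) * \<tau>\<^sup>2
      + (\<Sum>i\<in>{a, b}. (infdist w Y)\<^sup>2 / (2 * c) - (infdist w (C i))\<^sup>2 / 2)"
proof -
  define d where "d = infdist w Y"
  define s where "s = (infdist (x a) Y)\<^sup>2 + (infdist (x b) Y)\<^sup>2"
  define ca where "ca = (infdist w (C a))\<^sup>2"
  define cb where "cb = (infdist w (C b))\<^sup>2"
  \<comment> \<open>Regularity returns \<open>4 * \<eta> * d\<^sup>2\<close> in expectation. The
    gradient steps consume \<open>2 * \<eta> * d\<^sup>2\<close>, the new disagreement
    \<open>\<eta> * d\<^sup>2\<close>, and the remaining \<open>\<eta> * d\<^sup>2\<close> leaves,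
    through \<open>2 * d\<^sup>2 \<le> s\<close>, the decrease \<open>s / (8 * c)\<close>.\<close>
  define \<eta> where "\<eta> = 1 / (4 * c)"
  have \<eta>: "0 < \<eta>" "\<eta> \<le> 1" using c by (auto simp: \<eta>_def)
  have \<eta>c: "3 / \<eta> = 12 * c" "1 / (2 * c) = 2 * \<eta>" "1 / (8 * c) = \<eta> / 2" using c by (auto simp: \<eta>_def)
  have \<kappa>: "\<kappa> > 0" using c \<delta> L_nonneg by (simp add: \<kappa>_def add_pos_pos)
  have L2: "2 + L > 0" using L_nonneg by simp
  have D2: "1 + 2 / \<delta> > 0" using \<delta> by (simp add: add_pos_pos)
  \<comment> \<open>The value of \<open>\<kappa>\<close> comes from this identity: displacement
    raises the weighted disagreement by just the share \<open>\<eta> * d\<^sup>2\<close> reserved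
    for it.\<close>
  have \<kappa>d: "\<kappa> * (1 + 2 / \<delta>) * (4 * (2 + L)\<^sup>2) = \<eta>"
    using c D2 L2 unfolding \<kappa>_def \<eta>_def by simp
  have d2: "2 * d\<^sup>2 \<le> s" unfolding d_def s_def by (rule infdist_midpoint_sq)
  have \<tau>': "\<tau> \<le> \<eta> / (6 * (L + 1))" using \<tau> by (simp add: \<eta>_def algebra_simps)
  have \<tau>1: "\<tau> \<le> 1"
  proof -
    have "1 * (1 * 1) \<le> 24 * (c * (L + 1))" using c L_nonneg by (intro mult_mono) auto
    then have "1 / (24 * c * (L + 1)) \<le> 1" by (simp add: mult.assoc)
    then show ?thesis using \<tau> by linarith
  qed
  have inf: "(infdist (x' i) Y)\<^sup>2 \<le> (1 + \<eta>) * d\<^sup>2 + (12 * c + 4) * G\<^sup>2 * \<tau>\<^sup>2 - (infdist w (C i))\<^sup>2 / 2"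
    if "i \<in> {a, b}" for i
    using step_infdist_sq_le[OF that \<eta> \<tau>'] unfolding \<eta>c d_def .
  have "infeasibility Y x' = (\<Sum>i\<in>UNIV - {a, b}. (infdist (x i) Y)\<^sup>2) + ((infdist (x' a) Y)\<^sup>2 + (infdist (x' b) Y)\<^sup>2)"
    unfolding infeasibility_def sum_split_pair[OF ab, of "\<lambda>i. (infdist (x' i) Y)\<^sup>2"]
    by (auto simp: step_idle intro!: sum.cong)
  moreover have "infeasibility Y x = (\<Sum>i\<in>UNIV - {a, b}. (infdist (x i) Y)\<^sup>2) + s"
    unfolding infeasibility_def sum_split_pair[OF ab, of "\<lambda>i. (infdist (x i) Y)\<^sup>2"] s_def ..
  ultimately have S: "infeasibility Y x' \<le> infeasibility Y x - s + 2 * ((1 + \<eta>) * d\<^sup>2)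
      + 2 * ((12 * c + 4) * G\<^sup>2 * \<tau>\<^sup>2) - ca / 2 - cb / 2"
    using inf[of a] inf[of b] by (simp add: ca_def cb_def)
  have disp: "(norm (x' i - w))\<^sup>2 \<le> 2 * (2 + L)\<^sup>2 * d\<^sup>2 + 2 * G\<^sup>2 * \<tau>\<^sup>2" if "i \<in> {a, b}" for i
  proof -
    have d0: "d \<ge> 0" by (simp add: d_def infdist_nonneg)
    have "norm (x' i - w) \<le> 2 * d + \<tau> * (G + L * d)"
      using step_displacement[OF that] by (simp add: d_def)
    also have "\<dots> \<le> (2 + L) * d + \<tau> * G"
      using mult_right_mono[OF \<tau>1, of "L * d"] d0 L_nonneg by (simp add: algebra_simps)
    finally have "(norm (x' i - w))\<^sup>2 \<le> ((2 + L) * d + \<tau> * G)\<^sup>2" by (intro power_mono) auto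
    also have "\<dots> \<le> 2 * ((2 + L) * d)\<^sup>2 + 2 * (\<tau> * G)\<^sup>2"
      using zero_le_power2[of "(2 + L) * d - \<tau> * G"] by (simp add: power2_sum power2_diff)
    finally show ?thesis by (simp only: power_mult_distrib mult.assoc mult.commute[of "\<tau>\<^sup>2"])
  qed
  have "disagreement x' \<le> (1 + \<delta> / 2) * (disagreement x - (norm (x a - x b))\<^sup>2 / 2)
    + (1 + 2 / \<delta>) * ((norm (x' a - w))\<^sup>2 + (norm (x' b - w))\<^sup>2)"
    using step_disagreement_le[of "\<delta> / 2"] \<delta> by simp
  also have "\<dots> \<le> (1 + \<delta> / 2) * (disagreement x - (norm (x a - x b))\<^sup>2 / 2)
    + (1 + 2 / \<delta>) * (4 * (2 + L)\<^sup>2 * d\<^sup>2 + 4 * G\<^sup>2 * \<tau>\<^sup>2)"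
    using disp[of a] disp[of b] \<delta> by (intro add_left_mono mult_left_mono) auto
  finally have "\<kappa> * disagreement x' \<le> \<kappa> * ((1 + \<delta> / 2) * (disagreement x - (norm (x a - x b))\<^sup>2 / 2)
    + (1 + 2 / \<delta>) * (4 * (2 + L)\<^sup>2 * d\<^sup>2 + 4 * G\<^sup>2 * \<tau>\<^sup>2))"
    using \<kappa> by (intro mult_left_mono) auto
  also have "\<dots> = \<kappa> * (1 + \<delta> / 2) * (disagreement x - (norm (x a - x b))\<^sup>2 / 2)
      + (\<kappa> * (1 + 2 / \<delta>) * (4 * (2 + L)\<^sup>2)) * d\<^sup>2 + 4 * \<kappa> * (1 + 2 / \<delta>) * G\<^sup>2 * \<tau>\<^sup>2"
  proof -
    have "k * (A * B + C * (4 * M * e + 4 * h * t)) = k * A * B + k * C * (4 * M) * e + 4 * k * C * h * t"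
      for k A B C M e h t :: real by (simp add: algebra_simps)
    then show ?thesis .
  qed
  also have "\<dots> = \<kappa> * (1 + \<delta> / 2) * (disagreement x - (norm (x a - x b))\<^sup>2 / 2)
      + \<eta> * d\<^sup>2 + 4 * \<kappa> * (1 + 2 / \<delta>) * G\<^sup>2 * \<tau>\<^sup>2"
    unfolding \<kappa>d ..
  finally have D: "\<kappa> * disagreement x' \<le> \<kappa> * (1 + \<delta> / 2) * (disagreement x - (norm (x a - x b))\<^sup>2 / 2)
      + \<eta> * d\<^sup>2 + 4 * \<kappa> * (1 + 2 / \<delta>) * G\<^sup>2 * \<tau>\<^sup>2" .
  have "(2 - \<eta>) * d\<^sup>2 \<le> (1 - \<eta> / 2) * s"
    using mult_left_mono[OF d2, of "1 - \<eta> / 2"] \<eta> by (simp add: algebra_simps)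
  then have d3: "2 * ((1 + \<eta>) * d\<^sup>2) + \<eta> * d\<^sup>2 \<le> s - \<eta> / 2 * s + 2 * (2 * \<eta> * d\<^sup>2)"
    by (simp add: algebra_simps)
  have E: "(\<Sum>i\<in>{a, b}. d\<^sup>2 / (2 * c) - (infdist w (C i))\<^sup>2 / 2) = 2 * (2 * \<eta> * d\<^sup>2) - ca / 2 - cb / 2"
    using ab unfolding ca_def cb_def \<eta>_def by simp
  have F: "s / (8 * c) = \<eta> / 2 * s" unfolding \<eta>_def by simp
  show ?thesis
    unfolding d_def[symmetric] s_def[symmetric] E F distrib_right[of _ _ "\<tau>\<^sup>2"]
    using S D d3 by linarith
qed

text \<open>The gradient is taken at \<open>w\<close>, but the objective is compared at a feasible
  \<open>p\<close>, since only on \<open>Y\<close> are the values Lipschitz with constant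
  \<open>G\<close>; the exchange costs \<open>G * norm (w - p)\<close>. What averaging and
  projection gain is given up here.\<close>

lemma step_sum_dist_le:
  assumes y: "y \<in> Y" and p: "p \<in> Y"
  shows "(\<Sum>i\<in>UNIV. (norm (x' i - y))\<^sup>2) \<le> (\<Sum>i\<in>UNIV. (norm (x i - y))\<^sup>2)
    - 2 * (\<Sum>i\<in>{a, b}. \<alpha> i * (f i p - f i y))
    + (4 * \<tau> * G * norm (w - p) + 4 * \<tau>\<^sup>2 * (G + L * infdist w Y)\<^sup>2)"
proof -
  let ?e = "\<tau> * (G * norm (w - p))" and ?h = "\<tau>\<^sup>2 * (G + L * infdist w Y)\<^sup>2"
  have active: "(norm (x' i - y))\<^sup>2 \<le> (norm (w - y))\<^sup>2 - 2 * (\<alpha> i * (f i p - f i y)) + 2 * ?e + 2 * ?h"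
    if i: "i \<in> {a, b}" for i
  proof -
    have "inner (g i w) (w - y) \<ge> f i w - f i y"
      using gradient_ineq[of i w y] inner_minus_right[of "g i w" "w - y"] by simp
    moreover have "f i w - f i p \<ge> - G * norm (w - p)" by (rule f_diff_ge[OF p])
    ultimately have "inner (g i w) (w - y) \<ge> (f i p - f i y) - G * norm (w - p)" by linarith
    then have "\<alpha> i * inner (g i w) (w - y) \<ge> \<alpha> i * ((f i p - f i y) - G * norm (w - p))"
      using \<alpha>[OF i] by (intro mult_left_mono)
    moreover have "\<alpha> i * (G * norm (w - p)) \<le> ?e"
      using \<alpha>[OF i] G_nonneg by (intro mult_right_mono) auto
    ultimately have "\<alpha> i * inner (g i w) (w - y) \<ge> \<alpha> i * (f i p - f i y) - ?e"
      by (simp add: right_diff_distrib)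
    then show ?thesis using step_dist_le[OF y i] zero_le_power2[of "infdist w (C i)"] by linarith
  qed
  have "2 * (norm (w - y))\<^sup>2 \<le> (norm (x a - y))\<^sup>2 + (norm (x b - y))\<^sup>2"
    unfolding norm_midpoint_sq by simp
  then have "(norm (x' a - y))\<^sup>2 + (norm (x' b - y))\<^sup>2 \<le> (norm (x a - y))\<^sup>2 + (norm (x b - y))\<^sup>2
     - 2 * (\<alpha> a * (f a p - f a y) + \<alpha> b * (f b p - f b y)) + 4 * ?e + 4 * ?h"
    using active[of a] active[of b] by (simp add: algebra_simps)
  moreover have "(\<Sum>i\<in>UNIV - {a, b}. (norm (x' i - y))\<^sup>2) = (\<Sum>i\<in>UNIV - {a, b}. (norm (x i - y))\<^sup>2)"
    by (rule sum.cong) (auto simp: step_idle)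
  ultimately show ?thesis
    unfolding sum_split_pair[OF ab] using ab by (simp add: algebra_simps)
qed

text \<open>Averaging preserves the mean, so it moves only through the displacements of the two
  active agents from \<open>w\<close>; the factor \<open>1 / real CARD('v)\<close> is
  dropped.\<close>

lemma step_mean_le:
  "norm (mean x' - mean x) \<le> 4 * infdist w Y + 2 * \<tau> * (G + L * infdist w Y)"
proof -
  have "(\<Sum>i\<in>UNIV. x' i) - (\<Sum>i\<in>UNIV. x i) = (x' a - w) + (x' b - w)"
  proof -
    have "(\<Sum>i\<in>UNIV - {a, b}. x' i) = (\<Sum>i\<in>UNIV - {a, b}. x i)"
      by (rule sum.cong) (auto simp: step_idle)
    then show ?thesis unfolding sum_split_pair[OF ab]
      by (simp add: algebra_simps flip: scaleR_add_left)
  qed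
  then have "mean x' - mean x = (1 / real CARD('v)) *\<^sub>R ((x' a - w) + (x' b - w))"
    by (simp add: mean_def flip: scaleR_diff_right)
  then have "norm (mean x' - mean x) = norm ((x' a - w) + (x' b - w)) / real CARD('v)" by simp
  also have "\<dots> \<le> norm ((x' a - w) + (x' b - w)) / 1"
    by (intro divide_left_mono) (auto simp: Suc_le_eq)
  also have "\<dots> \<le> norm (x' a - w) + norm (x' b - w)" using norm_triangle_ineq by simp
  also have "\<dots> \<le> 4 * infdist w Y + 2 * \<tau> * (G + L * infdist w Y)"
    using step_displacement[of a] step_displacement[of b] by simp
  finally show ?thesis .
qed

lemma infdist_midpoint_le_sqrt: "infdist w Y \<le> sqrt (infeasibility Y x + disagreement x)"
proof -
  have "2 * (infdist w Y)\<^sup>2 \<le> infeasibility Y x + infeasibility Y x"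
    using infdist_midpoint_sq infdist_sq_le[of x a Y] infdist_sq_le[of x b Y] by linarith
  then show ?thesis using disagreement_nonneg[of x] by (intro real_le_rsqrt) auto
qed

lemma norm_midpoint_closest_le: "norm (w - closest_point Y (mean x)) \<le> 3 * sqrt (infeasibility Y x + disagreement x)"
proof -
  let ?m = "mean x"
  have "2 * (norm (w - ?m))\<^sup>2 \<le> disagreement x + disagreement x"
    unfolding norm_midpoint_sq using norm_diff_mean_sq_le[of x a] norm_diff_mean_sq_le[of x b]
      zero_le_power2[of "norm (x a - x b)"] by linarith
  then have wm: "norm (w - ?m) \<le> sqrt (infeasibility Y x + disagreement x)"
    using infeasibility_nonneg[of Y x] by (intro real_le_rsqrt) auto
  have "norm (w - closest_point Y ?m) \<le> norm (w - ?m) + infdist ?m Y"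
    using Y norm_triangle_ineq[of "w - ?m" "?m - closest_point Y ?m"]
    by (simp add: infdist_eq_dist_closest_point dist_norm)
  also have "infdist ?m Y \<le> infdist w Y + norm (w - ?m)"
    using infdist_triangle[of ?m Y w] by (simp add: dist_norm norm_minus_commute)
  finally show ?thesis using wm infdist_midpoint_le_sqrt by simp
qed

end

end

text \<open>Every agent wakes with probability at least \<open>\<mu>\<close>, which makes the
  infeasibility decrease; the spectral gap \<open>\<delta>\<close> does so for the disagreement,
  because \<open>(1 + \<delta> / 2) * (1 - \<delta>) \<le> 1 - \<delta> / 2\<close> leaves a
  contraction after the loss in Young's inequality.\<close>

lemma expected_potential_le:
  fixes q :: "'v::finite \<Rightarrow> 'v \<Rightarrow> real" and x :: "'v \<Rightarrow> 'a::euclidean_space"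
  assumes q: "\<And>a b. q a b \<ge> 0" "(\<Sum>a\<in>UNIV. \<Sum>b\<in>UNIV. q a b) = 1" "\<And>a. (\<Sum>b\<in>UNIV. q a b) \<ge> \<mu>"
    and \<delta>: "0 < \<delta>" "\<delta> \<le> 1" "\<delta> * disagreement x \<le> (\<Sum>a\<in>UNIV. \<Sum>b\<in>UNIV. q a b * (norm (x a - x b))\<^sup>2) / 2"
    and c: "c > 0" and \<kappa>: "\<kappa> \<ge> 0"
  shows "(\<Sum>a\<in>UNIV. \<Sum>b\<in>UNIV. q a b *
      (infeasibility Y x - ((infdist (x a) Y)\<^sup>2 + (infdist (x b) Y)\<^sup>2) / (8 * c)
      + \<kappa> * (1 + \<delta> / 2) * (disagreement x - (norm (x a - x b))\<^sup>2 / 2) + B))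
    \<le> (1 - min (\<mu> / (8 * c)) (\<delta> / 2)) * (infeasibility Y x + \<kappa> * disagreement x) + B"
proof -
  let ?S = "infeasibility Y x" and ?D = "disagreement x"
  let ?Q = "\<Sum>a\<in>UNIV. \<Sum>b\<in>UNIV. q a b * (norm (x a - x b))\<^sup>2"
  let ?R = "\<Sum>a\<in>UNIV. \<Sum>b\<in>UNIV. q a b * ((infdist (x a) Y)\<^sup>2 + (infdist (x b) Y)\<^sup>2)"
  have "(\<Sum>a\<in>UNIV. \<Sum>b\<in>UNIV. q a b *
      (?S - ((infdist (x a) Y)\<^sup>2 + (infdist (x b) Y)\<^sup>2) / (8 * c)
      + \<kappa> * (1 + \<delta> / 2) * (?D - (norm (x a - x b))\<^sup>2 / 2) + B))
    = (\<Sum>a\<in>UNIV. \<Sum>b\<in>UNIV. q a b * (?S + \<kappa> * (1 + \<delta> / 2) * ?D + B)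
        - q a b * ((infdist (x a) Y)\<^sup>2 + (infdist (x b) Y)\<^sup>2) * (1 / (8 * c))
        - q a b * (norm (x a - x b))\<^sup>2 * (\<kappa> * (1 + \<delta> / 2) / 2))"
    by (intro sum.cong refl) (simp add: algebra_simps add_divide_distrib)
  also have "\<dots> = (\<Sum>a\<in>UNIV. \<Sum>b\<in>UNIV. q a b) * (?S + \<kappa> * (1 + \<delta> / 2) * ?D + B)
      - ?R * (1 / (8 * c)) - ?Q * (\<kappa> * (1 + \<delta> / 2) / 2)"
    by (simp only: sum_subtractf sum_distrib_right)
  also have "\<dots> = (?S - ?R * (1 / (8 * c))) + \<kappa> * (1 + \<delta> / 2) * (?D - ?Q / 2) + B"
    unfolding q(2) by (simp add: algebra_simps)
  also have "\<dots> \<le> (1 - \<mu> / (8 * c)) * ?S + \<kappa> * ((1 - \<delta> / 2) * ?D) + B"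
  proof -
    have "\<mu> * ?S = (\<Sum>a\<in>UNIV. \<mu> * (infdist (x a) Y)\<^sup>2)"
      unfolding infeasibility_def by (rule sum_distrib_left)
    also have "\<dots> \<le> (\<Sum>a\<in>UNIV. (\<Sum>b\<in>UNIV. q a b) * (infdist (x a) Y)\<^sup>2)"
      by (intro sum_mono mult_right_mono q) auto
    also have "\<dots> \<le> ?R"
      unfolding sum_distrib_right by (intro sum_mono mult_left_mono q) auto
    finally have "\<mu> * ?S * (1 / (8 * c)) \<le> ?R * (1 / (8 * c))" using c by (intro mult_right_mono) auto
    moreover have "(1 + \<delta> / 2) * (?D - ?Q / 2) \<le> (1 - \<delta> / 2) * ?D"
    proof -
      have "?D - ?Q / 2 \<le> (1 - \<delta>) * ?D" using \<delta>(3) by (simp add: algebra_simps)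
      then have "(1 + \<delta> / 2) * (?D - ?Q / 2) \<le> (1 + \<delta> / 2) * ((1 - \<delta>) * ?D)"
        using \<delta> by (intro mult_left_mono) auto
      also have "\<dots> = (1 - \<delta> / 2) * ?D - \<delta>\<^sup>2 / 2 * ?D" by (simp add: algebra_simps power2_eq_square)
      also have "\<dots> \<le> (1 - \<delta> / 2) * ?D" using disagreement_nonneg[of x] by simp
      finally show ?thesis .
    qed
    then have "\<kappa> * ((1 + \<delta> / 2) * (?D - ?Q / 2)) \<le> \<kappa> * ((1 - \<delta> / 2) * ?D)"
      using \<kappa> by (intro mult_left_mono)
    moreover have "(1 - \<mu> / (8 * c)) * ?S = ?S - \<mu> * ?S * (1 / (8 * c))"
      by (simp add: left_diff_distrib)
    ultimately show ?thesis unfolding mult.assoc by linarith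
  qed
  also have "\<dots> \<le> (1 - min (\<mu> / (8 * c)) (\<delta> / 2)) * ?S + \<kappa> * ((1 - min (\<mu> / (8 * c)) (\<delta> / 2)) * ?D) + B"
    using infeasibility_nonneg[of Y x] disagreement_nonneg[of x] \<kappa>
    by (intro add_mono mult_left_mono mult_right_mono) auto
  finally show ?thesis by (simp add: algebra_simps)
qed

section \<open>Real sequences\<close>

text \<open>Summing the recursion, a bound \<open>B\<close> on the partial sums reproduces itself if
  \<open>r K + \<sigma> * B + suminf s = B\<close>, which dictates the value of
  \<open>B\<close>.\<close>

lemma summable_of_contraction:
  fixes r s :: "nat \<Rightarrow> real"
  assumes rec: "\<forall>\<^sub>F k in sequentially. r (Suc k) \<le> \<sigma> * r k + s k"
    and r: "\<And>k. r k \<ge> 0" and \<sigma>: "0 \<le> \<sigma>" "\<sigma> < 1" and s: "summable s" "\<And>k. s k \<ge> 0"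
  shows "summable r"
proof -
  obtain K where K: "\<And>k. k \<ge> K \<Longrightarrow> r (Suc k) \<le> \<sigma> * r k + s k"
    using rec unfolding eventually_sequentially by blast
  define B where "B = (r K + suminf s) / (1 - \<sigma>)"
  have "(\<Sum>k<n. r (k + K)) \<le> B" for n
  proof (induction n)
    case 0
    then show ?case using r \<sigma> s by (simp add: B_def suminf_nonneg)
  next
    case (Suc n)
    have "(\<Sum>k<Suc n. r (k + K)) = r K + (\<Sum>k<n. r (Suc (k + K)))"
      by (subst sum.lessThan_Suc_shift) simp
    also have "\<dots> \<le> r K + (\<Sum>k<n. \<sigma> * r (k + K) + s (k + K))"
      using K by (intro add_left_mono sum_mono) simp
    also have "\<dots> = r K + \<sigma> * (\<Sum>k<n. r (k + K)) + (\<Sum>k<n. s (k + K))"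
      by (simp add: sum.distrib sum_distrib_left)
    also have "(\<Sum>k<n. s (k + K)) \<le> suminf s"
    proof -
      have "(\<Sum>k<n. s (k + K)) = (\<Sum>k=K..<n + K. s k)"
        by (simp add: sum.shift_bounds_nat_ivl[of s 0 K n, simplified] atLeast0LessThan)
      also have "\<dots> \<le> suminf s" by (intro sum_le_suminf s) auto
      finally show ?thesis .
    qed
    also have "r K + \<sigma> * (\<Sum>k<n. r (k + K)) + suminf s \<le> r K + \<sigma> * B + suminf s"
      using Suc \<sigma> by (intro add_mono mult_left_mono) auto
    also have "\<dots> = B" using \<sigma> by (simp add: B_def field_simps)
    finally show ?case by simp
  qed
  then have "summable (\<lambda>k. r (k + K))"
    by (intro summableI_nonneg_bounded[of _ B] r)
  then show ?thesis by simp
qed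

text \<open>The weight grows more slowly than any geometric sequence: its successive ratios are
  eventually below \<open>1 + \<rho>\<close>, and \<open>(1 - \<rho>) * (1 + \<rho>) < 1\<close>.
  The weighted error is of order \<open>k powr (- 5/4)\<close>, hence summable.\<close>

lemma summable_powr_mult_of_contraction:
  fixes q :: "nat \<Rightarrow> real"
  assumes rec: "\<forall>\<^sub>F k in sequentially. q (Suc k) \<le> (1 - \<rho>) * q k + C / (real (Suc k))\<^sup>2"
    and q: "\<And>k. q k \<ge> 0" and \<rho>: "0 < \<rho>" "\<rho> \<le> 1" and C: "C \<ge> 0"
  shows "summable (\<lambda>k. real k powr (3/4) * q k)"
proof (rule summable_of_contraction[where \<sigma> = "(1 - \<rho>) * (1 + \<rho>)"])
  have "((\<lambda>k. real (Suc k) powr (3/4) / real k powr (3/4)) \<longlonglongrightarrow> 1)"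
    by real_asymp
  then have "\<forall>\<^sub>F k in sequentially. real (Suc k) powr (3/4) / real k powr (3/4) < 1 + \<rho>"
    using \<rho> by (intro order_tendstoD) auto
  then show "\<forall>\<^sub>F k in sequentially. real (Suc k) powr (3/4) * q (Suc k)
    \<le> (1 - \<rho>) * (1 + \<rho>) * (real k powr (3/4) * q k) + C * real (Suc k) powr (- 5/4)"
    using rec eventually_gt_at_top[of 0]
  proof eventually_elim
    case (elim k)
    have "real (Suc k) powr (3/4) * q (Suc k)
        \<le> real (Suc k) powr (3/4) * ((1 - \<rho>) * q k + C / (real (Suc k))\<^sup>2)"
      using elim by (intro mult_left_mono) auto
    also have "\<dots> = real (Suc k) powr (3/4) * ((1 - \<rho>) * q k) + C * (real (Suc k) powr (3/4) / real (Suc k) powr 2)"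
      by (simp add: algebra_simps del: of_nat_Suc)
    also have "real (Suc k) powr (3/4) / real (Suc k) powr 2 = real (Suc k) powr (- 5/4)"
      by (subst powr_diff[symmetric]) simp
    also have "real (Suc k) powr (3/4) * ((1 - \<rho>) * q k) \<le> ((1 + \<rho>) * real k powr (3/4)) * ((1 - \<rho>) * q k)"
    proof (rule mult_right_mono)
      show "real (Suc k) powr (3/4) \<le> (1 + \<rho>) * real k powr (3/4)" using elim by (simp add: field_simps)
      show "(1 - \<rho>) * q k \<ge> 0" using \<rho> q by simp
    qed
    finally show ?case by (simp add: mult_ac del: of_nat_Suc)
  qed
  have "summable (\<lambda>k. real k powr (- 5/4))" by (subst summable_real_powr_iff) simp
  then show "summable (\<lambda>k. C * real (Suc k) powr (- 5/4))"
    by (subst (asm) summable_Suc_iff[symmetric]) (rule summable_mult)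
  show "(1 - \<rho>) * (1 + \<rho>) < 1" using \<rho> by (simp add: algebra_simps)
qed (use q \<rho> C in auto)

text \<open>The deterministic counterpart of the convergence theorem for almost supermartingales:
  after subtraction of the partial sums of \<open>s\<close>, the sequence is eventually decreasing
  and bounded below. The terms of \<open>s\<close> may have any sign.\<close>

lemma almost_decreasing:
  fixes a b s :: "nat \<Rightarrow> real"
  assumes rec: "\<forall>\<^sub>F k in sequentially. a (Suc k) \<le> a k - b k + s k"
    and b: "\<And>k. b k \<ge> 0" and s: "summable s" and a: "\<forall>\<^sub>F k in sequentially. a k \<ge> B"
  shows "convergent a" "summable b"
proof -
  define u where "u k = a k - (\<Sum>j<k. s j)" for k
  obtain K where K: "\<And>k. k \<ge> K \<Longrightarrow> a (Suc k) \<le> a k - b k + s k" "\<And>k. k \<ge> K \<Longrightarrow> a k \<ge> B"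
    using eventually_conj[OF rec a] unfolding eventually_sequentially by blast
  have u: "u (Suc k) \<le> u k - b k" if "k \<ge> K" for k
    using K(1)[OF that] by (simp add: u_def)
  have s': "convergent (\<lambda>k. \<Sum>j<k. s j)" using s by (simp add: summable_iff_convergent)
  then have "Bseq (\<lambda>k. \<Sum>j<k. s j)" by (rule convergent_imp_Bseq)
  then obtain S where S: "\<And>k. \<bar>\<Sum>j<k. s j\<bar> \<le> S" by (auto simp: Bseq_def)
  have "decseq (\<lambda>k. u (k + K))"
    using u b by (intro decseq_SucI) (smt (verit) add_Suc le_add2)
  moreover have "u (k + K) \<ge> B - S" for k
    using K(2)[of "k + K"] S[of "k + K"] by (simp add: u_def)
  ultimately obtain l where l: "(\<lambda>k. u (k + K)) \<longlonglongrightarrow> l"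
    using decseq_convergent by blast
  then have u_lim: "u \<longlonglongrightarrow> l" by (rule LIMSEQ_offset)
  have "a = (\<lambda>k. u k + (\<Sum>j<k. s j))" by (simp add: u_def fun_eq_iff)
  then show "convergent a" using u_lim s' convergent_add convergentI by metis
  have "summable (\<lambda>k. u k - u (Suc k))" by (rule telescope_summable'[OF u_lim])
  then show "summable b"
    using u b by (rule_tac summable_comparison_test'[where N = K]) (auto simp: algebra_simps)
qed

section \<open>Harmonic numbers of the update counts\<close>

lemma abs_harm_diff_ln_le:
  assumes "n \<ge> 1"
  shows "\<bar>harm n - ln (real n) - euler_mascheroni\<bar> \<le> 1 / real n"
proof -
  have b: "euler_mascheroni \<ge> harm n - ln (real (Suc n)) + 1 / real (2 * (n + 1))"
    "euler_mascheroni \<le> harm n - ln (real (Suc n)) + 1 / real (2 * n)"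
    using euler_mascheroni_bounds[OF assms] by (auto simp: inverse_eq_divide)
  have "1 / real (2 * n) \<le> 1 / real n" "1 / real (2 * (n + 1)) \<ge> 0"
    using assms by (auto simp: field_simps)
  moreover have "ln (real n) \<le> ln (real (Suc n))" using assms by simp
  moreover have "ln (real (Suc n)) - ln (real n) \<le> 1 / real n"
    using ln_diff_le_inverse[of "real n"] assms by (simp add: inverse_eq_divide add.commute)
  ultimately show ?thesis using b by linarith
qed

lemma abs_ln_le_double:
  fixes t :: real
  assumes "t \<ge> 1/2"
  shows "\<bar>ln t\<bar> \<le> 2 * \<bar>t - 1\<bar>"
proof -
  have t: "t > 0" using assms by simp
  have "ln t \<le> t - 1" by (rule ln_le_minus_one[OF t])
  moreover have "- ln t \<le> 1 / t - 1"
    using ln_le_minus_one[of "1 / t"] t by (simp add: ln_div)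
  moreover have "1 / t - 1 \<le> 2 * \<bar>t - 1\<bar>"
  proof (cases "t \<le> 1")
    case True
    have "1 / t - 1 = (1 - t) * (1 / t)" using t by (simp add: field_simps)
    also have "\<dots> \<le> (1 - t) * 2" using True assms by (intro mult_left_mono) (auto simp: field_simps)
    finally show ?thesis using True by simp
  next
    case False
    then show ?thesis by (smt (verit) divide_le_eq_1_pos t)
  qed
  moreover have "t - 1 \<le> 2 * \<bar>t - 1\<bar>"
  proof -
    have "b \<le> a \<Longrightarrow> 0 \<le> a \<Longrightarrow> b \<le> 2 * a" for a b :: real by linarith
    then show ?thesis using abs_ge_self abs_ge_zero by blast
  qed
  ultimately show ?thesis by (simp add: abs_le_iff)
qed

lemma eventually_linear_lower_bound:
  fixes n :: "nat \<Rightarrow> nat"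
  assumes freq: "\<forall>\<^sub>F k in sequentially. \<bar>real (n k) - \<gamma> * real k\<bar> \<le> real k powr (3/4)" and \<gamma>: "\<gamma> > 0"
  shows "\<forall>\<^sub>F k in sequentially. \<gamma> / 2 * real k \<le> real (n k)"
proof -
  have "((\<lambda>k. real k powr (3/4) / real k) \<longlonglongrightarrow> 0)" by real_asymp
  then have "\<forall>\<^sub>F k in sequentially. real k powr (3/4) / real k < \<gamma> / 2"
    using \<gamma> by (intro order_tendstoD) auto
  then show ?thesis using freq eventually_gt_at_top[of 0]
  proof eventually_elim
    case (elim k)
    then have "real k powr (3/4) \<le> \<gamma> / 2 * real k" by (simp add: field_simps)
    then show ?case using elim by linarith
  qed
qed

text \<open>Both harmonic numbers are logarithms plus Euler's constant, up to the reciprocals of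
  their indices; the constant cancels. The quotient \<open>t\<close> of the count and
  \<open>\<gamma> * real k\<close> differs from 1 by at most
  \<open>real k powr (- 1/4) / \<gamma>\<close>, and so does \<open>ln t\<close> from 0 up to a
  factor 2.\<close>

lemma harm_asymptotics:
  fixes n :: "nat \<Rightarrow> nat"
  assumes freq: "\<forall>\<^sub>F k in sequentially. \<bar>real (n k) - \<gamma> * real k\<bar> \<le> real k powr (3/4)" and \<gamma>: "\<gamma> > 0"
  shows "\<forall>\<^sub>F k in sequentially. \<bar>harm (n k) - harm k - ln \<gamma>\<bar> \<le> (4 / \<gamma> + 1) * real k powr (- 1/4)"
  using freq eventually_linear_lower_bound[OF freq \<gamma>] eventually_gt_at_top[of 0]
proof eventually_elim
  case (elim k)
  have k: "real k > 0" using elim by simp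
  have n: "real (n k) > 0" using elim \<gamma> k by (smt (verit) divide_pos_pos mult_pos_pos)
  define t where "t = real (n k) / (\<gamma> * real k)"
  have "t - 1 = (real (n k) - \<gamma> * real k) / (\<gamma> * real k)"
    using \<gamma> k by (simp add: t_def field_simps)
  then have "\<bar>t - 1\<bar> = \<bar>real (n k) - \<gamma> * real k\<bar> / (\<gamma> * real k)" using \<gamma> k by (simp add: abs_mult)
  also have "\<dots> \<le> real k powr (3/4) / (\<gamma> * real k)" using elim \<gamma> k by (intro divide_right_mono) auto
  also have "\<dots> = real k powr (- 1/4) / \<gamma>"
    using k powr_diff[of "real k" "3/4" 1] by simp
  finally have t1: "\<bar>t - 1\<bar> \<le> real k powr (- 1/4) / \<gamma>" .
  have "t \<ge> 1/2" using elim \<gamma> k by (simp add: t_def field_simps)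
  then have "\<bar>ln t\<bar> \<le> 2 * (real k powr (- 1/4) / \<gamma>)" using abs_ln_le_double t1 by force
  moreover have "ln t = ln (real (n k)) - ln (real k) - ln \<gamma>"
    using n \<gamma> k by (simp add: t_def ln_div ln_mult)
  moreover have "\<bar>harm (n k) - ln (real (n k)) - euler_mascheroni\<bar> \<le> 2 / \<gamma> * real k powr (- 1/4)"
  proof -
    have "1 / real (n k) \<le> 1 / (\<gamma> / 2 * real k)" using elim \<gamma> k n by (intro divide_left_mono) auto
    also have "\<dots> = 2 / \<gamma> * real k powr (- 1)" using k \<gamma> by (simp add: powr_minus_divide)
    also have "\<dots> \<le> 2 / \<gamma> * real k powr (- 1/4)" using k \<gamma> elim by (intro mult_left_mono powr_mono) auto
    finally show ?thesis using abs_harm_diff_ln_le[of "n k"] n by simp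
  qed
  moreover have "\<bar>harm k - ln (real k) - euler_mascheroni\<bar> \<le> real k powr (- 1/4)"
  proof -
    have "1 / real k = real k powr (- 1)" using k by (simp add: powr_minus_divide)
    also have "\<dots> \<le> real k powr (- 1/4)" using k elim by (intro powr_mono) auto
    finally show ?thesis using abs_harm_diff_ln_le[of k] k by simp
  qed
  moreover have "(4 / \<gamma> + 1) * real k powr (- 1/4) =
    2 * (real k powr (- 1/4) / \<gamma>) + 2 / \<gamma> * real k powr (- 1/4) + real k powr (- 1/4)"
    using \<gamma> by (simp add: field_simps)
  ultimately show ?case by linarith
qed

lemma num_updates_0 [simp]: "num_updates I J i 0 = 0"
  by (simp add: num_updates_def)

lemma num_updates_Suc:
  "num_updates I J i (Suc k) = num_updates I J i k + (if i \<in> {I (Suc k), J (Suc k)} then 1 else 0)"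
proof -
  have "{t \<in> {1..Suc k}. i \<in> {I t, J t}} = {t \<in> {1..k}. i \<in> {I t, J t}} \<union> (if i \<in> {I (Suc k), J (Suc k)} then {Suc k} else {})"
    by (auto simp: le_Suc_eq)
  then show ?thesis unfolding num_updates_def
    by (simp add: card_insert_if)
qed

section \<open>Convergence along one sample path\<close>

text \<open>Otherwise a positive multiple of a tail of the harmonic series would converge.\<close>

lemma frequently_small_of_summable:
  fixes h :: "nat \<Rightarrow> real"
  assumes "summable (\<lambda>k. h k / real (Suc k))" and h: "\<And>k. h k \<ge> 0" and "\<epsilon> > 0"
  shows "\<exists>k\<ge>N. h k < \<epsilon>"
proof (rule ccontr)
  assume "\<not> ?thesis"
  then have "\<And>k. k \<ge> N \<Longrightarrow> h k \<ge> \<epsilon>" by force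
  then have "summable (\<lambda>k. \<epsilon> / real (Suc k))"
    using assms by (intro summable_comparison_test'[OF assms(1), of N]) (auto intro!: divide_right_mono)
  then have "summable (\<lambda>k. inverse \<epsilon> * (\<epsilon> / real (Suc k)))" by (rule summable_mult)
  then have "summable (\<lambda>k. 1 / real (Suc k))" using \<open>\<epsilon> > 0\<close> by (simp add: field_simps)
  then have "summable (\<lambda>k. 1 / real k)" by (rule summable_Suc_iff[THEN iffD1])
  then show False using not_summable_harmonic[where 'a = real] by (simp add: inverse_eq_divide)
qed

context convex_problem
begin

abbreviation total :: "'a \<Rightarrow> real" where
  "total y \<equiv> \<Sum>i\<in>UNIV. f i y"

lemma continuous_total: "continuous (at y) total"
proof -
  have "continuous (at y) (f i)" for i
    using gradient[of i y] unfolding gderiv_def by (rule has_derivative_continuous)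
  then show ?thesis by (intro continuous_sum)
qed

lemma optimal_setD:
  assumes "y \<in> optimal_set total Y"
  shows "y \<in> Y" "p \<in> Y \<Longrightarrow> total y \<le> total p"
  using assms unfolding optimal_set_def is_arg_min_def by (auto simp: not_less)

lemma optimal_setI:
  assumes "y \<in> optimal_set total Y" "z \<in> Y" "total z \<le> total y"
  shows "z \<in> optimal_set total Y"
  using assms unfolding optimal_set_def is_arg_min_def by (auto simp: not_less)

text \<open>The probabilistic input consists of \<open>IJ\<close>, \<open>freq\<close> and
  \<open>potential\<close>, which hold on almost every path; everything in this context is
  deterministic.\<close>

context
  fixes I J :: "nat \<Rightarrow> 'v" and C :: "'v \<Rightarrow> nat \<Rightarrow> 'a set" and x :: "nat \<Rightarrow> 'v \<Rightarrow> 'a" and \<gamma> :: "'v \<Rightarrow> real"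
  assumes step: "\<And>k. gossip_step (I (Suc k)) (J (Suc k)) (\<lambda>i. C i (Suc k)) g
      (\<lambda>i. 1 / real (num_updates I J i (Suc k))) (x k) (x (Suc k))"
    and IJ: "\<And>k. I (Suc k) \<noteq> J (Suc k)"
    and C: "\<And>i k. closed (C i (Suc k))" "\<And>i k. convex (C i (Suc k))" "\<And>i k. Y \<subseteq> C i (Suc k)"
    and freq: "\<And>i. \<forall>\<^sub>F k in sequentially. \<bar>real (num_updates I J i k) - \<gamma> i * real k\<bar> \<le> real k powr (3/4)"
    and \<gamma>: "\<And>i. \<gamma> i > 0"
    and potential: "summable (\<lambda>k. real k powr (3/4) * (infeasibility Y (x k) + disagreement (x k)))"
begin

definition gap :: "nat \<Rightarrow> real" where
  "gap k = sqrt (infeasibility Y (x k) + disagreement (x k))"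

text \<open>A feasible stand-in for all iterates: it lies in \<open>Y\<close>, where every
  \<open>f i\<close> is Lipschitz with constant \<open>G\<close>, and within
  \<open>3 * gap k\<close> of each agent.\<close>

definition center :: "nat \<Rightarrow> 'a" where
  "center k = closest_point Y (mean (x k))"

definition spread :: "'a \<Rightarrow> nat \<Rightarrow> real" where
  "spread y k = (\<Sum>i\<in>UNIV. (norm (x k i - y))\<^sup>2)"

text \<open>The update of agent \<open>i\<close> carries the weight \<open>1 / num_updates i\<close>, so its accumulated weight is
  the harmonic number of the number of its updates, whereas \<open>harm k\<close> is the weight it ought to have.\<close>

definition excess :: "'v \<Rightarrow> nat \<Rightarrow> real" where
  "excess i k = harm (num_updates I J i k) - harm k - ln (\<gamma> i)"

text \<open>Summation by parts in closed form: the increment of the correction replaces the random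
  weights of the \<open>f i\<close> by the common weight \<open>1 / real (Suc k)\<close>, at the
  price of \<open>excess\<close> times the change of the values at \<open>center\<close>.\<close>

definition energy :: "'a \<Rightarrow> nat \<Rightarrow> real" where
  "energy y k = spread y k + 2 * (\<Sum>i\<in>UNIV. excess i k * (f i (center k) - f i y))"

text \<open>\<open>A\<close> and \<open>B\<close> are meant as the constants in the bounds
  \<open>A / real (Suc k)\<close> on the stepsizes and \<open>B * real k powr (- 1/4)\<close> on
  \<open>excess\<close>. The first two summands come from the projected gradient step, the last from
  the movement of \<open>center\<close>.\<close>

definition step_error :: "real \<Rightarrow> real \<Rightarrow> nat \<Rightarrow> real" where
  "step_error A B k = 12 * A * G * (gap k / real (Suc k)) + 4 * A\<^sup>2 * ((G + L * gap k)\<^sup>2 / (real (Suc k))\<^sup>2)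
     + 2 * real CARD('v) * B * G * (real (Suc k) powr (- 1/4) *
         (4 * gap k + 2 * (A / real (Suc k)) * (G + L * gap k)))"

lemma gap_nonneg: "gap k \<ge> 0"
  by (simp add: gap_def infeasibility_nonneg disagreement_nonneg)

lemma gap_sq: "(gap k)\<^sup>2 = infeasibility Y (x k) + disagreement (x k)"
  by (simp add: gap_def infeasibility_nonneg disagreement_nonneg)

lemma center_in_Y: "center k \<in> Y"
  unfolding center_def by (rule closest_point_in_Y)

lemma norm_diff_center_le: "norm (x k i - center k) \<le> 3 * gap k"
proof -
  have "(norm (x k i - mean (x k)))\<^sup>2 \<le> (gap k)\<^sup>2" "(infdist (x k i) Y)\<^sup>2 \<le> (gap k)\<^sup>2"
    unfolding gap_sq using norm_diff_mean_sq_le[of "x k" i] infdist_sq_le[of "x k" i Y]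
      infeasibility_nonneg[of Y "x k"] disagreement_nonneg[of "x k"] by linarith+
  then have "norm (x k i - mean (x k)) \<le> gap k" "infdist (x k i) Y \<le> gap k"
    using gap_nonneg power2_le_imp_le by blast+
  moreover have "infdist (mean (x k)) Y \<le> infdist (x k i) Y + norm (x k i - mean (x k))"
    using infdist_triangle[of "mean (x k)" Y "x k i"] by (simp add: dist_norm norm_minus_commute)
  moreover have "norm (x k i - center k) \<le> norm (x k i - mean (x k)) + infdist (mean (x k)) Y"
    using Y norm_triangle_ineq[of "x k i - mean (x k)" "mean (x k) - center k"]
    by (simp add: infdist_eq_dist_closest_point dist_norm center_def)
  ultimately show ?thesis by linarith
qed

lemma weighted_gap_summable: "summable (\<lambda>k. real (Suc k) powr (3/4) * (gap k)\<^sup>2)"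
proof (rule summable_comparison_test_ev)
  have "(\<lambda>k. real (Suc k) powr (3/4) / real k powr (3/4)) \<longlonglongrightarrow> 1" by real_asymp
  then have "\<forall>\<^sub>F k in sequentially. real (Suc k) powr (3/4) / real k powr (3/4) < 2"
    by (intro order_tendstoD) auto
  then show "\<forall>\<^sub>F k in sequentially. norm (real (Suc k) powr (3/4) * (gap k)\<^sup>2)
      \<le> 2 * (real k powr (3/4) * (infeasibility Y (x k) + disagreement (x k)))"
    using eventually_gt_at_top[of 0]
  proof eventually_elim
    case (elim k)
    then have "real (Suc k) powr (3/4) \<le> 2 * real k powr (3/4)" by (simp add: field_simps)
    then have "real (Suc k) powr (3/4) * (gap k)\<^sup>2 \<le> 2 * real k powr (3/4) * (gap k)\<^sup>2"
      by (intro mult_right_mono) auto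
    then show ?case by (simp add: gap_sq[symmetric] mult.assoc)
  qed
  show "summable (\<lambda>k. 2 * (real k powr (3/4) * (infeasibility Y (x k) + disagreement (x k))))"
    by (rule summable_mult[OF potential])
qed

lemma gap_tendsto_0: "gap \<longlonglongrightarrow> 0"
proof -
  have "(\<lambda>k. real (Suc k) powr (3/4) * (gap k)\<^sup>2) \<longlonglongrightarrow> 0"
    by (rule summable_LIMSEQ_zero[OF weighted_gap_summable])
  then have "(\<lambda>k. (gap k)\<^sup>2) \<longlonglongrightarrow> 0"
    by (rule Lim_null_comparison[rotated])
       (auto intro!: always_eventually simp: mult_le_cancel_right1 ge_one_powr_ge_zero)
  then have "(\<lambda>k. sqrt ((gap k)\<^sup>2)) \<longlonglongrightarrow> sqrt 0" by (rule tendsto_real_sqrt)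
  then show ?thesis using gap_nonneg by simp
qed

text \<open>The delicate term is \<open>u k * gap k\<close>, because summability is known only for
  the weighted square of \<open>gap\<close>. All other terms carry a factor
  \<open>1 / real (Suc k)\<close>.\<close>

lemma step_error_summable: "summable (step_error A B)"
proof -
  define t where "t k = real (Suc k) powr (- 5/4) + real (Suc k) powr (3/4) * (gap k)\<^sup>2" for k
  define u where "u k = real (Suc k) powr (- 1/4)" for k
  have t: "summable t"
    unfolding t_def using weighted_gap_summable
    by (intro summable_add) (subst summable_Suc_iff[of "\<lambda>k. real k powr (- 5/4)"], subst summable_real_powr_iff, simp)
  have comp: "summable h" if "\<And>k. 0 \<le> h k" "\<And>k. h k \<le> t k" for h :: "nat \<Rightarrow> real"
    by (rule summable_comparison_test'[OF t, of 0]) (use that in auto)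
  have n1: "1 / real (Suc k) \<le> u k" for k
  proof -
    have "1 / real (Suc k) = real (Suc k) powr (- 1)" by (simp add: powr_minus_divide)
    also have "\<dots> \<le> u k" unfolding u_def by (intro powr_mono) auto
    finally show ?thesis .
  qed
  have u1: "u k \<le> 1" for k
    using powr_mono[of "- 1/4" 0 "real (Suc k)"] by (simp add: u_def)
  have un: "u k / real (Suc k) = real (Suc k) powr (- 5/4)" for k
    using powr_diff[of "real (Suc k)" "- 1/4" 1] by (simp add: u_def)
  have u_gap: "u k * gap k \<le> t k" for k
  proof -
    \<comment> \<open>The exponents \<open>- 5/8\<close> and \<open>3/8\<close> add up to
      \<open>- 1/4\<close>, and their doubles \<open>- 5/4\<close> and \<open>3/4\<close> give
      exactly the two summable sequences in \<open>t\<close>.\<close>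
    define r where "r = real (Suc k) powr (- 5/8)"
    define q where "q = real (Suc k) powr (3/8) * gap k"
    have "u k * gap k = r * q" by (simp add: u_def r_def q_def flip: powr_add)
    also have "\<dots> \<le> r\<^sup>2 + q\<^sup>2" using sum_squares_bound[of r q] zero_le_power2[of r] zero_le_power2[of q] by linarith
    also have "\<dots> = t k"
      by (simp add: r_def q_def t_def power_mult_distrib power2_eq_square flip: powr_add)
    finally show ?thesis .
  qed
  have t0: "real (Suc k) powr (- 5/4) \<le> t k" "real (Suc k) powr (3/4) * (gap k)\<^sup>2 \<le> t k" for k
    by (simp_all add: t_def)
  have s1: "summable (\<lambda>k. u k * gap k)"
    using u_gap gap_nonneg by (intro comp) (auto simp: u_def)
  have s2: "summable (\<lambda>k. gap k / real (Suc k))"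
  proof (rule comp)
    fix k
    have "gap k / real (Suc k) \<le> u k * gap k"
      using mult_right_mono[OF n1[of k] gap_nonneg[of k]] by simp
    then show "gap k / real (Suc k) \<le> t k" using u_gap[of k] by linarith
  qed (simp add: gap_nonneg)
  have s3: "summable (\<lambda>k. u k / real (Suc k))"
    unfolding un using t0 by (intro comp) auto
  have s4: "summable (\<lambda>k. u k * (gap k / real (Suc k)))"
  proof (rule summable_comparison_test'[OF s2, of 0])
    fix k
    show "norm (u k * (gap k / real (Suc k))) \<le> gap k / real (Suc k)"
      using mult_right_mono[OF u1[of k], of "gap k / real (Suc k)"] gap_nonneg[of k] by (simp add: u_def)
  qed
  have nn: "1 / (real (Suc k))\<^sup>2 \<le> u k / real (Suc k)" for k
    using divide_right_mono[OF n1[of k], of "real (Suc k)"] by (simp add: power2_eq_square)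
  have s5: "summable (\<lambda>k. 1 / (real (Suc k))\<^sup>2)"
    by (rule summable_comparison_test'[OF s3, of 0]) (use nn in auto)
  have s6: "summable (\<lambda>k. (gap k)\<^sup>2 / (real (Suc k))\<^sup>2)"
  proof (rule comp)
    fix k
    have "1 / (real (Suc k))\<^sup>2 \<le> 1" by (simp add: field_simps)
    also have "1 \<le> real (Suc k) powr (3/4)" by (intro ge_one_powr_ge_zero) auto
    finally have "1 / (real (Suc k))\<^sup>2 * (gap k)\<^sup>2 \<le> real (Suc k) powr (3/4) * (gap k)\<^sup>2"
      by (intro mult_right_mono) auto
    then show "(gap k)\<^sup>2 / (real (Suc k))\<^sup>2 \<le> t k" using t0[of k] by simp
  qed simp
  have "summable (\<lambda>k. (G + L * gap k)\<^sup>2 / (real (Suc k))\<^sup>2)"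
  proof (rule summable_comparison_test')
    show "summable (\<lambda>k. 2 * G\<^sup>2 * (1 / (real (Suc k))\<^sup>2) + 2 * L\<^sup>2 * ((gap k)\<^sup>2 / (real (Suc k))\<^sup>2))"
      by (intro summable_add summable_mult s5 s6)
    fix k :: nat
    have "(G + L * gap k)\<^sup>2 \<le> 2 * G\<^sup>2 + 2 * L\<^sup>2 * (gap k)\<^sup>2"
      using zero_le_power2[of "G - L * gap k"] by (simp add: power2_sum power2_diff power_mult_distrib)
    then have "(G + L * gap k)\<^sup>2 / (real (Suc k))\<^sup>2 \<le> (2 * G\<^sup>2 + 2 * L\<^sup>2 * (gap k)\<^sup>2) / (real (Suc k))\<^sup>2"
      by (intro divide_right_mono) auto
    then show "norm ((G + L * gap k)\<^sup>2 / (real (Suc k))\<^sup>2)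
        \<le> 2 * G\<^sup>2 * (1 / (real (Suc k))\<^sup>2) + 2 * L\<^sup>2 * ((gap k)\<^sup>2 / (real (Suc k))\<^sup>2)"
      by (simp add: add_divide_distrib)
  qed
  moreover have "summable (\<lambda>k. 4 * (u k * gap k) + (2 * A * G * (u k / real (Suc k)) + 2 * A * L * (u k * (gap k / real (Suc k)))))"
    by (intro summable_add summable_mult s1 s3 s4)
  moreover have "4 * (u k * gap k) + (2 * A * G * (u k / real (Suc k)) + 2 * A * L * (u k * (gap k / real (Suc k))))
    = u k * (4 * gap k + 2 * (A / real (Suc k)) * (G + L * gap k))" for k
    by (simp add: field_simps del: of_nat_Suc)
  ultimately show ?thesis
    unfolding step_error_def[abs_def] u_def[symmetric]
    by (intro summable_add summable_mult s2) auto
qed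

lemma stepsize_bound:
  obtains A where "A > 0" "\<forall>\<^sub>F k in sequentially. \<forall>i. 1 / real (num_updates I J i (Suc k)) \<le> A / real (Suc k)"
proof
  define A where "A = (\<Sum>i\<in>UNIV. 2 / \<gamma> i)"
  have A: "2 / \<gamma> i \<le> A" for i
    unfolding A_def using \<gamma> by (intro member_le_sum) (auto intro: less_imp_le)
  show "A > 0" using A[of undefined] \<gamma>[of undefined] by (smt (verit) divide_pos_pos)
  have "\<forall>\<^sub>F k in sequentially. \<forall>i. \<gamma> i / 2 * real k \<le> real (num_updates I J i k)"
    using eventually_linear_lower_bound[OF freq \<gamma>] by (intro eventually_all_finite) auto
  then have "\<forall>\<^sub>F k in sequentially. \<forall>i. \<gamma> i / 2 * real (Suc k) \<le> real (num_updates I J i (Suc k))"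
    by (rule eventually_compose_filterlim[OF _ filterlim_Suc])
  then show "\<forall>\<^sub>F k in sequentially. \<forall>i. 1 / real (num_updates I J i (Suc k)) \<le> A / real (Suc k)"
  proof eventually_elim
    case (elim k)
    show ?case
    proof
      fix i
      have pos: "\<gamma> i / 2 * real (Suc k) > 0" using \<gamma>[of i] by simp
      have "1 / real (num_updates I J i (Suc k)) \<le> 1 / (\<gamma> i / 2 * real (Suc k))"
      proof (rule divide_left_mono)
        show le: "\<gamma> i / 2 * real (Suc k) \<le> real (num_updates I J i (Suc k))" using elim by blast
        then show "0 < real (num_updates I J i (Suc k)) * (\<gamma> i / 2 * real (Suc k))"
          by (intro mult_pos_pos[OF less_le_trans[OF pos le] pos])
      qed simp
      also have "\<dots> = (2 / \<gamma> i) / real (Suc k)" by simp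
      also have "\<dots> \<le> A / real (Suc k)" using A by (intro divide_right_mono) auto
      finally show "1 / real (num_updates I J i (Suc k)) \<le> A / real (Suc k)" .
    qed
  qed
qed

lemma excess_bound:
  obtains B where "B > 0" "\<forall>\<^sub>F k in sequentially. \<forall>i. \<bar>excess i k\<bar> \<le> B * real k powr (- 1/4)"
proof
  define B where "B = (\<Sum>i\<in>UNIV. 4 / \<gamma> i + 1)"
  have B: "4 / \<gamma> i + 1 \<le> B" for i
    unfolding B_def using \<gamma> by (intro member_le_sum) (auto intro!: add_nonneg_nonneg divide_nonneg_nonneg intro: less_imp_le)
  show "B > 0" using B[of undefined] \<gamma>[of undefined] by (smt (verit) divide_pos_pos)
  have "\<forall>\<^sub>F k in sequentially. \<forall>i. \<bar>excess i k\<bar> \<le> (4 / \<gamma> i + 1) * real k powr (- 1/4)"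
    unfolding excess_def using harm_asymptotics[OF freq \<gamma>] by (intro eventually_all_finite) auto
  then show "\<forall>\<^sub>F k in sequentially. \<forall>i. \<bar>excess i k\<bar> \<le> B * real k powr (- 1/4)"
    by eventually_elim (meson B mult_right_mono order_trans powr_ge_zero)
qed

lemma excess_tendsto_0: "excess i \<longlonglongrightarrow> 0"
proof -
  obtain B where B: "\<forall>\<^sub>F k in sequentially. \<forall>i. \<bar>excess i k\<bar> \<le> B * real k powr (- 1/4)"
    using excess_bound by blast
  have "(\<lambda>k. real k powr (- 1/4)) \<longlonglongrightarrow> 0" by real_asymp
  then have "(\<lambda>k. B * real k powr (- 1/4)) \<longlonglongrightarrow> B * 0" by (rule tendsto_mult_left)
  then have "(\<lambda>k. B * real k powr (- 1/4)) \<longlonglongrightarrow> 0" by simp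
  moreover have "\<forall>\<^sub>F k in sequentially. norm (excess i k) \<le> B * real k powr (- 1/4)"
    using B by eventually_elim simp
  ultimately show ?thesis by (rule Lim_null_comparison[rotated])
qed

text \<open>An update raises the count by one, hence its harmonic number by exactly the stepsize
  used.\<close>

lemma excess_Suc:
  "excess i (Suc k) - excess i k =
    (if i \<in> {I (Suc k), J (Suc k)} then 1 / real (num_updates I J i (Suc k)) else 0) - 1 / real (Suc k)"
  by (auto simp: excess_def num_updates_Suc harm_Suc inverse_eq_divide simp del: of_nat_Suc)

text \<open>The sum of \<open>?\<alpha> i * \<phi> i\<close> over the active agents occurs with
  opposite signs in the bound for \<open>spread\<close> and in the increment of the correction. It
  cancels, and the common weight \<open>1 / real (Suc k)\<close> remains.\<close>

lemma energy_step:
  obtains A B where "\<And>y. y \<in> Y \<Longrightarrow> \<forall>\<^sub>F k in sequentially.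
    energy y (Suc k) \<le> energy y k - 2 * ((total (center k) - total y) / real (Suc k)) + step_error A B k"
proof -
  obtain A where A: "A > 0" "\<forall>\<^sub>F k in sequentially. \<forall>i. 1 / real (num_updates I J i (Suc k)) \<le> A / real (Suc k)"
    using stepsize_bound .
  obtain B where B: "B > 0" "\<forall>\<^sub>F k in sequentially. \<forall>i. \<bar>excess i k\<bar> \<le> B * real k powr (- 1/4)"
    using excess_bound .
  have B': "\<forall>\<^sub>F k in sequentially. \<forall>i. \<bar>excess i (Suc k)\<bar> \<le> B * real (Suc k) powr (- 1/4)"
    by (rule eventually_compose_filterlim[OF B(2) filterlim_Suc])
  have "\<forall>\<^sub>F k in sequentially. energy y (Suc k)
      \<le> energy y k - 2 * ((total (center k) - total y) / real (Suc k)) + step_error A B k" if y: "y \<in> Y" for y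
    using A(2) B'
  proof eventually_elim
    case (elim k)
    let ?a = "I (Suc k)" and ?b = "J (Suc k)"
    let ?w = "(1/2) *\<^sub>R (x k ?a + x k ?b)" and ?\<alpha> = "\<lambda>i. 1 / real (num_updates I J i (Suc k))"
    define \<tau> where "\<tau> = A / real (Suc k)"
    define \<phi> where "\<phi> i = f i (center k) - f i y" for i
    define \<phi>' where "\<phi>' i = f i (center (Suc k)) - f i y" for i
    define D where "D = 4 * gap k + 2 * \<tau> * (G + L * gap k)"
    have \<tau>: "\<tau> \<ge> 0" using A(1) by (simp add: \<tau>_def)
    have \<alpha>: "\<And>i. i \<in> {?a, ?b} \<Longrightarrow> 0 \<le> ?\<alpha> i" "\<And>i. i \<in> {?a, ?b} \<Longrightarrow> ?\<alpha> i \<le> \<tau>"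
      using elim(1) by (auto simp: \<tau>_def)
    note hyps = step[of k] IJ[of k] C(1)[of _ k] C(2)[of _ k] C(3)[of _ k] \<alpha>
    have wd: "infdist ?w Y \<le> gap k"
      unfolding gap_def by (rule infdist_midpoint_le_sqrt[OF hyps])
    have wc: "norm (?w - center k) \<le> 3 * gap k"
      unfolding gap_def center_def by (rule norm_midpoint_closest_le[OF hyps])
    have grad: "G + L * infdist ?w Y \<le> G + L * gap k" "0 \<le> G + L * infdist ?w Y"
      using wd L_nonneg G_nonneg by (auto intro: mult_left_mono simp: infdist_nonneg)
    have "spread y (Suc k) \<le> spread y k - 2 * (\<Sum>i\<in>{?a, ?b}. ?\<alpha> i * \<phi> i)
      + (4 * \<tau> * G * norm (?w - center k) + 4 * \<tau>\<^sup>2 * (G + L * infdist ?w Y)\<^sup>2)"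
      unfolding spread_def \<phi>_def by (rule step_sum_dist_le[OF hyps y center_in_Y])
    also have "\<dots> \<le> spread y k - 2 * (\<Sum>i\<in>{?a, ?b}. ?\<alpha> i * \<phi> i)
      + (4 * \<tau> * G * (3 * gap k) + 4 * \<tau>\<^sup>2 * (G + L * gap k)\<^sup>2)"
      using \<tau> G_nonneg
      by (intro add_left_mono add_mono mult_left_mono[OF wc] mult_left_mono[OF power_mono[OF grad]]) auto
    finally have V: "spread y (Suc k) \<le> spread y k - 2 * (\<Sum>i\<in>{?a, ?b}. ?\<alpha> i * \<phi> i)
      + (12 * \<tau> * G * gap k + 4 * \<tau>\<^sup>2 * (G + L * gap k)\<^sup>2)" by (simp add: mult_ac)
    have "norm (center (Suc k) - center k) \<le> norm (mean (x (Suc k)) - mean (x k))"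
      unfolding center_def using closest_point_lipschitz[of Y] Y by (simp add: dist_norm)
    also have "\<dots> \<le> 4 * infdist ?w Y + 2 * \<tau> * (G + L * infdist ?w Y)"
      by (rule step_mean_le[OF hyps])
    also have "\<dots> \<le> D"
      unfolding D_def using wd \<tau> by (intro add_mono mult_left_mono[OF grad(1)]) auto
    finally have cc: "norm (center (Suc k) - center k) \<le> D" .
    have diff: "excess i (Suc k) * (\<phi>' i - \<phi> i) \<le> B * G * (real (Suc k) powr (- 1/4) * D)" for i
    proof -
      have "\<bar>\<phi>' i - \<phi> i\<bar> \<le> G * norm (center (Suc k) - center k)"
        unfolding \<phi>'_def \<phi>_def using f_lipschitz_on_Y[OF center_in_Y center_in_Y, of i "Suc k" k] by simp
      also have "\<dots> \<le> G * D" using cc G_nonneg by (rule mult_left_mono)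
      finally have "\<bar>excess i (Suc k)\<bar> * \<bar>\<phi>' i - \<phi> i\<bar> \<le> (B * real (Suc k) powr (- 1/4)) * (G * D)"
        using elim(2) B(1) by (intro mult_mono) auto
      then show ?thesis by (simp add: abs_mult[symmetric] mult_ac del: of_nat_Suc)
    qed
    have "excess i (Suc k) * \<phi>' i - excess i k * \<phi> i =
        (if i \<in> {?a, ?b} then ?\<alpha> i * \<phi> i else 0) - \<phi> i / real (Suc k) + excess i (Suc k) * (\<phi>' i - \<phi> i)" for i
    proof -
      \<comment> \<open>Summation by parts: the increment of \<open>excess\<close> goes with the old
        value, the new \<open>excess\<close> with the change of the value.\<close>
      have "excess i (Suc k) * \<phi>' i - excess i k * \<phi> i =
        (excess i (Suc k) - excess i k) * \<phi> i + excess i (Suc k) * (\<phi>' i - \<phi> i)" by (simp add: algebra_simps)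
      then show ?thesis unfolding excess_Suc by (simp add: left_diff_distrib)
    qed
    then have "(\<Sum>i\<in>UNIV. excess i (Suc k) * \<phi>' i) - (\<Sum>i\<in>UNIV. excess i k * \<phi> i) =
      (\<Sum>i\<in>UNIV. if i \<in> {?a, ?b} then ?\<alpha> i * \<phi> i else 0) - (\<Sum>i\<in>UNIV. \<phi> i) / real (Suc k)
        + (\<Sum>i\<in>UNIV. excess i (Suc k) * (\<phi>' i - \<phi> i))"
      by (simp add: sum_subtractf[symmetric] sum.distrib[symmetric] sum_divide_distrib del: of_nat_Suc insert_iff)
    also have "(\<Sum>i\<in>UNIV. if i \<in> {?a, ?b} then ?\<alpha> i * \<phi> i else 0) = (\<Sum>i\<in>{?a, ?b}. ?\<alpha> i * \<phi> i)"
      by (subst sum.inter_restrict[symmetric]) auto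
    also have "(\<Sum>i\<in>UNIV. \<phi> i) = total (center k) - total y" by (simp add: \<phi>_def sum_subtractf)
    also have "(\<Sum>i\<in>UNIV. excess i (Suc k) * (\<phi>' i - \<phi> i)) \<le> (\<Sum>i\<in>(UNIV::'v set). B * G * (real (Suc k) powr (- 1/4) * D))"
      by (intro sum_mono diff)
    also have "\<dots> = real CARD('v) * B * G * (real (Suc k) powr (- 1/4) * D)" by simp
    finally have E: "(\<Sum>i\<in>UNIV. excess i (Suc k) * \<phi>' i) - (\<Sum>i\<in>UNIV. excess i k * \<phi> i)
      \<le> (\<Sum>i\<in>{?a, ?b}. ?\<alpha> i * \<phi> i) - (total (center k) - total y) / real (Suc k)
        + real CARD('v) * B * G * (real (Suc k) powr (- 1/4) * D)" by simp
    have "step_error A B k = (12 * \<tau> * G * gap k + 4 * \<tau>\<^sup>2 * (G + L * gap k)\<^sup>2)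
      + 2 * (real CARD('v) * B * G * (real (Suc k) powr (- 1/4) * D))"
      unfolding step_error_def D_def \<tau>_def by (simp add: power_divide del: of_nat_Suc)
    then show ?case
      unfolding energy_def \<phi>_def[symmetric] \<phi>'_def[symmetric] using V E by linarith
  qed
  then show thesis by (rule that)
qed

text \<open>No bound on the iterates is available beforehand, so the correction \<open>R\<close> is
  first bounded relative to the spread, by \<open>\<epsilon> k * (1 + spread y k)\<close> with
  \<open>\<epsilon>\<close> tending to 0. Once \<open>\<epsilon> k < 1/2\<close>, the energy
  controls the spread and is bounded below; its convergence then bounds the spread and forces
  \<open>R\<close> to 0.\<close>

lemma spread_convergent:
  assumes y: "y \<in> optimal_set total Y"
  shows "convergent (spread y)" "summable (\<lambda>k. (total (center k) - total y) / real (Suc k))"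
proof -
  note yY = optimal_setD(1)[OF y]
  have F: "total (center k) - total y \<ge> 0" for k using optimal_setD(2)[OF y center_in_Y] by simp
  define R where "R k = 2 * (\<Sum>i\<in>UNIV. excess i k * (f i (center k) - f i y))" for k
  define \<epsilon> where "\<epsilon> k = 2 * (\<Sum>i\<in>UNIV. \<bar>excess i k\<bar>) * G" for k
  have "\<epsilon> \<longlonglongrightarrow> 2 * (\<Sum>i\<in>(UNIV::'v set). \<bar>0\<bar>) * G"
    unfolding \<epsilon>_def
    by (intro tendsto_mult tendsto_sum tendsto_rabs tendsto_const excess_tendsto_0)
  then have \<epsilon>: "\<epsilon> \<longlonglongrightarrow> 0" by simp
  have \<epsilon>0: "\<epsilon> k \<ge> 0" for k using G_nonneg by (simp add: \<epsilon>_def sum_nonneg)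
  have R: "\<bar>R k\<bar> \<le> \<epsilon> k * (1 + spread y k)" for k
  proof -
    have "norm (center k - y) \<le> norm (mean (x k) - y)"
      unfolding center_def using Y yY by (intro norm_closest_point_diff_le)
    \<comment> \<open>The inequality \<open>t \<le> 1 + t\<^sup>2\<close> leads back to the squared
      distances that make up \<open>spread\<close>.\<close>
    also have "\<dots> \<le> 1 + (norm (mean (x k) - y))\<^sup>2"
      using zero_le_power2[of "norm (mean (x k) - y) - 1"] norm_ge_zero[of "mean (x k) - y"]
      unfolding power2_diff by (simp, linarith)
    also have "\<dots> \<le> 1 + spread y k" unfolding spread_def by (intro add_left_mono norm_mean_sq_le)
    finally have cy: "norm (center k - y) \<le> 1 + spread y k" .
    have "\<bar>\<Sum>i\<in>UNIV. excess i k * (f i (center k) - f i y)\<bar> \<le> (\<Sum>i\<in>UNIV. \<bar>excess i k * (f i (center k) - f i y)\<bar>)"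
      by (rule sum_abs)
    also have "\<dots> \<le> (\<Sum>i\<in>UNIV. \<bar>excess i k\<bar> * (G * (1 + spread y k)))"
    proof (rule sum_mono)
      fix i
      have "\<bar>f i (center k) - f i y\<bar> \<le> G * norm (center k - y)" by (rule f_lipschitz_on_Y[OF center_in_Y yY])
      also have "\<dots> \<le> G * (1 + spread y k)" using cy G_nonneg by (rule mult_left_mono)
      finally show "\<bar>excess i k * (f i (center k) - f i y)\<bar> \<le> \<bar>excess i k\<bar> * (G * (1 + spread y k))"
        unfolding abs_mult by (intro mult_left_mono) auto
    qed
    also have "\<dots> = (\<Sum>i\<in>UNIV. \<bar>excess i k\<bar>) * (G * (1 + spread y k))"
      by (rule sum_distrib_right[symmetric])
    finally show ?thesis by (simp add: R_def \<epsilon>_def abs_mult mult_ac)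
  qed
  have energy: "energy y k = spread y k + R k" for k by (simp add: energy_def R_def)
  have half: "\<forall>\<^sub>F k in sequentially. spread y k \<le> 2 * energy y k + 1"
    using order_tendstoD(2)[OF \<epsilon>, of "1/2", simplified]
  proof eventually_elim
    case (elim k)
    have "0 \<le> spread y k" by (simp add: spread_def sum_nonneg)
    then have "\<epsilon> k * (1 + spread y k) \<le> 1/2 * (1 + spread y k)" using elim by (intro mult_right_mono) auto
    then have "- R k \<le> 1/2 * (1 + spread y k)" by (rule order_trans[OF abs_le_D2[OF R[of k]]])
    then show ?case unfolding energy by (simp add: field_simps)
  qed
  then have lower: "\<forall>\<^sub>F k in sequentially. energy y k \<ge> - 1/2"
  proof eventually_elim
    case (elim k)
    have "0 \<le> spread y k" by (simp add: spread_def sum_nonneg)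
    then show ?case using elim by linarith
  qed
  obtain A B where AB: "\<And>y. y \<in> Y \<Longrightarrow> \<forall>\<^sub>F k in sequentially.
    energy y (Suc k) \<le> energy y k - 2 * ((total (center k) - total y) / real (Suc k)) + step_error A B k"
    using energy_step by blast
  note ad = almost_decreasing[OF AB[OF yY] _ step_error_summable lower]
  have conv: "convergent (energy y)" by (rule ad(1)) (use F in auto)
  have "summable (\<lambda>k. 2 * ((total (center k) - total y) / real (Suc k)))" by (rule ad(2)) (use F in auto)
  then show "summable (\<lambda>k. (total (center k) - total y) / real (Suc k))"
    by (rule summable_mult_D) simp
  obtain S where S: "\<And>k. \<bar>energy y k\<bar> \<le> S"
    using convergent_imp_Bseq[OF conv] by (auto simp: Bseq_def)
  have "(\<lambda>k. \<epsilon> k * (2 * S + 2)) \<longlonglongrightarrow> 0 * (2 * S + 2)" by (intro tendsto_intros \<epsilon>)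
  then have "(\<lambda>k. \<epsilon> k * (2 * S + 2)) \<longlonglongrightarrow> 0" by simp
  moreover have "\<forall>\<^sub>F k in sequentially. norm (R k) \<le> \<epsilon> k * (2 * S + 2)"
    using half
  proof eventually_elim
    case (elim k)
    have "1 + spread y k \<le> 2 * S + 2" using elim S[of k] by linarith
    then have "\<epsilon> k * (1 + spread y k) \<le> \<epsilon> k * (2 * S + 2)" using \<epsilon>0 by (intro mult_left_mono) auto
    then show ?case using R[of k] by simp
  qed
  ultimately have "R \<longlonglongrightarrow> 0" by (rule Lim_null_comparison[rotated])
  from convergent_diff[OF conv convergentI[OF this]]
  have "convergent (\<lambda>k. energy y k - R k)" .
  then show "convergent (spread y)" unfolding energy by simp
qed

text \<open>As for Fejer monotone sequences: a subsequence of the centers approaches an optimal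
  \<open>z\<close>; the squared distances to this very \<open>z\<close> converge, and along the
  subsequence they tend to 0, so they tend to 0 altogether.\<close>

theorem path_converges_to_optimum:
  assumes "optimal_set total Y \<noteq> {}"
  shows "\<exists>z\<in>optimal_set total Y. \<forall>i. (\<lambda>k. x k i) \<longlonglongrightarrow> z"
proof -
  obtain y where y: "y \<in> optimal_set total Y" using assms by blast
  have F: "total (center k) - total y \<ge> 0" for k using optimal_setD(2)[OF y center_in_Y] by simp
  have small: "\<exists>k\<ge>N. total (center k) - total y < \<epsilon>" if "\<epsilon> > 0" for \<epsilon> N
    by (rule frequently_small_of_summable[OF spread_convergent(2)[OF y]]) (use F that in auto)
  have "\<exists>r. strict_mono r \<and> (\<forall>n. total (center (r n)) - total y < 1 / real (Suc n))"
  proof -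
    define r where "r = rec_nat (SOME k. total (center k) - total y < 1)
      (\<lambda>n m. SOME k. k > m \<and> total (center k) - total y < 1 / real (Suc (Suc n)))"
    have r0: "total (center (r 0)) - total y < 1"
      unfolding r_def using someI_ex[of "\<lambda>k. total (center k) - total y < 1"] small[of 1 0] by auto
    have rS: "r (Suc n) > r n \<and> total (center (r (Suc n))) - total y < 1 / real (Suc (Suc n))" for n
    proof -
      have "\<exists>k. k > r n \<and> total (center k) - total y < 1 / real (Suc (Suc n))"
        using small[of "1 / real (Suc (Suc n))" "Suc (r n)"] by (auto simp: Suc_le_eq)
      from someI_ex[OF this] show ?thesis by (simp add: r_def)
    qed
    have "total (center (r n)) - total y < 1 / real (Suc n)" for n
    proof (cases n)
      case 0
      then show ?thesis using r0 by simp
    next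
      case (Suc m)
      then show ?thesis using rS[of m] by blast
    qed
    moreover have "strict_mono r" using rS by (simp add: strict_mono_Suc_iff)
    ultimately show ?thesis by blast
  qed
  then obtain r where r: "strict_mono r" "\<And>n. total (center (r n)) - total y < 1 / real (Suc n)" by blast
  obtain S where S: "\<And>k. \<bar>spread y k\<bar> \<le> S"
    using convergent_imp_Bseq[OF spread_convergent(1)[OF y]] by (auto simp: Bseq_def)
  have "norm (center k - y) \<le> sqrt S" for k
  proof -
    have "norm (center k - y) \<le> norm (mean (x k) - y)"
      unfolding center_def using Y optimal_setD(1)[OF y] by (intro norm_closest_point_diff_le)
    moreover have "(norm (mean (x k) - y))\<^sup>2 \<le> S"
      using norm_mean_sq_le[of "x k" y] S[of k] by (simp add: spread_def)
    ultimately show ?thesis using real_le_rsqrt order_trans by blast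
  qed
  then have "bounded (range (\<lambda>n. center (r n)))"
    unfolding bounded_def by (intro exI[of _ y] exI[of _ "sqrt S"]) (auto simp: dist_norm norm_minus_commute)
  from bounded_imp_convergent_subsequence[OF this]
  obtain z r' where z: "strict_mono (r' :: nat \<Rightarrow> nat)" "((\<lambda>n. center (r n)) \<circ> r') \<longlonglongrightarrow> z" by blast
  define \<rho> where "\<rho> = r \<circ> r'"
  have \<rho>: "strict_mono \<rho>" unfolding \<rho>_def using r(1) z(1) by (rule strict_mono_o)
  have cz: "(\<lambda>n. center (\<rho> n)) \<longlonglongrightarrow> z" using z(2) by (simp add: \<rho>_def o_def)
  have zY: "z \<in> Y" using closed_sequentially[OF Y(1) _ cz] center_in_Y by blast
  have "(\<lambda>n. total (center (\<rho> n))) \<longlonglongrightarrow> total z"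
    by (rule isCont_tendsto_compose[OF continuous_total cz])
  moreover have "(\<lambda>n. total (center (\<rho> n))) \<longlonglongrightarrow> total y"
  proof -
    have "(\<lambda>n. total (center (r n)) - total y) \<longlonglongrightarrow> 0"
    proof (rule Lim_null_comparison[OF always_eventually])
      show "\<forall>n. norm (total (center (r n)) - total y) \<le> 1 / real (Suc n)"
        using r(2) F by (auto intro: less_imp_le)
      show "(\<lambda>n. 1 / real (Suc n)) \<longlonglongrightarrow> 0" by real_asymp
    qed
    then have "(\<lambda>n. total (center (r n))) \<longlonglongrightarrow> total y" by (simp add: LIM_zero_iff)
    from LIMSEQ_subseq_LIMSEQ[OF this z(1)] show ?thesis by (simp add: \<rho>_def o_def)
  qed
  ultimately have "total z = total y" by (rule LIMSEQ_unique)
  then have zopt: "z \<in> optimal_set total Y" using optimal_setI[OF y zY] by simp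
  have "(\<lambda>k. x k i - center k) \<longlonglongrightarrow> 0" for i
  proof (rule Lim_null_comparison[OF always_eventually])
    show "\<forall>k. norm (x k i - center k) \<le> 3 * gap k" using norm_diff_center_le by blast
    show "(\<lambda>k. 3 * gap k) \<longlonglongrightarrow> 0" using tendsto_mult[OF tendsto_const[of 3] gap_tendsto_0] by simp
  qed
  then have "(\<lambda>n. x (\<rho> n) i - center (\<rho> n)) \<longlonglongrightarrow> 0" for i
    using LIMSEQ_subseq_LIMSEQ[OF _ \<rho>] by (fastforce simp: o_def)
  from tendsto_add[OF this cz] have xz: "(\<lambda>n. x (\<rho> n) i) \<longlonglongrightarrow> z" for i by simp
  have "(\<lambda>n. spread z (\<rho> n)) \<longlonglongrightarrow> (\<Sum>i\<in>(UNIV::'v set). (norm (z - z))\<^sup>2)"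
    unfolding spread_def by (intro tendsto_sum tendsto_power tendsto_norm tendsto_diff tendsto_const xz)
  then have sub: "(\<lambda>n. spread z (\<rho> n)) \<longlonglongrightarrow> 0" by simp
  obtain l where l: "spread z \<longlonglongrightarrow> l" using spread_convergent(1)[OF zopt] by (auto simp: convergent_def)
  have "l = 0" using LIMSEQ_subseq_LIMSEQ[OF l \<rho>] sub LIMSEQ_unique by (auto simp: o_def)
  have "(\<lambda>k. x k i) \<longlonglongrightarrow> z" for i
  proof -
    have "(\<lambda>k. (norm (x k i - z))\<^sup>2) \<longlonglongrightarrow> 0"
    proof (rule Lim_null_comparison[OF always_eventually])
      show "\<forall>k. norm ((norm (x k i - z))\<^sup>2) \<le> spread z k"
        unfolding spread_def by (auto intro!: member_le_sum)
      show "spread z \<longlonglongrightarrow> 0" using l \<open>l = 0\<close> by simp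
    qed
    then have "(\<lambda>k. sqrt ((norm (x k i - z))\<^sup>2)) \<longlonglongrightarrow> sqrt 0" by (rule tendsto_real_sqrt)
    then have "(\<lambda>k. norm (x k i - z)) \<longlonglongrightarrow> 0" by simp
    then have "(\<lambda>k. x k i - z) \<longlonglongrightarrow> 0" by (rule tendsto_norm_zero_cancel)
    then show ?thesis by (simp add: LIM_zero_iff)
  qed
  then show ?thesis using zopt by blast
qed

end

end

section \<open>Measurability of projections on random sets\<close>

text \<open>The distance to a set is 1-Lipschitz in the point, so its sublevel sets are countable
  unions over a dense set of points \<open>q\<close>, for each of which only measurability in the
  index is required.\<close>

lemma infdist_pair_measurable:
  fixes X :: "'j \<Rightarrow> 'a::euclidean_space set"
  assumes [measurable]: "\<And>y. (\<lambda>j. infdist y (X j)) \<in> borel_measurable N"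
  shows "(\<lambda>p. infdist (fst p) (X (snd p))) \<in> borel_measurable (borel \<Otimes>\<^sub>M N)"
proof (subst borel_measurable_iff_less, intro allI)
  fix r :: real
  obtain D :: "'a set" where D: "countable D" "\<And>U. open U \<Longrightarrow> U \<noteq> {} \<Longrightarrow> \<exists>d\<in>D. d \<in> U"
    using countable_dense_setE by blast
  have "{p \<in> space (borel \<Otimes>\<^sub>M N). infdist (fst p) (X (snd p)) < r} =
    (\<Union>q\<in>D. {p \<in> space (borel \<Otimes>\<^sub>M N). dist (fst p) q + infdist q (X (snd p)) < r})" (is "?A = ?B")
  proof (intro equalityI subsetI)
    fix p assume p: "p \<in> ?A"
    let ?e = "(r - infdist (fst p) (X (snd p))) / 2"
    have "?e > 0" using p by simp
    then obtain q where q: "q \<in> D" "dist (fst p) q < ?e" using D(2)[of "ball (fst p) ?e"] by auto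
    have "infdist q (X (snd p)) \<le> infdist (fst p) (X (snd p)) + dist (fst p) q"
      using infdist_triangle[of q "X (snd p)" "fst p"] by (simp add: dist_commute)
    then have "dist (fst p) q + infdist q (X (snd p)) < r" using q(2) by (simp add: field_simps)
    then show "p \<in> ?B" using p q(1) by auto
  next
    fix p assume "p \<in> ?B"
    then obtain q where "p \<in> space (borel \<Otimes>\<^sub>M N)" "dist (fst p) q + infdist q (X (snd p)) < r" by blast
    then show "p \<in> ?A" using infdist_triangle[of "fst p" "X (snd p)" q] by simp
  qed
  also have "\<dots> \<in> sets (borel \<Otimes>\<^sub>M N)"
  proof (rule sets.countable_UN'[OF D(1)])
    have "{p \<in> space (borel \<Otimes>\<^sub>M N). dist (fst p) q + infdist q (X (snd p)) < r} \<in> sets (borel \<Otimes>\<^sub>M N)" for q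
      by measurable
    then show "(\<lambda>q. {p \<in> space (borel \<Otimes>\<^sub>M N). dist (fst p) q + infdist q (X (snd p)) < r}) ` D \<subseteq> sets (borel \<Otimes>\<^sub>M N)"
      by blast
  qed
  finally show "?A \<in> sets (borel \<Otimes>\<^sub>M N)" .
qed

text \<open>The projection is the gradient of \<open>norm y ^ 2 / 2 - infdist y C ^ 2 / 2\<close>, hence a limit of
  difference quotients of the distance.\<close>

lemma closest_point_inner_tendsto:
  fixes C :: "'a::euclidean_space set"
  assumes C: "closed C" "convex C" "C \<noteq> {}" and b: "norm b = 1"
  shows "(\<lambda>n. inner y b - real (Suc n) / 2 * ((infdist (y + (1 / real (Suc n)) *\<^sub>R b) C)\<^sup>2 - (infdist y C)\<^sup>2))
    \<longlonglongrightarrow> inner (closest_point C y) b"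
proof -
  let ?p = "closest_point C y"
  define h where "h n = 1 / real (Suc n)" for n
  define q where "q n = closest_point C (y + h n *\<^sub>R b)" for n
  define \<Delta> where "\<Delta> n = (infdist (y + h n *\<^sub>R b) C)\<^sup>2 - (infdist y C)\<^sup>2" for n
  have in_C: "closest_point C z \<in> C" for z using C closest_point_in_set by blast
  have d: "(infdist z C)\<^sup>2 = (norm (z - closest_point C z))\<^sup>2" for z
    using C by (simp add: infdist_eq_dist_closest_point dist_norm)
  have d_le: "(infdist z C)\<^sup>2 \<le> (norm (z - u))\<^sup>2" if "u \<in> C" for z u
    using infdist_le[OF that, of z] by (intro power_mono infdist_nonneg) (simp add: dist_norm)
  have expand: "(norm (y + h n *\<^sub>R b - u))\<^sup>2 = (norm (y - u))\<^sup>2 + 2 * h n * inner b (y - u) + (h n)\<^sup>2" for n u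
  proof -
    have bb: "inner b b = 1" using b by (simp add: norm_eq_1)
    show ?thesis unfolding power2_norm_eq_inner
      by (simp add: inner_diff_left inner_diff_right inner_add_left inner_add_right inner_commute bb
          algebra_simps power2_eq_square)
  qed
  have h: "h n > 0" for n by (simp add: h_def)
  have upper: "\<Delta> n \<le> 2 * h n * inner b (y - ?p) + (h n)\<^sup>2" for n
    using d_le[OF in_C, of "y + h n *\<^sub>R b" y] d[of y] unfolding expand \<Delta>_def by simp
  \<comment> \<open>For the upper bound the projection of \<open>y\<close> competed at the perturbed
    point. Here the projection \<open>q n\<close> of the perturbed point competes at
    \<open>y\<close>; it stays within \<open>h n\<close> of \<open>?p\<close> because projections
    are nonexpansive.\<close>
  have lower: "2 * h n * inner b (y - ?p) - 2 * (h n)\<^sup>2 \<le> \<Delta> n" for n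
  proof -
    have "norm (?p - q n) \<le> h n"
      using closest_point_lipschitz[of C y "y + h n *\<^sub>R b"] C b h[of n] by (simp add: dist_norm q_def)
    then have "\<bar>inner b (?p - q n)\<bar> \<le> h n"
      using Cauchy_Schwarz_ineq2[of b "?p - q n"] b by simp
    then have "h n * (- h n) \<le> h n * inner b (?p - q n)" using h[of n] by (intro mult_left_mono) auto
    moreover have "(norm (y - q n))\<^sup>2 + 2 * h n * inner b (y - q n) + (h n)\<^sup>2 - (norm (y - q n))\<^sup>2 \<le> \<Delta> n"
      using d_le[OF in_C, of y "y + h n *\<^sub>R b"] d[of "y + h n *\<^sub>R b"]
      unfolding expand \<Delta>_def q_def by simp
    moreover have "2 * h n * inner b (y - q n) = 2 * h n * inner b (y - ?p) + 2 * (h n * inner b (?p - q n))"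
      by (simp add: inner_diff_right algebra_simps)
    ultimately show ?thesis using zero_le_square[of "h n"]
      unfolding power2_eq_square mult_minus_right by linarith
  qed
  have "\<bar>(inner y b - real (Suc n) / 2 * \<Delta> n) - inner ?p b\<bar> \<le> h n" for n
  proof -
    have e: "real (Suc n) / 2 * \<Delta> n = \<Delta> n / (2 * h n)" by (simp add: h_def)
    have "\<Delta> n / (2 * h n) \<le> (2 * h n * inner b (y - ?p) + (h n)\<^sup>2) / (2 * h n)"
      using h[of n] upper[of n] by (intro divide_right_mono) auto
    also have "\<dots> = inner b (y - ?p) + h n / 2" using h[of n] by (simp add: add_divide_distrib power2_eq_square)
    finally have u: "\<Delta> n / (2 * h n) \<le> inner b (y - ?p) + h n / 2" .
    have "inner b (y - ?p) - h n = (2 * h n * inner b (y - ?p) - 2 * (h n)\<^sup>2) / (2 * h n)"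
      using h[of n] by (simp add: diff_divide_distrib power2_eq_square)
    also have "\<dots> \<le> \<Delta> n / (2 * h n)" using h[of n] lower[of n] by (intro divide_right_mono) auto
    finally have l: "inner b (y - ?p) - h n \<le> \<Delta> n / (2 * h n)" .
    have "inner b (y - ?p) = inner y b - inner ?p b" by (simp add: inner_diff_right inner_commute)
    then show ?thesis unfolding e abs_le_iff using u l h[of n] by (intro conjI) linarith+
  qed
  then have "\<forall>\<^sub>F n in sequentially. norm ((inner y b - real (Suc n) / 2 * \<Delta> n) - inner ?p b) \<le> h n"
    by (intro always_eventually) (simp only: real_norm_def, blast)
  moreover have "h \<longlonglongrightarrow> 0" unfolding h_def by real_asymp
  ultimately have "(\<lambda>n. (inner y b - real (Suc n) / 2 * \<Delta> n) - inner ?p b) \<longlonglongrightarrow> 0"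
    by (rule Lim_null_comparison)
  then show ?thesis unfolding \<Delta>_def h_def by (rule LIM_zero_cancel)
qed

text \<open>Each coordinate is a pointwise limit of expressions in \<open>infdist\<close>, so
  measurable distances already make random projections measurable.\<close>

lemma closest_point_pair_measurable:
  fixes X :: "'j \<Rightarrow> 'a::euclidean_space set"
  assumes X: "\<And>j. j \<in> space N \<Longrightarrow> closed (X j)" "\<And>j. j \<in> space N \<Longrightarrow> convex (X j)" "\<And>j. j \<in> space N \<Longrightarrow> X j \<noteq> {}"
    and meas: "\<And>y. (\<lambda>j. infdist y (X j)) \<in> borel_measurable N"
  shows "(\<lambda>p. closest_point (X (snd p)) (fst p)) \<in> borel_measurable (borel \<Otimes>\<^sub>M N)"
proof (subst borel_measurable_euclidean_space, intro ballI)
  fix b :: 'a assume b: "b \<in> Basis"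
  have [measurable]: "(\<lambda>p. infdist (h p) (X (snd p))) \<in> borel_measurable (borel \<Otimes>\<^sub>M N)"
    if [measurable]: "h \<in> borel_measurable (borel \<Otimes>\<^sub>M N)" for h
  proof -
    have "(\<lambda>p. (h p, snd p)) \<in> borel \<Otimes>\<^sub>M N \<rightarrow>\<^sub>M borel \<Otimes>\<^sub>M N" by measurable
    from measurable_compose[OF this infdist_pair_measurable[OF meas]] show ?thesis by simp
  qed
  show "(\<lambda>p. inner (closest_point (X (snd p)) (fst p)) b) \<in> borel_measurable (borel \<Otimes>\<^sub>M N)"
  proof (rule borel_measurable_LIMSEQ_real)
    fix p :: "'a \<times> 'j" assume "p \<in> space (borel \<Otimes>\<^sub>M N)"
    then have "snd p \<in> space N" by (auto simp: space_pair_measure)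
    then show "(\<lambda>n. inner (fst p) b - real (Suc n) / 2 * ((infdist (fst p + (1 / real (Suc n)) *\<^sub>R b) (X (snd p)))\<^sup>2 - (infdist (fst p) (X (snd p)))\<^sup>2))
        \<longlonglongrightarrow> inner (closest_point (X (snd p)) (fst p)) b"
      using b by (intro closest_point_inner_tendsto X) auto
  next
    fix n
    show "(\<lambda>p. inner (fst p) b - real (Suc n) / 2 * ((infdist (fst p + (1 / real (Suc n)) *\<^sub>R b) (X (snd p)))\<^sup>2 - (infdist (fst p) (X (snd p)))\<^sup>2))
      \<in> borel_measurable (borel \<Otimes>\<^sub>M N)"
      by measurable
  qed
qed

section \<open>Generated sigma-algebras, independence and freezing\<close>

lemma space_generated_sigma [simp]: "space (generated_sigma M N Y K) = space M"
  by (auto simp: generated_sigma_def intro!: space_measure_of)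

lemma sets_generated_sigma:
  "sets (generated_sigma M N Y K) = sigma_sets (space M) (\<Union>k\<in>K. {Y k -` A \<inter> space M |A. A \<in> sets (N k)})"
  unfolding generated_sigma_def by (rule sets_measure_of) auto

lemma sets_generated_sigma_mono:
  assumes "K \<subseteq> K'"
  shows "sets (generated_sigma M N Y K) \<subseteq> sets (generated_sigma M N Y K')"
  unfolding sets_generated_sigma using assms by (intro sigma_sets_mono') blast

lemma sets_generated_sigma_subset:
  assumes "\<And>k. k \<in> K \<Longrightarrow> Y k \<in> M \<rightarrow>\<^sub>M N k"
  shows "sets (generated_sigma M N Y K) \<subseteq> sets M"
  unfolding sets_generated_sigma
  by (rule sets.sigma_sets_subset) (use assms measurable_sets in blast)

lemma vimage_in_generated_sigma:
  assumes "k \<in> K" "A \<in> sets (N k)"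
  shows "Y k -` A \<inter> space M \<in> sets (generated_sigma M N Y K)"
  unfolding sets_generated_sigma using assms by (intro sigma_sets.Basic) blast

text \<open>The conditional probability of \<open>D\<close> given \<open>F\<close> is constant, and
  \<open>u\<close> may be pulled out of the conditional expectation.\<close>

lemma (in prob_space) integral_indep_event:
  assumes sub: "subalgebra M F" and D: "D \<in> events"
    and indep: "\<And>S. S \<in> sets F \<Longrightarrow> prob (D \<inter> S) = prob D * prob S"
    and u: "u \<in> borel_measurable F" "integrable M u"
  shows "(\<integral>\<omega>. indicat_real D \<omega> * u \<omega> \<partial>M) = prob D * (\<integral>\<omega>. u \<omega> \<partial>M)"
proof -
  interpret finite_measure_subalgebra M F by unfold_locales (rule sub)
  have uM: "u \<in> borel_measurable M" by (rule borel_measurable_integrable[OF u(2)])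
  have int: "integrable M (\<lambda>\<omega>. u \<omega> * indicat_real D \<omega>)"
    using integrable_mult_indicator[OF D u(2)] by (simp add: mult.commute)
  have "AE \<omega> in M. real_cond_exp M F (indicator D) \<omega> = prob D"
  proof (rule real_cond_exp_charact)
    fix S assume S: "S \<in> sets F"
    then have SM: "S \<in> events" using sub by (auto simp: subalgebra_def)
    have "(\<integral>x\<in>S. indicat_real D x \<partial>M) = prob (D \<inter> S)"
      unfolding set_lebesgue_integral_def using D SM
      by (simp add: indicator_inter_arith[symmetric] Int_commute)
    also have "\<dots> = (\<integral>x\<in>S. prob D \<partial>M)"
      unfolding indep[OF S] set_lebesgue_integral_def using SM by simp
    finally show "(\<integral>x\<in>S. indicat_real D x \<partial>M) = (\<integral>x\<in>S. prob D \<partial>M)" .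
  qed (use D in \<open>auto simp: less_top[symmetric]\<close>)
  then have "(\<integral>\<omega>. u \<omega> * real_cond_exp M F (indicator D) \<omega> \<partial>M) = (\<integral>\<omega>. u \<omega> * prob D \<partial>M)"
    using uM by (intro integral_cong_AE) auto
  moreover have "(\<integral>\<omega>. u \<omega> * real_cond_exp M F (indicator D) \<omega> \<partial>M) = (\<integral>\<omega>. u \<omega> * indicat_real D \<omega> \<partial>M)"
    using D by (intro real_cond_exp_intg(2) int u) auto
  ultimately show ?thesis by (simp add: mult.commute)
qed

text \<open>Independent information does not change a conditional expectation. Here
  \<open>F'\<close> contains \<open>F\<close> and makes \<open>W\<close> measurable, and
  \<open>H\<close> is independent of \<open>F'\<close>. On sets \<open>D \<inter> T\<close> both
  integrals split off the factor \<open>prob D\<close>; such sets are closed under intersection, and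
  Dynkin's argument extends the equality to what they generate.\<close>

lemma (in prob_space) set_integral_cond_exp_enlarged:
  assumes sub: "subalgebra M F" "subalgebra M F'" "sets F \<subseteq> sets F'"
    and H: "Int_stable H" "H \<subseteq> events"
    and indep: "\<And>D S. D \<in> H \<Longrightarrow> S \<in> sets F' \<Longrightarrow> prob (D \<inter> S) = prob D * prob S"
    and W: "W \<in> borel_measurable F'" "integrable M W"
    and S: "S \<in> sigma_sets (space M) {D \<inter> T | D T. D \<in> H \<and> T \<in> sets F}"
  shows "(\<integral>\<omega>\<in>S. W \<omega> \<partial>M) = (\<integral>\<omega>\<in>S. real_cond_exp M F W \<omega> \<partial>M)"
proof -
  interpret finite_measure_subalgebra M F by unfold_locales (rule sub)
  let ?G = "{D \<inter> T | D T. D \<in> H \<and> T \<in> sets F}"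
  let ?R = "real_cond_exp M F W"
  have int: "integrable M W" "integrable M ?R" by (auto intro: W(2) real_cond_exp_int(1)[OF W(2)])
  have sp: "space F = space M" "space F' = space M" using sub by (auto simp: subalgebra_def)
  have F_M: "sets F \<subseteq> events" using sub(1) by (simp add: subalgebra_def)
  have R: "?R \<in> borel_measurable F'"
    using borel_measurable_cond_exp[of M F W] sub(3) sp unfolding measurable_def by auto
  have G_M: "?G \<subseteq> events" using H(2) F_M by blast
  have GP: "?G \<subseteq> Pow (space M)" using G_M sets.sets_into_space by blast
  have stable: "Int_stable ?G"
  proof (rule Int_stableI)
    fix A B assume "A \<in> ?G" "B \<in> ?G"
    then obtain D T D' T' where *: "A = D \<inter> T" "B = D' \<inter> T'" "D \<in> H" "D' \<in> H" "T \<in> sets F" "T' \<in> sets F" by blast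
    then have "A \<inter> B = (D \<inter> D') \<inter> (T \<inter> T')" by blast
    moreover have "D \<inter> D' \<in> H" "T \<inter> T' \<in> sets F" using * H(1) by (auto dest: Int_stableD)
    ultimately show "A \<inter> B \<in> ?G" by blast
  qed
  have events: "A \<in> events" if "A \<in> sigma_sets (space M) ?G" for A
    using sets.sigma_sets_subset[OF G_M] that by blast
  show ?thesis
    using stable GP S
  proof (induction rule: sigma_sets_induct_disjoint)
    case (basic A)
    then obtain D T where A: "A = D \<inter> T" "D \<in> H" "T \<in> sets F" by blast
    have T: "T \<in> events" "T \<in> sets F'" using A F_M sub(3) by auto
    have *: "(\<integral>\<omega>\<in>A. u \<omega> \<partial>M) = prob D * (\<integral>\<omega>\<in>T. u \<omega> \<partial>M)"
      if u: "u \<in> borel_measurable F'" "integrable M u" for u :: "'a \<Rightarrow> real"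
    proof -
      have "(\<integral>\<omega>\<in>A. u \<omega> \<partial>M) = (\<integral>\<omega>. indicat_real D \<omega> * (indicat_real T \<omega> * u \<omega>) \<partial>M)"
        unfolding set_lebesgue_integral_def A by (simp add: indicator_inter_arith mult.assoc)
      also have "\<dots> = prob D * (\<integral>\<omega>. indicat_real T \<omega> * u \<omega> \<partial>M)"
      proof (rule integral_indep_event[OF sub(2)])
        show "(\<lambda>\<omega>. indicat_real T \<omega> * u \<omega>) \<in> borel_measurable F'" using T u by measurable
        show "integrable M (\<lambda>\<omega>. indicat_real T \<omega> * u \<omega>)"
          using integrable_mult_indicator[OF T(1) u(2)] by simp
      qed (use A H indep in auto)
      finally show ?thesis by (simp add: set_lebesgue_integral_def)
    qed
    show ?case using *[OF W] *[OF R int(2)] real_cond_exp_intA[OF W(2) A(3)] by simp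
  next
    case empty
    show ?case by (simp add: set_lebesgue_integral_def)
  next
    case (compl A)
    have A: "A \<in> events" by (rule events[OF compl(1)])
    have *: "(\<integral>\<omega>\<in>space M - A. u \<omega> \<partial>M) = (\<integral>\<omega>. u \<omega> \<partial>M) - (\<integral>\<omega>\<in>A. u \<omega> \<partial>M)"
      if u: "integrable M u" for u :: "'a \<Rightarrow> real"
    proof -
      have "(\<integral>\<omega>\<in>space M - A. u \<omega> \<partial>M) = (\<integral>\<omega>. u \<omega> - indicat_real A \<omega> * u \<omega> \<partial>M)"
        unfolding set_lebesgue_integral_def by (rule Bochner_Integration.integral_cong) (auto simp: indicator_def)
      then show ?thesis
        using u integrable_mult_indicator[OF A u] by (simp add: set_lebesgue_integral_def)
    qed
    show ?case using *[OF int(1)] *[OF int(2)] compl(2) real_cond_exp_int(2)[OF W(2)] by simp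
  next
    case (union A)
    have A: "A i \<in> events" for i using events union(2) by blast
    have disj: "i \<noteq> j \<Longrightarrow> A i \<inter> A j = {}" for i j using union(1) by (auto simp: disjoint_family_on_def)
    have "(\<integral>\<omega>\<in>(\<Union>i. A i). u \<omega> \<partial>M) = (\<Sum>i. \<integral>\<omega>\<in>A i. u \<omega> \<partial>M)"
      if u: "integrable M u" for u :: "'a \<Rightarrow> real"
      using A by (intro lebesgue_integral_countable_add A disj)
        (auto simp: set_integrable_def intro!: integrable_mult_indicator[OF _ u, simplified])
    then show ?case using int union(3) by simp
  qed
qed

text \<open>An inequality that holds at each fixed point, on every event of \<open>F\<close>, holds
  at a random point known to \<open>F\<close>: a simple function is constant on finitely many events
  of \<open>F\<close>, and continuity in the point with dominated convergence gives the
  limit.\<close>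

lemma (in prob_space) set_integral_freeze_nonneg:
  fixes \<phi> :: "'b::euclidean_space \<Rightarrow> 'a \<Rightarrow> real"
  assumes sub: "subalgebra M F" and S: "S \<in> sets F"
    and v: "v \<in> borel_measurable F" "\<And>\<omega>. \<omega> \<in> S \<Longrightarrow> norm (v \<omega>) \<le> R" and R: "R \<ge> 0"
    and nonneg: "\<And>S y. S \<in> sets F \<Longrightarrow> 0 \<le> (\<integral>\<omega>\<in>S. \<phi> y \<omega> \<partial>M)"
    and meas: "\<And>y. \<phi> y \<in> borel_measurable M"
    and cont: "\<And>\<omega>. \<omega> \<in> space M \<Longrightarrow> continuous_on UNIV (\<lambda>y. \<phi> y \<omega>)"
    and bound: "\<And>y \<omega>. \<omega> \<in> space M \<Longrightarrow> norm y \<le> 2 * R \<Longrightarrow> \<bar>\<phi> y \<omega>\<bar> \<le> B"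
  shows "0 \<le> (\<integral>\<omega>\<in>S. \<phi> (v \<omega>) \<omega> \<partial>M)"
proof -
  have sp: "space F = space M" and FM: "sets F \<subseteq> events" using sub by (auto simp: subalgebra_def)
  have SM: "S \<in> events" using S FM by blast
  \<comment> \<open>Cutting off outside \<open>S\<close> makes the bound \<open>R\<close> hold
    everywhere. The approximating simple functions are bounded by twice the norm of
    \<open>v'\<close>, whence the \<open>2 * R\<close> in the hypothesis on
    \<open>\<phi>\<close>.\<close>
  define v' where "v' \<omega> = indicat_real S \<omega> *\<^sub>R v \<omega>" for \<omega>
  have "v' \<in> borel_measurable F" unfolding v'_def using S v(1) by measurable
  from borel_measurable_implies_sequence_metric[OF this, of 0]
  obtain s where "\<forall>n. simple_function F (s n)" "\<forall>\<omega>\<in>space M. (\<lambda>n. s n \<omega>) \<longlonglongrightarrow> v' \<omega>"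
    "\<forall>n. \<forall>\<omega>\<in>space M. norm (s n \<omega>) \<le> 2 * norm (v' \<omega>)" unfolding sp by auto
  note s = this[rule_format]
  have bd: "norm (s n \<omega>) \<le> 2 * R" if "\<omega> \<in> space M" for n \<omega>
    using s(3)[OF that, of n] v(2)[of \<omega>] R by (cases "\<omega> \<in> S") (auto simp: v'_def)
  have split: "indicat_real S \<omega> * \<phi> (s n \<omega>) \<omega> =
      (\<Sum>y\<in>s n ` space M. indicat_real (S \<inter> (s n -` {y} \<inter> space M)) \<omega> * \<phi> y \<omega>)"
    if \<omega>: "\<omega> \<in> space M" for n \<omega>
  proof -
    have "(\<Sum>y\<in>s n ` space M. indicat_real (S \<inter> (s n -` {y} \<inter> space M)) \<omega> * \<phi> y \<omega>) =
        (\<Sum>y\<in>s n ` space M. if y = s n \<omega> then indicat_real S \<omega> * \<phi> (s n \<omega>) \<omega> else 0)"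
      using \<omega> by (intro sum.cong) (auto simp: indicator_def)
    also have "\<dots> = indicat_real S \<omega> * \<phi> (s n \<omega>) \<omega>"
      using \<omega> simple_functionD(1)[OF s(1)[of n]] sp by (subst sum.delta) auto
    finally show ?thesis ..
  qed
  have piece: "S \<inter> (s n -` {y} \<inter> space M) \<in> sets F" for n y
    using S simple_functionD(2)[OF s(1)[of n], of "{y}"] sp by auto
  have pos: "0 \<le> (\<integral>\<omega>. indicat_real S \<omega> * \<phi> (s n \<omega>) \<omega> \<partial>M)" for n
  proof -
    have "(\<integral>\<omega>. indicat_real S \<omega> * \<phi> (s n \<omega>) \<omega> \<partial>M) =
        (\<integral>\<omega>. (\<Sum>y\<in>s n ` space M. indicat_real (S \<inter> (s n -` {y} \<inter> space M)) \<omega> * \<phi> y \<omega>) \<partial>M)"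
      by (intro Bochner_Integration.integral_cong refl split)
    also have "\<dots> = (\<Sum>y\<in>s n ` space M. \<integral>\<omega>. indicat_real (S \<inter> (s n -` {y} \<inter> space M)) \<omega> * \<phi> y \<omega> \<partial>M)"
    proof (rule Bochner_Integration.integral_sum)
      fix y assume "y \<in> s n ` space M"
      then have y: "norm y \<le> 2 * R" using bd by auto
      have [measurable]: "S \<inter> (s n -` {y} \<inter> space M) \<in> events" using piece FM by blast
      note meas[measurable]
      show "integrable M (\<lambda>\<omega>. indicat_real (S \<inter> (s n -` {y} \<inter> space M)) \<omega> * \<phi> y \<omega>)"
      proof (rule integrable_const_bound[where B = "\<bar>B\<bar>"])
        show "AE \<omega> in M. norm (indicat_real (S \<inter> (s n -` {y} \<inter> space M)) \<omega> * \<phi> y \<omega>) \<le> \<bar>B\<bar>"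
        proof (rule AE_I2)
          fix \<omega> assume "\<omega> \<in> space M"
          from bound[OF this y] show "norm (indicat_real (S \<inter> (s n -` {y} \<inter> space M)) \<omega> * \<phi> y \<omega>) \<le> \<bar>B\<bar>"
            by (auto simp: indicator_def)
        qed
      qed measurable
    qed
    also have "\<dots> \<ge> 0"
      using nonneg[OF piece] by (intro sum_nonneg) (simp add: set_lebesgue_integral_def)
    finally show ?thesis .
  qed
  have conv: "(\<lambda>n. indicat_real S \<omega> * \<phi> (s n \<omega>) \<omega>) \<longlonglongrightarrow> indicat_real S \<omega> * \<phi> (v \<omega>) \<omega>"
    if \<omega>: "\<omega> \<in> space M" for \<omega>
  proof (cases "\<omega> \<in> S")
    case True
    then have "(\<lambda>n. s n \<omega>) \<longlonglongrightarrow> v \<omega>" using s(2)[OF \<omega>] by (simp add: v'_def)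
    from continuous_on_tendsto_compose[OF cont[OF \<omega>] this]
    show ?thesis by (intro tendsto_mult_left) auto
  qed simp
  have meas_n: "(\<lambda>\<omega>. indicat_real S \<omega> * \<phi> (s n \<omega>) \<omega>) \<in> borel_measurable M" for n
  proof -
    have "S \<inter> (s n -` {y} \<inter> space M) \<in> events" for y using piece FM by blast
    then show ?thesis
      by (intro measurable_cong[THEN iffD2, OF split] borel_measurable_sum borel_measurable_times
          borel_measurable_indicator meas)
  qed
  have "(\<lambda>n. \<integral>\<omega>. indicat_real S \<omega> * \<phi> (s n \<omega>) \<omega> \<partial>M) \<longlonglongrightarrow> (\<integral>\<omega>. indicat_real S \<omega> * \<phi> (v \<omega>) \<omega> \<partial>M)"
  proof (rule integral_dominated_convergence[where w = "\<lambda>_. \<bar>B\<bar>"])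
    show "(\<lambda>\<omega>. indicat_real S \<omega> * \<phi> (v \<omega>) \<omega>) \<in> borel_measurable M"
      by (rule borel_measurable_LIMSEQ_real[OF conv meas_n])
    show "AE \<omega> in M. norm (indicat_real S \<omega> * \<phi> (s n \<omega>) \<omega>) \<le> \<bar>B\<bar>" for n
    proof (rule AE_I2)
      fix \<omega> assume \<omega>: "\<omega> \<in> space M"
      have "\<bar>\<phi> (s n \<omega>) \<omega>\<bar> \<le> \<bar>B\<bar>"
        using bound[OF \<omega> bd[OF \<omega>]] abs_ge_self by (rule order_trans)
      then show "norm (indicat_real S \<omega> * \<phi> (s n \<omega>) \<omega>) \<le> \<bar>B\<bar>"
        by (auto simp: indicator_def)
    qed
  qed (use meas_n conv in auto)
  then have "0 \<le> (\<integral>\<omega>. indicat_real S \<omega> * \<phi> (v \<omega>) \<omega> \<partial>M)"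
    by (rule LIMSEQ_le_const) (use pos in auto)
  then show ?thesis by (simp add: set_lebesgue_integral_def)
qed

lemma AE_summable_of_summable_integral:
  fixes u :: "nat \<Rightarrow> 'w \<Rightarrow> real"
  assumes int: "\<And>k. integrable M (u k)" and nonneg: "\<And>k \<omega>. \<omega> \<in> space M \<Longrightarrow> u k \<omega> \<ge> 0"
    and sum: "summable (\<lambda>k. \<integral>\<omega>. u k \<omega> \<partial>M)"
  shows "AE \<omega> in M. summable (\<lambda>k. u k \<omega>)"
proof -
  have "(\<integral>\<^sup>+ \<omega>. (\<Sum>k. ennreal (u k \<omega>)) \<partial>M) = (\<Sum>k. \<integral>\<^sup>+ \<omega>. ennreal (u k \<omega>) \<partial>M)"
    using int by (intro nn_integral_suminf) auto
  also have "\<dots> = (\<Sum>k. ennreal (\<integral>\<omega>. u k \<omega> \<partial>M))"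
    using int nonneg by (intro suminf_cong nn_integral_eq_integral) auto
  also have "\<dots> = ennreal (\<Sum>k. \<integral>\<omega>. u k \<omega> \<partial>M)"
    using nonneg sum by (intro suminf_ennreal2 integral_nonneg_AE) auto
  finally have "(\<integral>\<^sup>+ \<omega>. (\<Sum>k. ennreal (u k \<omega>)) \<partial>M) \<noteq> \<infinity>" by simp
  then have "AE \<omega> in M. (\<Sum>k. ennreal (u k \<omega>)) \<noteq> \<infinity>"
    using int by (intro nn_integral_noteq_infinite) auto
  then show ?thesis
    using AE_space by eventually_elim (use nonneg in \<open>auto intro!: summable_suminf_not_top\<close>)
qed

lemma (in finite_measure) set_integrable_bounded:
  fixes u :: "'a \<Rightarrow> real"
  assumes S: "S \<in> sets M" and u: "u \<in> borel_measurable M" and bound: "\<And>\<omega>. \<omega> \<in> S \<Longrightarrow> \<bar>u \<omega>\<bar> \<le> B"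
  shows "set_integrable M S u"
  unfolding set_integrable_def
proof (rule integrable_const_bound[where B = "\<bar>B\<bar>"])
  show "AE \<omega> in M. norm (indicat_real S \<omega> *\<^sub>R u \<omega>) \<le> \<bar>B\<bar>"
    using bound by (intro AE_I2) (force simp: indicator_def)
  show "(\<lambda>\<omega>. indicat_real S \<omega> *\<^sub>R u \<omega>) \<in> borel_measurable M" using S u by measurable
qed

lemma set_integral_mono_sets:
  fixes u v :: "'w \<Rightarrow> real"
  assumes "set_integrable M S u" "set_integrable M S v" "\<And>\<omega>. \<omega> \<in> S \<Longrightarrow> \<omega> \<in> space M \<Longrightarrow> u \<omega> \<le> v \<omega>"
  shows "(\<integral>\<omega>\<in>S. u \<omega> \<partial>M) \<le> (\<integral>\<omega>\<in>S. v \<omega> \<partial>M)"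
  using assms unfolding set_integrable_def set_lebesgue_integral_def
  by (intro integral_mono) (auto simp: indicator_def)

section \<open>The random process\<close>

text \<open>The random process with one Lipschitz constant for all agents; the set \<open>Y\<close>
  of the deterministic part becomes the feasible set.\<close>

locale grp_process = prob_space M + convex_problem "feasible_set N X" f g L G
  for M :: "'w measure" and N :: "'v::finite \<Rightarrow> 'j measure"
    and X :: "'v \<Rightarrow> 'j \<Rightarrow> 'a::euclidean_space set"
    and f :: "'v \<Rightarrow> 'a \<Rightarrow> real" and g :: "'v \<Rightarrow> 'a \<Rightarrow> 'a" and L G +
  fixes E :: "'v set set"
    and P :: "'v \<Rightarrow> 'v \<Rightarrow> real"
    and I J :: "nat \<Rightarrow> 'w \<Rightarrow> 'v"
    and \<Omega> :: "'v \<Rightarrow> nat \<Rightarrow> 'w \<Rightarrow> 'j"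
    and c :: real
    and x :: "'v \<Rightarrow> nat \<Rightarrow> 'w \<Rightarrow> 'a"
  assumes graph: "simple_graph E" "connected_graph E"
    and stochastic: "\<And>i j. P i j \<ge> 0" "\<And>i. (\<Sum>j\<in>UNIV. P i j) = 1"
    and support: "\<And>i j. {i, j} \<in> E \<Longrightarrow> P j i > 0" "\<And>i j. {i, j} \<notin> E \<Longrightarrow> P j i = 0"
    and gossip: "gossip_selection M P I J"
    and sets_closed_convex: "\<And>i j. j \<in> space (N i) \<Longrightarrow> closed (X i j) \<and> convex (X i j)"
    and dist_measurable: "\<And>i y. (\<lambda>j. infdist y (X i j)) \<in> borel_measurable (N i)"
    and choices: "\<And>i k. k \<ge> 1 \<Longrightarrow> \<Omega> i k \<in> measurable M (N i)"
    and c_pos: "c > 0"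
    and regularity: "\<And>i k y. k \<ge> 1 \<Longrightarrow>
        AE \<omega> in M. (infdist y (feasible_set N X))\<^sup>2 \<le>
          c * real_cond_exp M (past_choices M N \<Omega> k) (\<lambda>\<omega>. (infdist y (X i (\<Omega> i k \<omega>)))\<^sup>2) \<omega>"
    and initial: "\<And>i. x i 0 \<in> borel_measurable M"
    and sources: "independent_sources M N (\<lambda>i. x i 0) I J \<Omega>"
    and algorithm: "\<And>\<omega>. \<omega> \<in> space M \<Longrightarrow>
        grp_path (\<lambda>k. I k \<omega>) (\<lambda>k. J k \<omega>) (\<lambda>i k. X i (\<Omega> i k \<omega>)) g
          (\<lambda>i k. 1 / real (num_updates (\<lambda>t. I t \<omega>) (\<lambda>t. J t \<omega>) i k))
          (\<lambda>i k. x i k \<omega>)"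
begin

abbreviation "Y \<equiv> feasible_set N X"

lemma choice_in_space: "k \<ge> 1 \<Longrightarrow> \<omega> \<in> space M \<Longrightarrow> \<Omega> i k \<omega> \<in> space (N i)"
  using choices measurable_space by metis

lemma component_set:
  assumes "j \<in> space (N i)"
  shows "closed (X i j)" "convex (X i j)" "Y \<subseteq> X i j" "X i j \<noteq> {}"
proof -
  show "closed (X i j)" "convex (X i j)" using sets_closed_convex[OF assms] by auto
  show "Y \<subseteq> X i j" using assms by (auto simp: feasible_set_def)
  then show "X i j \<noteq> {}" using Y(3) by auto
qed

subsection \<open>The law of the gossip pairs\<close>

definition pair_prob :: "'v \<Rightarrow> 'v \<Rightarrow> real" where
  "pair_prob a b = P a b / real CARD('v)"

definition pair_event :: "nat \<Rightarrow> 'v \<Rightarrow> 'v \<Rightarrow> 'w set" where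
  "pair_event k a b = {\<omega> \<in> space M. I k \<omega> = a \<and> J k \<omega> = b}"

lemma pair_prob_nonneg: "pair_prob a b \<ge> 0"
  using stochastic by (simp add: pair_prob_def)

lemma pair_prob_row: "(\<Sum>b\<in>UNIV. pair_prob a b) = 1 / real CARD('v)"
  by (simp add: pair_prob_def stochastic(2) flip: sum_divide_distrib)

lemma pair_prob_sum: "(\<Sum>a\<in>UNIV. \<Sum>b\<in>UNIV. pair_prob a b) = 1"
  by (simp add: pair_prob_row)

lemma pair_prob_edge: "{a, b} \<in> E \<Longrightarrow> pair_prob a b > 0"
  using support(1)[of b a] by (simp add: pair_prob_def insert_commute)

lemma pair_prob_diag: "pair_prob a a = 0"
proof -
  have "{a, a} \<notin> E" using graph(1) by (auto simp: simple_graph_def)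
  then show ?thesis using support(2)[of a a] by (simp add: pair_prob_def)
qed

lemma gossip_indep_vars: "indep_vars (\<lambda>_. count_space UNIV) (\<lambda>k \<omega>. (I k \<omega>, J k \<omega>)) {1..}"
  using gossip unfolding gossip_selection_def by blast

lemma pair_measurable: "k \<ge> 1 \<Longrightarrow> (\<lambda>\<omega>. (I k \<omega>, J k \<omega>)) \<in> M \<rightarrow>\<^sub>M count_space UNIV"
  using gossip_indep_vars unfolding indep_vars_def by auto

lemma pair_event_vimage: "pair_event k a b = (\<lambda>\<omega>. (I k \<omega>, J k \<omega>)) -` {(a, b)} \<inter> space M"
  by (auto simp: pair_event_def)

lemma pair_event_in_events: "k \<ge> 1 \<Longrightarrow> pair_event k a b \<in> events"
  unfolding pair_event_vimage by (rule measurable_sets[OF pair_measurable]) auto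

lemma prob_pair_event:
  assumes "k \<ge> 1"
  shows "prob (pair_event k a b) = pair_prob a b"
proof -
  have wake: "\<P>(\<omega> in M. I k \<omega> = a) = 1 / real CARD('v)"
    and contact: "\<P>(\<omega> in M. J k \<omega> = b \<bar> I k \<omega> = a) = P a b"
    using gossip assms unfolding gossip_selection_def by blast+
  from contact[unfolded cond_prob_def wake] show ?thesis
    unfolding pair_event_def pair_prob_def by (simp add: field_simps conj_commute)
qed

lemma pair_event_diag_null: "k \<ge> 1 \<Longrightarrow> AE \<omega> in M. \<omega> \<notin> pair_event k a a"
  using prob_pair_event[of k a a] pair_event_in_events[of k a a]
  by (intro AE_not_in) (simp add: null_sets_def emeasure_eq_measure pair_prob_diag)

lemma AE_distinct_pair: "AE \<omega> in M. \<forall>k. I (Suc k) \<omega> \<noteq> J (Suc k) \<omega>"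
proof -
  have "AE \<omega> in M. \<forall>k a. \<omega> \<notin> pair_event (Suc k) a a"
    using pair_event_diag_null by (simp add: AE_all_countable AE_finite_all)
  then show ?thesis using AE_space by eventually_elim (simp add: pair_event_def, metis)
qed

subsection \<open>Information generated up to a given time\<close>

definition initial_events :: "'w set set" where
  "initial_events = sets (generated_sigma M (\<lambda>_. borel) (\<lambda>i. x i 0) UNIV)"

definition gossip_events :: "nat set \<Rightarrow> 'w set set" where
  "gossip_events T = sets (generated_sigma M (\<lambda>_. count_space UNIV) (\<lambda>k \<omega>. (I k \<omega>, J k \<omega>)) T)"

definition choice_events :: "nat set \<Rightarrow> 'w set set" where
  "choice_events U = sets (generated_sigma M (\<lambda>(l, t). N l) (\<lambda>(l, t). \<Omega> l t) (UNIV \<times> U))"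

text \<open>Two time sets, because two kinds of past occur: the pair at time \<open>k\<close> is
  independent of earlier pairs together with all choices, while regularity at time \<open>k\<close>
  is needed given all pairs and the earlier choices. The generating intersections are closed under
  intersection, so independence need only be checked on them.\<close>

definition info :: "nat set \<Rightarrow> nat set \<Rightarrow> 'w measure" where
  "info T U = sigma (space M) {A \<inter> B \<inter> C | A B C. A \<in> initial_events \<and> B \<in> gossip_events T \<and> C \<in> choice_events U}"

lemma space_in_source_events:
  "space M \<in> initial_events" "space M \<in> gossip_events T" "space M \<in> choice_events U"
  unfolding initial_events_def gossip_events_def choice_events_def
  using sets.top[of "generated_sigma M K H S" for K H S] by (metis space_generated_sigma)+

lemma source_events_subset:
  "initial_events \<subseteq> events" "T \<subseteq> {1..} \<Longrightarrow> gossip_events T \<subseteq> events" "U \<subseteq> {1..} \<Longrightarrow> choice_events U \<subseteq> events"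
proof -
  show "initial_events \<subseteq> events"
    unfolding initial_events_def by (rule sets_generated_sigma_subset) (rule initial)
  show "gossip_events T \<subseteq> events" if "T \<subseteq> {1..}"
    unfolding gossip_events_def
    by (rule sets_generated_sigma_subset, rule pair_measurable) (use that in auto)
  show "choice_events U \<subseteq> events" if "U \<subseteq> {1..}"
    unfolding choice_events_def
    by (rule sets_generated_sigma_subset) (use that choices in \<open>auto simp: subset_eq\<close>)
qed

lemma source_events_mono:
  "T \<subseteq> T' \<Longrightarrow> gossip_events T \<subseteq> gossip_events T'" "U \<subseteq> U' \<Longrightarrow> choice_events U \<subseteq> choice_events U'"
  unfolding gossip_events_def choice_events_def by (intro sets_generated_sigma_mono; blast)+

lemma source_events_Int:
  "A \<in> initial_events \<Longrightarrow> B \<in> initial_events \<Longrightarrow> A \<inter> B \<in> initial_events"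
  "A \<in> gossip_events T \<Longrightarrow> B \<in> gossip_events T \<Longrightarrow> A \<inter> B \<in> gossip_events T"
  "A \<in> choice_events U \<Longrightarrow> B \<in> choice_events U \<Longrightarrow> A \<inter> B \<in> choice_events U"
  unfolding initial_events_def gossip_events_def choice_events_def by auto

lemma source_events_sets_into_space:
  "A \<in> initial_events \<Longrightarrow> A \<subseteq> space M" "A \<in> gossip_events T \<Longrightarrow> A \<subseteq> space M"
  "A \<in> choice_events U \<Longrightarrow> A \<subseteq> space M"
  unfolding initial_events_def gossip_events_def choice_events_def
  by (auto dest!: sets.sets_into_space)

lemma space_info [simp]: "space (info T U) = space M"
  unfolding info_def by (rule space_measure_of) (use source_events_sets_into_space in blast)

lemma sets_info: "sets (info T U) = sigma_sets (space M)
    {A \<inter> B \<inter> C | A B C. A \<in> initial_events \<and> B \<in> gossip_events T \<and> C \<in> choice_events U}"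
  unfolding info_def by (rule sets_measure_of) (use source_events_sets_into_space in blast)

lemma source_events_in_info:
  "initial_events \<subseteq> sets (info T U)" "gossip_events T \<subseteq> sets (info T U)" "choice_events U \<subseteq> sets (info T U)"
proof -
  have in_info: "D \<in> sets (info T U)"
    if "D = A \<inter> B \<inter> C" "A \<in> initial_events" "B \<in> gossip_events T" "C \<in> choice_events U" for A B C D
    unfolding sets_info using that by (intro sigma_sets.Basic) blast
  note top = space_in_source_events
  show "initial_events \<subseteq> sets (info T U)"
  proof
    fix D assume D: "D \<in> initial_events"
    show "D \<in> sets (info T U)"
      by (rule in_info[OF _ D top(2,3)]) (use source_events_sets_into_space(1)[OF D] in blast)
  qed
  show "gossip_events T \<subseteq> sets (info T U)"
  proof
    fix D assume D: "D \<in> gossip_events T"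
    show "D \<in> sets (info T U)"
      by (rule in_info[OF _ top(1) D top(3)]) (use source_events_sets_into_space(2)[OF D] in blast)
  qed
  show "choice_events U \<subseteq> sets (info T U)"
  proof
    fix D assume D: "D \<in> choice_events U"
    show "D \<in> sets (info T U)"
      by (rule in_info[OF _ top(1,2) D]) (use source_events_sets_into_space(3)[OF D] in blast)
  qed
qed

lemma sets_info_mono:
  assumes "T \<subseteq> T'" "U \<subseteq> U'"
  shows "sets (info T U) \<subseteq> sets (info T' U')"
  unfolding sets_info
proof (rule sigma_sets_mono', rule subsetI)
  fix D assume "D \<in> {A \<inter> B \<inter> C | A B C. A \<in> initial_events \<and> B \<in> gossip_events T \<and> C \<in> choice_events U}"
  then obtain A B C where *: "D = A \<inter> B \<inter> C" "A \<in> initial_events" "B \<in> gossip_events T" "C \<in> choice_events U" by blast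
  have "B \<in> gossip_events T'" "C \<in> choice_events U'"
    using *(3,4) source_events_mono(1)[OF assms(1)] source_events_mono(2)[OF assms(2)] by (auto dest: subsetD)
  with *(1,2) show "D \<in> {A \<inter> B \<inter> C | A B C. A \<in> initial_events \<and> B \<in> gossip_events T' \<and> C \<in> choice_events U'}"
    by blast
qed

lemma subalgebra_info:
  assumes "T \<subseteq> {1..}" "U \<subseteq> {1..}"
  shows "subalgebra M (info T U)"
proof -
  have "sets (info T U) \<subseteq> events"
    unfolding sets_info using source_events_subset assms by (intro sets.sigma_sets_subset) blast
  then show ?thesis by (simp add: subalgebra_def)
qed

lemma prob_source_events:
  assumes "A \<in> initial_events" "B \<in> gossip_events {1..}" "C \<in> choice_events {1..}"
  shows "prob (A \<inter> B \<inter> C) = prob A * prob B * prob C"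
proof -
  have "indep_sets (\<lambda>s. [initial_events, gossip_events {1..}, choice_events {1..}] ! s) {..<3}"
    using sources unfolding independent_sources_def initial_events_def gossip_events_def choice_events_def .
  from indep_setsD[OF this, of "{..<3}" "\<lambda>s. [A, B, C] ! s"]
  show ?thesis using assms by (simp add: numeral_3_eq_3 lessThan_Suc ac_simps All_less_Suc)
qed

lemma prob_choice_indep:
  assumes "A \<in> initial_events" "B \<in> gossip_events {1..}" "C \<in> choice_events {1..}"
  shows "prob (A \<inter> B \<inter> C) = prob (A \<inter> B) * prob C"
  using prob_source_events[OF assms] prob_source_events[OF assms(1,2) space_in_source_events(3)]
    source_events_sets_into_space(1)[OF assms(1)]
  by (simp add: prob_space Int_absorb2 inf.coboundedI1)

lemma pair_event_in_gossip_events: "k \<in> T \<Longrightarrow> pair_event k a b \<in> gossip_events T"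
  unfolding pair_event_vimage gossip_events_def
  by (rule vimage_in_generated_sigma[where N = "\<lambda>_. count_space UNIV" and Y = "\<lambda>k \<omega>. (I k \<omega>, J k \<omega>)"]) auto

text \<open>The independent pairs are grouped into two blocks, the times before \<open>k\<close> and
  \<open>k\<close> itself, indexed by a Boolean.\<close>

lemma prob_gossip_future:
  assumes k: "k \<ge> 1" and B: "B \<in> gossip_events {1..<k}"
  shows "prob (B \<inter> pair_event k a b) = prob B * pair_prob a b"
proof -
  let ?Z = "\<lambda>k \<omega>. (I k \<omega>, J k \<omega>)"
  let ?E = "\<lambda>k. {?Z k -` A \<inter> space M |A. A \<in> sets (count_space UNIV)}"
  define K where "K j = (if j then {1..<k} else {k})" for j :: bool
  have "indep_sets ?E {1..}" using gossip_indep_vars unfolding indep_vars_def2 by blast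
  then have "indep_sets ?E (\<Union>j\<in>UNIV. K j)"
    by (rule indep_sets_mono_index[rotated]) (use k in \<open>auto simp: K_def split: if_splits\<close>)
  then have "indep_sets (\<lambda>j. sigma_sets (space M) (\<Union>i\<in>K j. ?E i)) UNIV"
  proof (rule indep_sets_collect_sigma)
    show "Int_stable (?E i)" for i
    proof (rule Int_stableI)
      fix A B assume "A \<in> ?E i" "B \<in> ?E i"
      then obtain A' B' where "A = ?Z i -` A' \<inter> space M" "B = ?Z i -` B' \<inter> space M" by blast
      then have eq: "A \<inter> B = ?Z i -` (A' \<inter> B') \<inter> space M" by blast
      show "A \<inter> B \<in> ?E i" by (intro CollectI exI[of _ "A' \<inter> B'"] conjI eq) simp
    qed
    show "disjoint_family_on K UNIV" by (auto simp: disjoint_family_on_def K_def)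
  qed
  from indep_setsD[OF this, of UNIV "\<lambda>j. if j then B else pair_event k a b"]
  have "B \<in> sigma_sets (space M) (\<Union>i\<in>{1..<k}. ?E i) \<Longrightarrow>
      pair_event k a b \<in> sigma_sets (space M) (\<Union>i\<in>{k}. ?E i) \<Longrightarrow>
      prob (B \<inter> pair_event k a b) = prob B * prob (pair_event k a b)"
    by (auto simp: K_def UNIV_bool ac_simps)
  moreover have "B \<in> sigma_sets (space M) (\<Union>i\<in>{1..<k}. ?E i)"
    using B unfolding gossip_events_def sets_generated_sigma .
  moreover have "pair_event k a b \<in> sigma_sets (space M) (\<Union>i\<in>{k}. ?E i)"
    using pair_event_in_gossip_events[of k "{k}"] unfolding gossip_events_def sets_generated_sigma by simp
  ultimately show ?thesis using prob_pair_event[OF k] by simp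
qed

text \<open>On a generating intersection the pair event is merged with the gossip component; the
  three sources factor, and so do pairs at different times. Closure under intersection carries
  independence to the whole sigma-algebra.\<close>

lemma prob_pair_event_indep:
  assumes k: "k \<ge> 1" and S: "S \<in> sets (info {1..<k} {1..})"
  shows "prob (pair_event k a b \<inter> S) = prob (pair_event k a b) * prob S"
proof -
  let ?G = "{A \<inter> B \<inter> C | A B C. A \<in> initial_events \<and> B \<in> gossip_events {1..<k} \<and> C \<in> choice_events {1..}}"
  let ?D = "pair_event k a b"
  have sub: "{1..<k} \<subseteq> {1..}" by auto
  have "indep_set {?D} ?G"
    unfolding indep_sets2_eq
  proof (intro conjI ballI)
    show "{?D} \<subseteq> events" using pair_event_in_events[OF k] by simp
    show "?G \<subseteq> events" using source_events_subset sub by blast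
    fix D S assume "D \<in> {?D}" "S \<in> ?G"
    then obtain A B C where *: "D = ?D" "S = A \<inter> B \<inter> C" "A \<in> initial_events" "B \<in> gossip_events {1..<k}" "C \<in> choice_events {1..}"
      by blast
    have B: "B \<in> gossip_events {1..}" using *(4) source_events_mono(1)[OF sub] by blast
    have BD: "B \<inter> ?D \<in> gossip_events {1..}"
      using B pair_event_in_gossip_events[of k "{1..}"] k by (intro source_events_Int(2)) auto
    have "D \<inter> S = A \<inter> (B \<inter> ?D) \<inter> C" using * by blast
    then have "prob (D \<inter> S) = prob A * prob (B \<inter> ?D) * prob C"
      using prob_source_events[OF *(3) BD *(5)] by simp
    also have "\<dots> = prob ?D * (prob A * prob B * prob C)"
      using prob_gossip_future[OF k *(4)] prob_pair_event[OF k] by simp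
    also have "\<dots> = prob D * prob S" using prob_source_events[OF *(3) B *(5)] * by simp
    finally show "prob (D \<inter> S) = prob D * prob S" .
  qed
  moreover have "Int_stable {?D}" by (auto simp: Int_stable_def)
  moreover have "Int_stable ?G"
  proof (rule Int_stableI)
    fix S S' assume "S \<in> ?G" "S' \<in> ?G"
    then obtain A B C A' B' C' where "S = A \<inter> B \<inter> C" "S' = A' \<inter> B' \<inter> C'"
      "A \<in> initial_events" "B \<in> gossip_events {1..<k}" "C \<in> choice_events {1..}"
      "A' \<in> initial_events" "B' \<in> gossip_events {1..<k}" "C' \<in> choice_events {1..}" by blast
    then have "S \<inter> S' = (A \<inter> A') \<inter> (B \<inter> B') \<inter> (C \<inter> C')" "A \<inter> A' \<in> initial_events"
      "B \<inter> B' \<in> gossip_events {1..<k}" "C \<inter> C' \<in> choice_events {1..}"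
      by (auto intro: source_events_Int)
    then show "S \<inter> S' \<in> ?G" by blast
  qed
  ultimately have "indep_set (sigma_sets (space M) {?D}) (sigma_sets (space M) ?G)"
    by (rule indep_set_sigma_sets)
  then show ?thesis using S unfolding indep_sets2_eq sets_info by (auto intro: sigma_sets.Basic)
qed

lemma initial_measurable_info: "x i 0 \<in> borel_measurable (info T U)"
proof (rule measurableI)
  fix A :: "'a set" assume "A \<in> sets borel"
  then have "x i 0 -` A \<inter> space M \<in> initial_events"
    unfolding initial_events_def
    by (intro vimage_in_generated_sigma[where N = "\<lambda>_. borel" and Y = "\<lambda>i. x i 0"]) auto
  then show "x i 0 -` A \<inter> space (info T U) \<in> sets (info T U)"
    using source_events_in_info(1) by auto
qed simp

lemma pair_measurable_info:
  assumes "k \<in> T"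
  shows "(\<lambda>\<omega>. (I k \<omega>, J k \<omega>)) \<in> info T U \<rightarrow>\<^sub>M count_space UNIV"
proof (rule measurableI)
  fix A :: "('v \<times> 'v) set"
  have "(\<lambda>\<omega>. (I k \<omega>, J k \<omega>)) -` A \<inter> space M \<in> gossip_events T"
    unfolding gossip_events_def using assms
    by (intro vimage_in_generated_sigma[where N = "\<lambda>_. count_space UNIV" and Y = "\<lambda>k \<omega>. (I k \<omega>, J k \<omega>)"]) auto
  then show "(\<lambda>\<omega>. (I k \<omega>, J k \<omega>)) -` A \<inter> space (info T U) \<in> sets (info T U)"
    using source_events_in_info(2) by auto
qed simp

lemma choice_measurable_info:
  assumes "k \<in> U" "k \<ge> 1"
  shows "\<Omega> i k \<in> info T U \<rightarrow>\<^sub>M N i"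
proof (rule measurableI)
  fix A assume A: "A \<in> sets (N i)"
  have "\<Omega> i k -` A \<inter> space M \<in> choice_events U"
    unfolding choice_events_def using assms A
      vimage_in_generated_sigma[of "(i, k)" "UNIV \<times> U" A "\<lambda>(l, t). N l" "\<lambda>(l, t). \<Omega> l t" M] by simp
  then show "\<Omega> i k -` A \<inter> space (info T U) \<in> sets (info T U)"
    using source_events_in_info(3) by auto
qed (use choice_in_space assms in auto)

abbreviation updates :: "'v \<Rightarrow> nat \<Rightarrow> 'w \<Rightarrow> nat" where
  "updates i k \<omega> \<equiv> num_updates (\<lambda>t. I t \<omega>) (\<lambda>t. J t \<omega>) i k"

lemma updates_measurable_info:
  assumes "{1..k} \<subseteq> T"
  shows "(\<lambda>\<omega>. real (updates i k \<omega>)) \<in> borel_measurable (info T U)"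
  using assms
proof (induction k)
  case (Suc k)
  have "(\<lambda>\<omega>. (\<lambda>(a, b). if i \<in> {a, b} then 1 else 0 :: real) (I (Suc k) \<omega>, J (Suc k) \<omega>)) \<in> borel_measurable (info T U)"
    using Suc.prems by (intro measurable_compose[OF pair_measurable_info]) auto
  moreover have "(\<lambda>\<omega>. real (updates i k \<omega>)) \<in> borel_measurable (info T U)"
    using Suc.prems by (intro Suc.IH) auto
  ultimately have "(\<lambda>\<omega>. real (updates i k \<omega>) + (\<lambda>(a, b). if i \<in> {a, b} then 1 else 0 :: real) (I (Suc k) \<omega>, J (Suc k) \<omega>))
     \<in> borel_measurable (info T U)" by measurable
  moreover have "(\<lambda>\<omega>. real (updates i (Suc k) \<omega>)) =
      (\<lambda>\<omega>. real (updates i k \<omega>) + (\<lambda>(a, b). if i \<in> {a, b} then 1 else 0 :: real) (I (Suc k) \<omega>, J (Suc k) \<omega>))"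
    by (auto simp: num_updates_Suc fun_eq_iff)
  ultimately show ?case by simp
qed simp

lemma gradient_measurable: "g i \<in> borel_measurable borel"
proof -
  have "continuous_on UNIV (g i)"
  proof (rule lipschitz_on_continuous_on)
    show "L-lipschitz_on UNIV (g i)"
      by (rule lipschitz_onI) (use lipschitz L_nonneg in \<open>auto simp: dist_norm\<close>)
  qed
  then show ?thesis by (rule borel_measurable_continuous_onI)
qed

lemma infdist_choice_measurable:
  assumes h: "h \<in> borel_measurable F" and choice: "\<Omega> i k \<in> F \<rightarrow>\<^sub>M N i"
  shows "(\<lambda>\<omega>. infdist (h \<omega>) (X i (\<Omega> i k \<omega>))) \<in> borel_measurable F"
proof -
  have "(\<lambda>\<omega>. (h \<omega>, \<Omega> i k \<omega>)) \<in> F \<rightarrow>\<^sub>M borel \<Otimes>\<^sub>M N i" using assms by measurable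
  from measurable_compose[OF this infdist_pair_measurable[OF dist_measurable]] show ?thesis by simp
qed

lemma algorithm_step:
  assumes "\<omega> \<in> space M"
  shows "gossip_step (I (Suc k) \<omega>) (J (Suc k) \<omega>) (\<lambda>i. X i (\<Omega> i (Suc k) \<omega>)) g
    (\<lambda>i. 1 / real (updates i (Suc k) \<omega>)) (\<lambda>i. x i k \<omega>) (\<lambda>i. x i (Suc k) \<omega>)"
  using grp_path_step[OF algorithm[OF assms], of "Suc k"] by simp

text \<open>Induction along the algorithm. The active pair has finitely many values, so
  measurability of the update for each fixed pair suffices; the projection is measurable jointly in
  point and index.\<close>

lemma iterate_measurable_info:
  assumes "{1..k} \<subseteq> T" "{1..k} \<subseteq> U"
  shows "x i k \<in> borel_measurable (info T U)"
  using assms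
proof (induction k arbitrary: i)
  case 0
  then show ?case using initial_measurable_info by simp
next
  case (Suc k)
  let ?F = "info T U"
  have IH[measurable]: "x i k \<in> borel_measurable ?F" for i using Suc.prems by (intro Suc.IH) auto
  have [measurable]: "(\<lambda>\<omega>. real (updates i (Suc k) \<omega>)) \<in> borel_measurable ?F" for i
    using Suc.prems by (intro updates_measurable_info)
  have [measurable]: "\<Omega> i (Suc k) \<in> ?F \<rightarrow>\<^sub>M N i" for i
    using Suc.prems by (intro choice_measurable_info) auto
  note gradient_measurable[measurable]
  define w where "w a b \<omega> = (1/2) *\<^sub>R (x a k \<omega> + x b k \<omega>)" for a b \<omega>
  have w[measurable]: "w a b \<in> borel_measurable ?F" for a b unfolding w_def by measurable
  define z where "z a b \<omega> = w a b \<omega> - (1 / real (updates i (Suc k) \<omega>)) *\<^sub>R g i (w a b \<omega>)" for a b \<omega>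
  have z: "z a b \<in> borel_measurable ?F" for a b unfolding z_def by measurable
  define H where "H p \<omega> = (case p of (a, b) \<Rightarrow>
      if i \<in> {a, b} then closest_point (X i (\<Omega> i (Suc k) \<omega>)) (z a b \<omega>) else x i k \<omega>)" for p \<omega>
  have "(\<lambda>\<omega>. closest_point (X i (\<Omega> i (Suc k) \<omega>)) (z a b \<omega>)) \<in> borel_measurable ?F" for a b
  proof -
    have "(\<lambda>\<omega>. (z a b \<omega>, \<Omega> i (Suc k) \<omega>)) \<in> ?F \<rightarrow>\<^sub>M borel \<Otimes>\<^sub>M N i" using z by measurable
    from measurable_compose[OF this closest_point_pair_measurable[OF component_set(1,2,4) dist_measurable]]
    show ?thesis by simp
  qed
  then have H: "H p \<in> borel_measurable ?F" for p
    unfolding H_def[abs_def] by (cases p) simp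
  have "(\<lambda>\<omega>. H (I (Suc k) \<omega>, J (Suc k) \<omega>) \<omega>) \<in> borel_measurable ?F"
    using Suc.prems by (intro measurable_compose_countable[OF H pair_measurable_info]) auto
  moreover have eq: "x i (Suc k) \<omega> = H (I (Suc k) \<omega>, J (Suc k) \<omega>) \<omega>" if "\<omega> \<in> space ?F" for \<omega>
    using algorithm_step[of \<omega> k] that unfolding gossip_step_def Let_def H_def z_def w_def by simp
  ultimately show ?case by (subst measurable_cong[OF eq])
qed

lemma iterate_measurable: "x i k \<in> borel_measurable M"
  by (rule measurable_from_subalg[OF subalgebra_info iterate_measurable_info[of _ "{1..}" "{1..}"]]) auto

subsection \<open>Set regularity at random points\<close>

text \<open>The event \<open>S\<close> may involve the initial vectors and all pairs besides the
  past choices; as they are independent of all choices, the conditional expectation given past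
  choices still integrates correctly over \<open>S\<close>. The constant is \<open>max c 1\<close>
  because the one-step estimate asks for at least 1.\<close>

lemma set_regularity_integral:
  assumes k: "k \<ge> 1" and S: "S \<in> sets (info {1..} {1..<k})"
  shows "(\<integral>\<omega>\<in>S. (infdist y Y)\<^sup>2 \<partial>M) \<le> max c 1 * (\<integral>\<omega>\<in>S. (infdist y (X i (\<Omega> i k \<omega>)))\<^sup>2 \<partial>M)"
proof -
  define W where "W \<omega> = (infdist y (X i (\<Omega> i k \<omega>)))\<^sup>2" for \<omega>
  let ?F = "generated_sigma M (\<lambda>(l, t). N l) (\<lambda>(l, t). \<Omega> l t) (UNIV \<times> {1..<k})"
  let ?F' = "generated_sigma M (\<lambda>(l, t). N l) (\<lambda>(l, t). \<Omega> l t) (UNIV \<times> {1..})"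
  let ?H = "{A \<inter> B | A B. A \<in> initial_events \<and> B \<in> gossip_events {1..}}"
  have past: "past_choices M N \<Omega> k = ?F" by (simp add: past_choices_def)
  have sub: "{1..<k} \<subseteq> {1..}" by auto
  have F: "sets ?F = choice_events {1..<k}" "sets ?F' = choice_events {1..}"
    by (simp_all add: choice_events_def)
  have SM: "S \<in> events" using S subalgebra_info[of "{1..}" "{1..<k}"] sub by (auto simp: subalgebra_def)
  have y0: "closest_point Y 0 \<in> Y" by (rule closest_point_in_Y)
  have W_meas: "W \<in> borel_measurable ?F'"
  proof -
    have "\<Omega> i k \<in> ?F' \<rightarrow>\<^sub>M N i"
    proof (rule measurableI)
      fix A assume "A \<in> sets (N i)"
      then show "\<Omega> i k -` A \<inter> space ?F' \<in> sets ?F'"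
        using vimage_in_generated_sigma[of "(i, k)" "UNIV \<times> {1..}" A "\<lambda>(l, t). N l" "\<lambda>(l, t). \<Omega> l t" M] k
        by simp
    qed (use choice_in_space k in auto)
    then show ?thesis unfolding W_def
      by (intro borel_measurable_power infdist_choice_measurable) auto
  qed
  have sub': "subalgebra M ?F" "subalgebra M ?F'"
    using source_events_subset(3)[OF sub] source_events_subset(3)[of "{1..}"] F by (auto simp: subalgebra_def)
  have W_int: "integrable M W"
  proof (rule integrable_const_bound[where B = "(dist y (closest_point Y 0))\<^sup>2"])
    show "AE \<omega> in M. norm (W \<omega>) \<le> (dist y (closest_point Y 0))\<^sup>2"
    proof (rule AE_I2)
      fix \<omega> assume "\<omega> \<in> space M"
      then have "closest_point Y 0 \<in> X i (\<Omega> i k \<omega>)"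
        using component_set(3)[OF choice_in_space[OF k]] y0 by blast
      then show "norm (W \<omega>) \<le> (dist y (closest_point Y 0))\<^sup>2"
        unfolding W_def by (simp add: power_mono infdist_le infdist_nonneg)
    qed
  qed (use measurable_from_subalg[OF sub'(2) W_meas] in auto)
  have eq: "(\<integral>\<omega>\<in>S. W \<omega> \<partial>M) = (\<integral>\<omega>\<in>S. real_cond_exp M ?F W \<omega> \<partial>M)"
  proof (rule set_integral_cond_exp_enlarged[OF sub', where H = ?H])
    show "sets ?F \<subseteq> sets ?F'" unfolding F by (rule source_events_mono(2)[OF sub])
    show "Int_stable ?H"
    proof (rule Int_stableI)
      fix D D' assume "D \<in> ?H" "D' \<in> ?H"
      then obtain A B A' B' where "D = A \<inter> B" "D' = A' \<inter> B'" "A \<in> initial_events" "B \<in> gossip_events {1..}"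
        "A' \<in> initial_events" "B' \<in> gossip_events {1..}" by blast
      then have "D \<inter> D' = (A \<inter> A') \<inter> (B \<inter> B')" "A \<inter> A' \<in> initial_events" "B \<inter> B' \<in> gossip_events {1..}"
        by (auto intro: source_events_Int)
      then show "D \<inter> D' \<in> ?H" by blast
    qed
    show "?H \<subseteq> events" using source_events_subset by blast
    show "prob (D \<inter> T) = prob D * prob T" if "D \<in> ?H" "T \<in> sets ?F'" for D T
      using that prob_choice_indep unfolding F by blast
    have "{A \<inter> B \<inter> C | A B C. A \<in> initial_events \<and> B \<in> gossip_events {1..} \<and> C \<in> choice_events {1..<k}}
      = {D \<inter> T | D T. D \<in> ?H \<and> T \<in> sets ?F}" unfolding F by blast
    then show "S \<in> sigma_sets (space M) {D \<inter> T | D T. D \<in> ?H \<and> T \<in> sets ?F}"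
      using S unfolding sets_info by simp
  qed (fact W_meas W_int)+
  interpret F: finite_measure_subalgebra M ?F by unfold_locales (rule sub')
  have R_int: "integrable M (real_cond_exp M ?F W)" by (rule F.real_cond_exp_int(1)[OF W_int])
  have "(\<integral>\<omega>\<in>S. (infdist y Y)\<^sup>2 \<partial>M) \<le> (\<integral>\<omega>\<in>S. c * real_cond_exp M ?F W \<omega> \<partial>M)"
    unfolding set_lebesgue_integral_def
  proof (rule integral_mono_AE)
    show "AE \<omega> in M. indicat_real S \<omega> *\<^sub>R (infdist y Y)\<^sup>2 \<le> indicat_real S \<omega> *\<^sub>R (c * real_cond_exp M ?F W \<omega>)"
      using regularity[OF k, of y i] unfolding past W_def[symmetric]
      by eventually_elim (auto simp: indicator_def)
    show "integrable M (\<lambda>\<omega>. indicat_real S \<omega> *\<^sub>R (infdist y Y)\<^sup>2)"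
      using SM by (auto simp: less_top[symmetric])
    show "integrable M (\<lambda>\<omega>. indicat_real S \<omega> *\<^sub>R (c * real_cond_exp M ?F W \<omega>))"
      by (rule integrable_mult_indicator[OF SM]) (use R_int in auto)
  qed
  also have "\<dots> = c * (\<integral>\<omega>\<in>S. W \<omega> \<partial>M)" unfolding eq by (simp add: set_lebesgue_integral_def mult.left_commute)
  also have "\<dots> \<le> max c 1 * (\<integral>\<omega>\<in>S. W \<omega> \<partial>M)"
    unfolding set_lebesgue_integral_def
    by (intro mult_right_mono integral_nonneg_AE) (auto simp: W_def indicator_def)
  finally show ?thesis unfolding W_def .
qed

text \<open>In the application \<open>v\<close> is the midpoint of two iterates, computed before the
  choice at time \<open>k\<close>. The differences frozen at a point are continuous in it and
  bounded on bounded sets, since a feasible point lies in every component set.\<close>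

lemma set_regularity_random_point:
  assumes k: "k \<ge> 1" and S: "S \<in> sets (info {1..} {1..<k})"
    and v: "v \<in> borel_measurable (info {1..} {1..<k})" "\<And>\<omega>. \<omega> \<in> S \<Longrightarrow> norm (v \<omega>) \<le> R" and R: "R \<ge> 0"
  shows "0 \<le> (\<integral>\<omega>\<in>S. max c 1 * (infdist (v \<omega>) (X i (\<Omega> i k \<omega>)))\<^sup>2 - (infdist (v \<omega>) Y)\<^sup>2 \<partial>M)"
proof -
  define y0 where "y0 = closest_point Y 0"
  have y0: "y0 \<in> Y" unfolding y0_def by (rule closest_point_in_Y)
  have sub: "subalgebra M (info {1..} {1..<k})" by (rule subalgebra_info) auto
  have meas: "(\<lambda>\<omega>. (infdist y (X i (\<Omega> i k \<omega>)))\<^sup>2) \<in> borel_measurable M" for y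
    using choices[OF k] by (intro borel_measurable_power infdist_choice_measurable) auto
  have bound: "(infdist y (X i (\<Omega> i k \<omega>)))\<^sup>2 \<le> (2 * R + norm y0)\<^sup>2" "(infdist y Y)\<^sup>2 \<le> (2 * R + norm y0)\<^sup>2"
    if "\<omega> \<in> space M" "norm y \<le> 2 * R" for y \<omega>
  proof -
    have "dist y y0 \<le> 2 * R + norm y0"
      using norm_triangle_ineq4[of y y0] that(2) by (simp add: dist_norm)
    moreover have "y0 \<in> X i (\<Omega> i k \<omega>)" using component_set(3)[OF choice_in_space[OF k that(1)]] y0 by blast
    ultimately show "(infdist y (X i (\<Omega> i k \<omega>)))\<^sup>2 \<le> (2 * R + norm y0)\<^sup>2" "(infdist y Y)\<^sup>2 \<le> (2 * R + norm y0)\<^sup>2"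
      using y0 by (auto intro!: power_mono infdist_nonneg infdist_le2)
  qed
  show ?thesis
  proof (rule set_integral_freeze_nonneg[OF sub S v R,
        where \<phi> = "\<lambda>y \<omega>. max c 1 * (infdist y (X i (\<Omega> i k \<omega>)))\<^sup>2 - (infdist y Y)\<^sup>2"
          and B = "max c 1 * (2 * R + norm y0)\<^sup>2 + (2 * R + norm y0)\<^sup>2"])
    fix S y assume S: "S \<in> sets (info {1..} {1..<k})"
    then have SM: "S \<in> events" using sub by (auto simp: subalgebra_def)
    have "integrable M (\<lambda>\<omega>. (infdist y (X i (\<Omega> i k \<omega>)))\<^sup>2)"
    proof (rule integrable_const_bound[where B = "(dist y y0)\<^sup>2"])
      show "AE \<omega> in M. norm ((infdist y (X i (\<Omega> i k \<omega>)))\<^sup>2) \<le> (dist y y0)\<^sup>2"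
      proof (rule AE_I2)
        fix \<omega> assume "\<omega> \<in> space M"
        then have "y0 \<in> X i (\<Omega> i k \<omega>)" using component_set(3)[OF choice_in_space[OF k]] y0 by blast
        then show "norm ((infdist y (X i (\<Omega> i k \<omega>)))\<^sup>2) \<le> (dist y y0)\<^sup>2"
          by (simp add: power_mono infdist_le infdist_nonneg)
      qed
    qed (rule meas)
    then have "set_integrable M S (\<lambda>\<omega>. max c 1 * (infdist y (X i (\<Omega> i k \<omega>)))\<^sup>2)" "set_integrable M S (\<lambda>\<omega>. (infdist y Y)\<^sup>2)"
      unfolding set_integrable_def by - (rule integrable_mult_indicator[OF SM], simp)+
    then have "(\<integral>\<omega>\<in>S. max c 1 * (infdist y (X i (\<Omega> i k \<omega>)))\<^sup>2 - (infdist y Y)\<^sup>2 \<partial>M)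
       = max c 1 * (\<integral>\<omega>\<in>S. (infdist y (X i (\<Omega> i k \<omega>)))\<^sup>2 \<partial>M) - (\<integral>\<omega>\<in>S. (infdist y Y)\<^sup>2 \<partial>M)"
      by (simp add: set_integral_diff(2))
    then show "0 \<le> (\<integral>\<omega>\<in>S. max c 1 * (infdist y (X i (\<Omega> i k \<omega>)))\<^sup>2 - (infdist y Y)\<^sup>2 \<partial>M)"
      using set_regularity_integral[OF k S, of y i] by simp
  next
    fix y :: 'a show "(\<lambda>\<omega>. max c 1 * (infdist y (X i (\<Omega> i k \<omega>)))\<^sup>2 - (infdist y Y)\<^sup>2) \<in> borel_measurable M"
      using meas[of y] by measurable
  next
    fix \<omega> show "continuous_on UNIV (\<lambda>y. max c 1 * (infdist y (X i (\<Omega> i k \<omega>)))\<^sup>2 - (infdist y Y)\<^sup>2)"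
      by (intro continuous_intros)
  next
    fix y :: 'a and \<omega> assume *: "\<omega> \<in> space M" "norm y \<le> 2 * R"
    have "max c 1 * (infdist y (X i (\<Omega> i k \<omega>)))\<^sup>2 \<le> max c 1 * (2 * R + norm y0)\<^sup>2"
      by (intro mult_left_mono bound *) auto
    moreover have "0 \<le> max c 1 * (infdist y (X i (\<Omega> i k \<omega>)))\<^sup>2" "0 \<le> max c 1 * (2 * R + norm y0)\<^sup>2" by auto
    ultimately show "\<bar>max c 1 * (infdist y (X i (\<Omega> i k \<omega>)))\<^sup>2 - (infdist y Y)\<^sup>2\<bar>
        \<le> max c 1 * (2 * R + norm y0)\<^sup>2 + (2 * R + norm y0)\<^sup>2"
      using bound(2)[OF *] zero_le_power2[of "infdist y Y"] zero_le_power2[of "2 * R + norm y0"]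
      unfolding abs_le_iff by (intro conjI) linarith+
  qed
qed

end

context grp_process
begin

section \<open>Decay of the expected potential\<close>

text \<open>Any fixed point of \<open>Y\<close> would do: it lies in all component sets, so
  projecting on them never increases the distance to it.\<close>

definition anchor :: 'a where "anchor = closest_point Y 0"

lemma anchor_in_Y: "anchor \<in> Y"
  unfolding anchor_def by (rule closest_point_in_Y)

lemma norm_midpoint_anchor_le:
  fixes u v :: 'a
  assumes "norm (u - anchor) \<le> B" "norm (v - anchor) \<le> B"
  shows "norm ((1/2) *\<^sub>R (u + v) - anchor) \<le> B"
proof -
  have "anchor = (1/2) *\<^sub>R (anchor + anchor)" by (rule scaleR_half_double[symmetric])
  then have "(1/2) *\<^sub>R (u + v) - anchor = (1/2) *\<^sub>R ((u + v) - (anchor + anchor))"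
    by (metis scaleR_diff_right)
  also have "\<dots> = (1/2) *\<^sub>R ((u - anchor) + (v - anchor))" by (simp add: algebra_simps)
  finally show ?thesis using norm_triangle_ineq[of "u - anchor" "v - anchor"] assms by simp
qed

text \<open>A crude bound, exponential in \<open>k\<close>, whose purpose is integrability on events
  where the initial vectors are bounded.\<close>

lemma iterate_bounded:
  assumes \<omega>: "\<omega> \<in> space M" and R: "\<And>i. norm (x i 0 \<omega> - anchor) \<le> R"
  shows "norm (x i k \<omega> - anchor) \<le> (1 + L) ^ k * (R + real k * G)"
proof (induction k arbitrary: i)
  case 0
  then show ?case using R by simp
next
  case (Suc k)
  let ?B = "(1 + L) ^ k * (R + real k * G)"
  let ?a = "I (Suc k) \<omega>" and ?b = "J (Suc k) \<omega>"
  let ?w = "(1/2) *\<^sub>R (x ?a k \<omega> + x ?b k \<omega>)"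
  let ?\<alpha> = "1 / real (updates i (Suc k) \<omega>)" and ?C = "X i (\<Omega> i (Suc k) \<omega>)"
  have B0: "0 \<le> ?B" using Suc.IH[of i] norm_ge_zero order_trans by blast
  have w: "norm (?w - anchor) \<le> ?B" by (rule norm_midpoint_anchor_le[OF Suc.IH Suc.IH])
  have step: "x i (Suc k) \<omega> = (if i \<in> {?a, ?b} then closest_point ?C (?w - ?\<alpha> *\<^sub>R g i ?w) else x i k \<omega>)"
    using algorithm_step[OF \<omega>, of k] unfolding gossip_step_def Let_def by blast
  have "norm (x i (Suc k) \<omega> - anchor) \<le> (1 + L) * ?B + G"
  proof (cases "i \<in> {?a, ?b}")
    case True
    have C: "closed ?C" "convex ?C" "Y \<subseteq> ?C" using component_set[OF choice_in_space[of "Suc k", OF _ \<omega>]] by auto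
    have "norm (x i (Suc k) \<omega> - anchor) \<le> norm ((?w - ?\<alpha> *\<^sub>R g i ?w) - anchor)"
      using step True C anchor_in_Y by (auto intro!: norm_closest_point_diff_le)
    also have "\<dots> \<le> norm (?w - anchor) + norm (?\<alpha> *\<^sub>R g i ?w)"
      using norm_triangle_ineq4[of "?w - anchor" "?\<alpha> *\<^sub>R g i ?w"] by (simp add: algebra_simps)
    \<comment> \<open>Stepsizes never exceed 1: a count is at least 1 or equals 0, and
      \<open>1 / 0 = 0\<close>.\<close>
    also have "norm (?\<alpha> *\<^sub>R g i ?w) \<le> 1 * norm (g i ?w)"
      unfolding norm_scaleR by (intro mult_right_mono) (auto simp: divide_le_eq)
    also have "1 * norm (g i ?w) \<le> G + L * infdist ?w Y" using norm_gradient_le by simp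
    also have "infdist ?w Y \<le> norm (?w - anchor)" using infdist_le[OF anchor_in_Y, of ?w] by (simp add: dist_norm)
    finally have "norm (x i (Suc k) \<omega> - anchor) \<le> norm (?w - anchor) + (G + L * norm (?w - anchor))"
      using L_nonneg by (simp add: mult_left_mono)
    also have "\<dots> \<le> ?B + (G + L * ?B)" using w L_nonneg by (intro add_mono mult_left_mono) auto
    finally show ?thesis by (simp add: algebra_simps)
  next
    case False
    then have "norm (x i (Suc k) \<omega> - anchor) \<le> ?B" using step Suc.IH by simp
    moreover have "0 \<le> L * ?B" using B0 L_nonneg by simp
    ultimately show ?thesis using G_nonneg by (simp add: distrib_right)
  qed
  also have "\<dots> \<le> (1 + L) * ?B + (1 + L) ^ Suc k * G"
    using mult_right_mono[OF one_le_power[of "1 + L" "Suc k"] G_nonneg] L_nonneg by simp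
  also have "\<dots> = (1 + L) ^ Suc k * (R + real (Suc k) * G)" by (simp add: algebra_simps)
  finally show ?case .
qed

definition pot :: "real \<Rightarrow> nat \<Rightarrow> 'w \<Rightarrow> real" where
  "pot \<kappa> k \<omega> = infeasibility Y (\<lambda>i. x i k \<omega>) + \<kappa> * disagreement (\<lambda>i. x i k \<omega>)"

lemma pot_nonneg: "\<kappa> \<ge> 0 \<Longrightarrow> pot \<kappa> k \<omega> \<ge> 0"
  by (simp add: pot_def infeasibility_nonneg disagreement_nonneg)

lemma potential_measurable:
  assumes [measurable]: "\<And>i. x i k \<in> borel_measurable F"
  shows "(\<lambda>\<omega>. infeasibility Y (\<lambda>i. x i k \<omega>)) \<in> borel_measurable F"
    "(\<lambda>\<omega>. disagreement (\<lambda>i. x i k \<omega>)) \<in> borel_measurable F"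
    "(\<lambda>\<omega>. (infdist (x a k \<omega>) Y)\<^sup>2) \<in> borel_measurable F"
    "(\<lambda>\<omega>. (norm (x a k \<omega> - x b k \<omega>))\<^sup>2) \<in> borel_measurable F"
proof -
  have [measurable]: "(\<lambda>y. infdist y Y) \<in> borel_measurable borel"
    by (intro borel_measurable_continuous_onI continuous_intros)
  show "(\<lambda>\<omega>. infeasibility Y (\<lambda>i. x i k \<omega>)) \<in> borel_measurable F"
    "(\<lambda>\<omega>. (infdist (x a k \<omega>) Y)\<^sup>2) \<in> borel_measurable F"
    "(\<lambda>\<omega>. disagreement (\<lambda>i. x i k \<omega>)) \<in> borel_measurable F"
    "(\<lambda>\<omega>. (norm (x a k \<omega> - x b k \<omega>))\<^sup>2) \<in> borel_measurable F"
    unfolding infeasibility_def disagreement_def mean_def by measurable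
qed

lemma potential_set_integrable:
  assumes S: "S \<in> events" and bound: "\<And>\<omega> i. \<omega> \<in> S \<Longrightarrow> norm (x i k \<omega> - anchor) \<le> B"
  shows "set_integrable M S (\<lambda>\<omega>. infeasibility Y (\<lambda>i. x i k \<omega>))"
    "set_integrable M S (\<lambda>\<omega>. disagreement (\<lambda>i. x i k \<omega>))"
    "set_integrable M S (\<lambda>\<omega>. (infdist (x a k \<omega>) Y)\<^sup>2)"
    "set_integrable M S (\<lambda>\<omega>. (norm (x a k \<omega> - x b k \<omega>))\<^sup>2)"
proof -
  note meas = potential_measurable[where F = M, OF iterate_measurable]
  have inf: "(infdist (x i k \<omega>) Y)\<^sup>2 \<le> B\<^sup>2" if "\<omega> \<in> S" for i \<omega>
    using infdist_le[OF anchor_in_Y, of "x i k \<omega>"] bound[OF that, of i]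
    by (intro power_mono infdist_nonneg) (simp add: dist_norm)
  show "set_integrable M S (\<lambda>\<omega>. (infdist (x a k \<omega>) Y)\<^sup>2)"
    by (rule set_integrable_bounded[OF S meas(3), where B = "B\<^sup>2"]) (use inf in auto)
  show "set_integrable M S (\<lambda>\<omega>. infeasibility Y (\<lambda>i. x i k \<omega>))"
  proof (rule set_integrable_bounded[OF S meas(1)])
    fix \<omega> assume \<omega>: "\<omega> \<in> S"
    have "infeasibility Y (\<lambda>i. x i k \<omega>) \<le> (\<Sum>i\<in>(UNIV::'v set). B\<^sup>2)"
      unfolding infeasibility_def by (intro sum_mono inf[OF \<omega>])
    then show "\<bar>infeasibility Y (\<lambda>i. x i k \<omega>)\<bar> \<le> (\<Sum>i\<in>(UNIV::'v set). B\<^sup>2)"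
      by (simp add: abs_of_nonneg[OF infeasibility_nonneg])
  qed
  show "set_integrable M S (\<lambda>\<omega>. disagreement (\<lambda>i. x i k \<omega>))"
  proof (rule set_integrable_bounded[OF S meas(2)])
    fix \<omega> assume \<omega>: "\<omega> \<in> S"
    have "disagreement (\<lambda>i. x i k \<omega>) \<le> (\<Sum>i\<in>UNIV. (norm (x i k \<omega> - anchor))\<^sup>2)" by (rule disagreement_le_sum)
    also have "\<dots> \<le> (\<Sum>i\<in>(UNIV::'v set). B\<^sup>2)" by (intro sum_mono power_mono bound[OF \<omega>]) auto
    finally show "\<bar>disagreement (\<lambda>i. x i k \<omega>)\<bar> \<le> (\<Sum>i\<in>(UNIV::'v set). B\<^sup>2)"
      by (simp add: abs_of_nonneg[OF disagreement_nonneg])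
  qed
  show "set_integrable M S (\<lambda>\<omega>. (norm (x a k \<omega> - x b k \<omega>))\<^sup>2)"
  proof (rule set_integrable_bounded[OF S meas(4)])
    fix \<omega> assume \<omega>: "\<omega> \<in> S"
    have "norm (x a k \<omega> - x b k \<omega>) \<le> B + B"
      using norm_triangle_ineq4[of "x a k \<omega> - anchor" "x b k \<omega> - anchor"] bound[OF \<omega>, of a] bound[OF \<omega>, of b] by simp
    then have "(norm (x a k \<omega> - x b k \<omega>))\<^sup>2 \<le> (B + B)\<^sup>2" by (rule power_mono) simp
    then show "\<bar>(norm (x a k \<omega> - x b k \<omega>))\<^sup>2\<bar> \<le> (B + B)\<^sup>2" by simp
  qed
qed

lemma indicator_split_pairs:
  assumes "\<omega> \<in> space M"
  shows "indicat_real S \<omega> * u = (\<Sum>a\<in>UNIV. \<Sum>b\<in>UNIV. indicat_real (S \<inter> pair_event k a b) \<omega> * u)"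
proof -
  have "(\<Sum>b\<in>UNIV. indicat_real (S \<inter> pair_event k a b) \<omega> * u) = (if a = I k \<omega> then indicat_real S \<omega> * u else 0)" for a
  proof -
    have "(\<Sum>b\<in>UNIV. indicat_real (S \<inter> pair_event k a b) \<omega> * u) =
        (\<Sum>b\<in>UNIV. if b = J k \<omega> then (if a = I k \<omega> then indicat_real S \<omega> * u else 0) else 0)"
      using assms by (intro sum.cong) (auto simp: indicator_def pair_event_def)
    then show ?thesis by simp
  qed
  then show ?thesis by simp
qed

lemma set_integral_split_pairs:
  assumes k: "k \<ge> 1" and u: "set_integrable M S u"
  shows "(\<integral>\<omega>\<in>S. u \<omega> \<partial>M) = (\<Sum>a\<in>UNIV. \<Sum>b\<in>UNIV. \<integral>\<omega>\<in>S \<inter> pair_event k a b. (u \<omega> :: real) \<partial>M)"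
proof -
  have int: "integrable M (\<lambda>\<omega>. indicat_real (S \<inter> pair_event k a b) \<omega> * u \<omega>)" for a b
    using integrable_mult_indicator[OF pair_event_in_events[OF k, of a b] u[unfolded set_integrable_def]]
    by (simp add: indicator_inter_arith mult_ac)
  have "(\<integral>\<omega>\<in>S. u \<omega> \<partial>M) = (\<integral>\<omega>. (\<Sum>a\<in>UNIV. \<Sum>b\<in>UNIV. indicat_real (S \<inter> pair_event k a b) \<omega> * u \<omega>) \<partial>M)"
    unfolding set_lebesgue_integral_def real_scaleR_def
    by (intro Bochner_Integration.integral_cong refl indicator_split_pairs)
  also have "\<dots> = (\<Sum>a\<in>UNIV. \<integral>\<omega>. (\<Sum>b\<in>UNIV. indicat_real (S \<inter> pair_event k a b) \<omega> * u \<omega>) \<partial>M)"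
    by (rule Bochner_Integration.integral_sum) (intro Bochner_Integration.integrable_sum int)
  also have "\<dots> = (\<Sum>a\<in>UNIV. \<Sum>b\<in>UNIV. \<integral>\<omega>. indicat_real (S \<inter> pair_event k a b) \<omega> * u \<omega> \<partial>M)"
    by (intro sum.cong refl Bochner_Integration.integral_sum int)
  finally show ?thesis by (simp add: set_lebesgue_integral_def)
qed

lemma set_integral_pair_event:
  assumes S: "S \<in> sets (info {1..k} {1..k})"
    and u: "u \<in> borel_measurable (info {1..k} {1..k})" "set_integrable M S u"
  shows "(\<integral>\<omega>\<in>S \<inter> pair_event (Suc k) a b. u \<omega> \<partial>M) = pair_prob a b * (\<integral>\<omega>\<in>S. (u \<omega> :: real) \<partial>M)"
proof -
  let ?F = "info {1..k} {1..k}"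
  have sub: "subalgebra M ?F" by (rule subalgebra_info) auto
  have "(\<integral>\<omega>\<in>S \<inter> pair_event (Suc k) a b. u \<omega> \<partial>M) = (\<integral>\<omega>. indicat_real (pair_event (Suc k) a b) \<omega> * (indicat_real S \<omega> * u \<omega>) \<partial>M)"
    unfolding set_lebesgue_integral_def by (simp add: indicator_inter_arith mult_ac)
  also have "\<dots> = prob (pair_event (Suc k) a b) * (\<integral>\<omega>. indicat_real S \<omega> * u \<omega> \<partial>M)"
  proof (rule integral_indep_event[OF sub])
    show "pair_event (Suc k) a b \<in> events" by (rule pair_event_in_events) simp
    show "prob (pair_event (Suc k) a b \<inter> T) = prob (pair_event (Suc k) a b) * prob T" if "T \<in> sets ?F" for T
    proof (rule prob_pair_event_indep)
      show "T \<in> sets (info {1..<Suc k} {1..})"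
        by (rule subsetD[OF sets_info_mono that]) auto
    qed simp
    show "(\<lambda>\<omega>. indicat_real S \<omega> * u \<omega>) \<in> borel_measurable ?F" using S u by measurable
    show "integrable M (\<lambda>\<omega>. indicat_real S \<omega> * u \<omega>)" using u(2) by (simp add: set_integrable_def)
  qed
  finally show ?thesis by (simp add: prob_pair_event set_lebesgue_integral_def)
qed

text \<open>Conditional expectations are replaced by integrals over events \<open>S\<close> known at
  time \<open>k\<close> on which iterates and stepsizes are bounded. Each pair is treated on its own
  event, where the midpoint is a fixed function of the iterates.\<close>

lemma expected_potential_step:
  fixes S :: "'w set" and k :: nat and B \<tau> \<delta> :: real
  defines "cc \<equiv> max c 1"
  defines "\<kappa> \<equiv> 1 / (16 * cc * (1 + 2 / \<delta>) * (2 + L)\<^sup>2)"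
  defines "D \<equiv> 2 * (12 * cc + 4) * G\<^sup>2 + 4 * \<kappa> * (1 + 2 / \<delta>) * G\<^sup>2"
  assumes \<delta>: "0 < \<delta>" "\<delta> \<le> 1"
      "\<And>z::'v \<Rightarrow> 'a. \<delta> * disagreement z \<le> (\<Sum>a\<in>UNIV. \<Sum>b\<in>UNIV. pair_prob a b * (norm (z a - z b))\<^sup>2) / 2"
    and S: "S \<in> sets (info {1..k} {1..k})"
    and bound: "\<And>\<omega> i. \<omega> \<in> S \<Longrightarrow> norm (x i k \<omega> - anchor) \<le> B"
      "\<And>\<omega> i. \<omega> \<in> S \<Longrightarrow> norm (x i (Suc k) \<omega> - anchor) \<le> B'"
    and \<tau>: "\<And>\<omega> i. \<omega> \<in> S \<Longrightarrow> i \<in> {I (Suc k) \<omega>, J (Suc k) \<omega>} \<Longrightarrow> 1 / real (updates i (Suc k) \<omega>) \<le> \<tau>"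
      "\<tau> \<le> 1 / (24 * cc * (L + 1))"
  shows "(\<integral>\<omega>\<in>S. pot \<kappa> (Suc k) \<omega> \<partial>M)
    \<le> (1 - min (1 / real CARD('v) / (8 * cc)) (\<delta> / 2)) * (\<integral>\<omega>\<in>S. pot \<kappa> k \<omega> \<partial>M) + D * \<tau>\<^sup>2"
proof -
  let ?F = "info {1..k} {1..k}"
  have cc: "cc \<ge> 1" by (simp add: cc_def)
  have \<kappa>: "\<kappa> > 0" using cc \<delta> L_nonneg by (simp add: \<kappa>_def add_pos_pos)
  have sub: "subalgebra M ?F" by (rule subalgebra_info) auto
  have SM: "S \<in> events" using S sub by (auto simp: subalgebra_def)
  have S_space: "S \<subseteq> space M" by (rule sets.sets_into_space[OF SM])
  \<comment> \<open>\<open>\<psi>\<close> is the part of the one-step bound that is known at time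
    \<open>k\<close>; the rest is a negative multiple of the terms \<open>er\<close>, whose
    integrals regularity makes nonnegative.\<close>
  define \<psi> where "\<psi> a b \<omega> = infeasibility Y (\<lambda>i. x i k \<omega>) - ((infdist (x a k \<omega>) Y)\<^sup>2 + (infdist (x b k \<omega>) Y)\<^sup>2) / (8 * cc)
      + \<kappa> * (1 + \<delta> / 2) * (disagreement (\<lambda>i. x i k \<omega>) - (norm (x a k \<omega> - x b k \<omega>))\<^sup>2 / 2) + D * \<tau>\<^sup>2" for a b \<omega>
  define w where "w a b \<omega> = (1/2) *\<^sub>R (x a k \<omega> + x b k \<omega>)" for a b \<omega>
  define er where "er a b i \<omega> = cc * (infdist (w a b \<omega>) (X i (\<Omega> i (Suc k) \<omega>)))\<^sup>2 - (infdist (w a b \<omega>) Y)\<^sup>2" for a b i \<omega>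
  note pieces = potential_set_integrable[OF SM bound(1)]
  have xF: "x i k \<in> borel_measurable ?F" for i by (rule iterate_measurable_info) auto
  have \<psi>_meas: "\<psi> a b \<in> borel_measurable ?F" for a b
  proof -
    note [measurable] = potential_measurable[OF xF]
    show ?thesis unfolding \<psi>_def by measurable
  qed
  have const: "set_integrable M S (\<lambda>_. r)" for r :: real
    by (rule set_integrable_bounded[OF SM, where B = "\<bar>r\<bar>"]) auto
  have \<psi>_int: "set_integrable M S (\<psi> a b)" for a b
    unfolding \<psi>_def
    by (intro set_integral_add set_integral_diff set_integrable_mult_right set_integrable_divide pieces const)
  have pot_int: "set_integrable M S (pot \<kappa> k)" "set_integrable M S (pot \<kappa> (Suc k))"
    unfolding pot_def using pieces potential_set_integrable[OF SM bound(2)]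
    by (auto intro!: set_integral_add set_integrable_mult_right)
  have er_int: "set_integrable M S (er a b i)" for a b i
  proof -
    have wM: "w a b \<in> borel_measurable M" unfolding w_def using iterate_measurable by measurable
    have wB: "norm (w a b \<omega> - anchor) \<le> B" if "\<omega> \<in> S" for \<omega>
      unfolding w_def by (intro norm_midpoint_anchor_le bound(1) that)
    have i1: "set_integrable M S (\<lambda>\<omega>. (infdist (w a b \<omega>) (X i (\<Omega> i (Suc k) \<omega>)))\<^sup>2)"
    proof (rule set_integrable_bounded[OF SM])
      show "(\<lambda>\<omega>. (infdist (w a b \<omega>) (X i (\<Omega> i (Suc k) \<omega>)))\<^sup>2) \<in> borel_measurable M"
        using choices[of "Suc k" i] by (intro borel_measurable_power infdist_choice_measurable wM) auto
      fix \<omega> assume \<omega>: "\<omega> \<in> S"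
      then have "anchor \<in> X i (\<Omega> i (Suc k) \<omega>)"
        using component_set(3)[OF choice_in_space[of "Suc k" \<omega>]] anchor_in_Y S_space by auto
      then have "infdist (w a b \<omega>) (X i (\<Omega> i (Suc k) \<omega>)) \<le> B"
        using wB[OF \<omega>] by (auto intro!: infdist_le2 simp: dist_norm)
      then show "\<bar>(infdist (w a b \<omega>) (X i (\<Omega> i (Suc k) \<omega>)))\<^sup>2\<bar> \<le> B\<^sup>2"
        by (simp add: power_mono infdist_nonneg)
    qed
    have i2: "set_integrable M S (\<lambda>\<omega>. (infdist (w a b \<omega>) Y)\<^sup>2)"
    proof (rule set_integrable_bounded[OF SM])
      have "(\<lambda>y. infdist y Y) \<in> borel_measurable borel"
        by (intro borel_measurable_continuous_onI continuous_intros)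
      from measurable_compose[OF wM this]
      show "(\<lambda>\<omega>. (infdist (w a b \<omega>) Y)\<^sup>2) \<in> borel_measurable M" by measurable
      fix \<omega> assume "\<omega> \<in> S"
      then have "infdist (w a b \<omega>) Y \<le> B"
        using wB anchor_in_Y by (auto intro!: infdist_le2 simp: dist_norm)
      then show "\<bar>(infdist (w a b \<omega>) Y)\<^sup>2\<bar> \<le> B\<^sup>2" by (simp add: power_mono infdist_nonneg)
    qed
    show ?thesis unfolding er_def by (intro set_integral_diff set_integrable_mult_right i1 i2)
  qed
  have sub_int: "set_integrable M (S \<inter> pair_event (Suc k) a b) u" if "set_integrable M S u" for u :: "'w \<Rightarrow> real" and a b
    using that by (rule set_integrable_subset) (use SM pair_event_in_events in auto)
  have piece: "(\<integral>\<omega>\<in>S \<inter> pair_event (Suc k) a b. pot \<kappa> (Suc k) \<omega> \<partial>M) \<le> pair_prob a b * (\<integral>\<omega>\<in>S. \<psi> a b \<omega> \<partial>M)" for a b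
  proof (cases "a = b")
    case True
    have "(\<integral>\<omega>\<in>S \<inter> pair_event (Suc k) a b. pot \<kappa> (Suc k) \<omega> \<partial>M) = (\<integral>\<omega>. 0 \<partial>M)"
      unfolding set_lebesgue_integral_def
    proof (rule integral_cong_AE)
      show "AE \<omega> in M. indicat_real (S \<inter> pair_event (Suc k) a b) \<omega> *\<^sub>R pot \<kappa> (Suc k) \<omega> = 0"
        using pair_event_diag_null[of "Suc k" a] True by (auto simp: indicator_def)
      show "(\<lambda>\<omega>. indicat_real (S \<inter> pair_event (Suc k) a b) \<omega> *\<^sub>R pot \<kappa> (Suc k) \<omega>) \<in> borel_measurable M"
        using sub_int[OF pot_int(2)] unfolding set_integrable_def by (rule borel_measurable_integrable)
    qed simp
    then show ?thesis using True pair_prob_diag by simp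
  next
    case False
    let ?S = "S \<inter> pair_event (Suc k) a b"
    have "(\<integral>\<omega>\<in>?S. pot \<kappa> (Suc k) \<omega> \<partial>M) \<le> (\<integral>\<omega>\<in>?S. \<psi> a b \<omega> - (er a b a \<omega> + er a b b \<omega>) * (1 / (2 * cc)) \<partial>M)"
    proof (rule set_integral_mono_sets)
      show "set_integrable M ?S (\<lambda>\<omega>. \<psi> a b \<omega> - (er a b a \<omega> + er a b b \<omega>) * (1 / (2 * cc)))"
        by (intro set_integral_diff set_integral_add set_integrable_mult_left sub_int \<psi>_int er_int)
      show "set_integrable M ?S (pot \<kappa> (Suc k))" by (rule sub_int[OF pot_int(2)])
      fix \<omega> assume \<omega>: "\<omega> \<in> ?S" "\<omega> \<in> space M"
      have IJ: "I (Suc k) \<omega> = a" "J (Suc k) \<omega> = b" using \<omega> by (auto simp: pair_event_def)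
      note C = component_set[OF choice_in_space[of "Suc k", OF _ \<omega>(2)]]
      have "pot \<kappa> (Suc k) \<omega> \<le> \<psi> a b \<omega> + (\<Sum>i\<in>{a, b}. (infdist (w a b \<omega>) Y)\<^sup>2 / (2 * cc) - (infdist (w a b \<omega>) (X i (\<Omega> i (Suc k) \<omega>)))\<^sup>2 / 2)"
        unfolding pot_def \<psi>_def w_def D_def \<kappa>_def
      proof (rule step_potential_le[OF algorithm_step[OF \<omega>(2), of k, unfolded IJ] False _ _ _ _ _ cc \<delta>(1,2) \<tau>(2)])
        show "1 / real (updates i (Suc k) \<omega>) \<le> \<tau>" if "i \<in> {a, b}" for i using \<tau>(1)[of \<omega> i] \<omega> that IJ by auto
      qed (use C in auto)
      also have "(\<Sum>i\<in>{a, b}. (infdist (w a b \<omega>) Y)\<^sup>2 / (2 * cc) - (infdist (w a b \<omega>) (X i (\<Omega> i (Suc k) \<omega>)))\<^sup>2 / 2)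
          = - ((er a b a \<omega> + er a b b \<omega>) * (1 / (2 * cc)))"
        using False cc by (simp add: er_def field_simps)
      finally show "pot \<kappa> (Suc k) \<omega> \<le> \<psi> a b \<omega> - (er a b a \<omega> + er a b b \<omega>) * (1 / (2 * cc))" by simp
    qed
    also have "\<dots> = (\<integral>\<omega>\<in>?S. \<psi> a b \<omega> \<partial>M) - ((\<integral>\<omega>\<in>?S. er a b a \<omega> \<partial>M) + (\<integral>\<omega>\<in>?S. er a b b \<omega> \<partial>M)) * (1 / (2 * cc))"
      using sub_int[OF \<psi>_int] sub_int[OF er_int] by (simp add: set_integral_diff(2) set_integral_add(2))
    also have "\<dots> \<le> (\<integral>\<omega>\<in>?S. \<psi> a b \<omega> \<partial>M)"
    proof -
      \<comment> \<open>The event fixes the pair at time \<open>Suc k\<close>, so regularity must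
        hold given the current pair; hence the information with all pairs but only the choices up to
        time \<open>k\<close>.\<close>
      have "0 \<le> (\<integral>\<omega>\<in>?S. er a b i \<omega> \<partial>M)" for i
        unfolding er_def cc_def
      proof (rule set_regularity_random_point[of "Suc k", where R = "\<bar>B\<bar> + norm anchor"])
        have "S \<in> sets (info {1..} {1..<Suc k})"
          by (rule subsetD[OF sets_info_mono S]) auto
        moreover have "pair_event (Suc k) a b \<in> sets (info {1..} {1..<Suc k})"
          using pair_event_in_gossip_events[of "Suc k" "{1..}" a b] source_events_in_info(2) by auto
        ultimately show "?S \<in> sets (info {1..} {1..<Suc k})" by auto
        have "x i k \<in> borel_measurable (info {1..} {1..<Suc k})" for i by (rule iterate_measurable_info) auto
        then show "w a b \<in> borel_measurable (info {1..} {1..<Suc k})" unfolding w_def by measurable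
        fix \<omega> assume "\<omega> \<in> ?S"
        then have "norm (w a b \<omega> - anchor) \<le> B" unfolding w_def by (intro norm_midpoint_anchor_le bound(1)) auto
        then show "norm (w a b \<omega>) \<le> \<bar>B\<bar> + norm anchor"
          using norm_triangle_ineq[of "w a b \<omega> - anchor" anchor] by simp
      qed auto
      then show ?thesis using cc by simp
    qed
    \<comment> \<open>Only now is the pair averaged out: \<open>S\<close> and \<open>\<psi>\<close>
      depend on the past alone.\<close>
    also have "\<dots> = pair_prob a b * (\<integral>\<omega>\<in>S. \<psi> a b \<omega> \<partial>M)"
      by (rule set_integral_pair_event[OF S \<psi>_meas \<psi>_int])
    finally show ?thesis .
  qed
  have "(\<integral>\<omega>\<in>S. pot \<kappa> (Suc k) \<omega> \<partial>M) = (\<Sum>a\<in>UNIV. \<Sum>b\<in>UNIV. \<integral>\<omega>\<in>S \<inter> pair_event (Suc k) a b. pot \<kappa> (Suc k) \<omega> \<partial>M)"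
    by (rule set_integral_split_pairs[OF _ pot_int(2)]) simp
  also have "\<dots> \<le> (\<Sum>a\<in>UNIV. \<Sum>b\<in>UNIV. pair_prob a b * (\<integral>\<omega>\<in>S. \<psi> a b \<omega> \<partial>M))"
    by (intro sum_mono piece)
  also have "\<dots> = (\<integral>\<omega>\<in>S. (\<Sum>a\<in>UNIV. \<Sum>b\<in>UNIV. pair_prob a b * \<psi> a b \<omega>) \<partial>M)"
  proof -
    have int: "integrable M (\<lambda>\<omega>. pair_prob a b * (indicat_real S \<omega> * \<psi> a b \<omega>))" for a b
      using \<psi>_int[of a b] by (simp add: set_integrable_def)
    have "(\<integral>\<omega>\<in>S. (\<Sum>a\<in>UNIV. \<Sum>b\<in>UNIV. pair_prob a b * \<psi> a b \<omega>) \<partial>M) =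
        (\<integral>\<omega>. (\<Sum>a\<in>UNIV. \<Sum>b\<in>UNIV. pair_prob a b * (indicat_real S \<omega> * \<psi> a b \<omega>)) \<partial>M)"
      unfolding set_lebesgue_integral_def real_scaleR_def sum_distrib_left
      by (simp only: mult.left_commute)
    also have "\<dots> = (\<Sum>a\<in>UNIV. \<integral>\<omega>. (\<Sum>b\<in>UNIV. pair_prob a b * (indicat_real S \<omega> * \<psi> a b \<omega>)) \<partial>M)"
      by (rule Bochner_Integration.integral_sum) (intro Bochner_Integration.integrable_sum int)
    also have "\<dots> = (\<Sum>a\<in>UNIV. \<Sum>b\<in>UNIV. \<integral>\<omega>. pair_prob a b * (indicat_real S \<omega> * \<psi> a b \<omega>) \<partial>M)"
      by (intro sum.cong refl Bochner_Integration.integral_sum int)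
    finally show ?thesis by (simp add: set_lebesgue_integral_def)
  qed
  also have "\<dots> \<le> (\<integral>\<omega>\<in>S. (1 - min (1 / real CARD('v) / (8 * cc)) (\<delta> / 2)) * pot \<kappa> k \<omega> + D * \<tau>\<^sup>2 \<partial>M)"
  proof (rule set_integral_mono_sets)
    show "set_integrable M S (\<lambda>\<omega>. \<Sum>a\<in>UNIV. \<Sum>b\<in>UNIV. pair_prob a b * \<psi> a b \<omega>)"
    proof -
      have "integrable M (\<lambda>\<omega>. \<Sum>a\<in>UNIV. \<Sum>b\<in>UNIV. pair_prob a b * (indicat_real S \<omega> * \<psi> a b \<omega>))"
        using \<psi>_int by (intro Bochner_Integration.integrable_sum) (simp add: set_integrable_def)
      then show ?thesis
        unfolding set_integrable_def real_scaleR_def sum_distrib_left by (simp only: mult.left_commute)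
    qed
    show "set_integrable M S (\<lambda>\<omega>. (1 - min (1 / real CARD('v) / (8 * cc)) (\<delta> / 2)) * pot \<kappa> k \<omega> + D * \<tau>\<^sup>2)"
      by (intro set_integral_add set_integrable_mult_right pot_int const)
    fix \<omega>
    show "(\<Sum>a\<in>UNIV. \<Sum>b\<in>UNIV. pair_prob a b * \<psi> a b \<omega>)
        \<le> (1 - min (1 / real CARD('v) / (8 * cc)) (\<delta> / 2)) * pot \<kappa> k \<omega> + D * \<tau>\<^sup>2"
      unfolding \<psi>_def pot_def
      by (rule expected_potential_le) (use pair_prob_nonneg pair_prob_sum pair_prob_row \<delta> cc \<kappa> in auto)
  qed
  also have "\<dots> = (1 - min (1 / real CARD('v) / (8 * cc)) (\<delta> / 2)) * (\<integral>\<omega>\<in>S. pot \<kappa> k \<omega> \<partial>M) + (\<integral>\<omega>\<in>S. D * \<tau>\<^sup>2 \<partial>M)"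
    by (subst set_integral_add(2)) (auto intro: set_integrable_mult_right pot_int const)
  also have "(\<integral>\<omega>\<in>S. D * \<tau>\<^sup>2 \<partial>M) \<le> D * \<tau>\<^sup>2"
  proof -
    have "D * \<tau>\<^sup>2 \<ge> 0" using \<kappa> cc \<delta> by (simp add: D_def)
    then have "prob S * (D * \<tau>\<^sup>2) \<le> 1 * (D * \<tau>\<^sup>2)" by (intro mult_right_mono prob_le_1)
    then show ?thesis using SM by (simp add: set_lebesgue_integral_def mult_ac)
  qed
  finally show ?thesis by simp
qed

section \<open>Frequency of updates\<close>

definition rate :: "'v \<Rightarrow> real" where
  "rate i = (\<Sum>b\<in>UNIV. pair_prob i b) + (\<Sum>a\<in>UNIV. pair_prob a i)"

lemma rate_pos: "rate i > 0"
proof -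
  have "(\<Sum>b\<in>UNIV. pair_prob i b) > 0" by (simp add: pair_prob_row)
  then show ?thesis unfolding rate_def by (intro add_pos_nonneg sum_nonneg pair_prob_nonneg)
qed

lemma rate_le: "rate i \<le> 2"
proof -
  have "(\<Sum>b\<in>UNIV. pair_prob i b) \<le> (\<Sum>a\<in>UNIV. \<Sum>b\<in>UNIV. pair_prob a b)"
    by (rule member_le_sum[where f = "\<lambda>a. \<Sum>b\<in>UNIV. pair_prob a b"]) (auto intro!: sum_nonneg pair_prob_nonneg)
  moreover have "(\<Sum>a\<in>UNIV. pair_prob a i) \<le> (\<Sum>a\<in>UNIV. \<Sum>b\<in>UNIV. pair_prob a b)"
    by (intro sum_mono member_le_sum) (auto intro!: pair_prob_nonneg)
  ultimately show ?thesis by (simp add: rate_def pair_prob_sum)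
qed

definition active :: "'v \<Rightarrow> nat \<Rightarrow> 'w \<Rightarrow> real" where
  "active i k \<omega> = (if i \<in> {I k \<omega>, J k \<omega>} then 1 else 0)"

text \<open>An agent is active by waking or by being contacted; both at once has probability 0, so
  the two sums in \<open>rate\<close> simply add.\<close>

lemma expectation_active:
  assumes k: "k \<ge> 1"
  shows "expectation (active i k) = rate i"
proof -
  have ev: "pair_event k a b \<in> events" for a b by (rule pair_event_in_events[OF k])
  have "expectation (active i k) = (\<integral>\<omega>. (\<Sum>a\<in>UNIV. \<Sum>b\<in>UNIV. indicat_real (space M \<inter> pair_event k a b) \<omega> * active i k \<omega>) \<partial>M)"
    by (rule Bochner_Integration.integral_cong[OF refl])
       (use indicator_split_pairs[where S = "space M" and k = k] in \<open>simp add: indicator_def\<close>)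
  also have "\<dots> = (\<integral>\<omega>. (\<Sum>a\<in>UNIV. \<Sum>b\<in>UNIV. of_bool (i \<in> {a, b}) * indicat_real (pair_event k a b) \<omega>) \<partial>M)"
    by (intro Bochner_Integration.integral_cong refl sum.cong)
       (auto simp: indicator_def active_def pair_event_def)
  also have "\<dots> = (\<Sum>a\<in>UNIV. \<integral>\<omega>. (\<Sum>b\<in>UNIV. of_bool (i \<in> {a, b}) * indicat_real (pair_event k a b) \<omega>) \<partial>M)"
    using ev by (intro Bochner_Integration.integral_sum Bochner_Integration.integrable_sum integrable_mult_right)
      (auto simp: less_top[symmetric])
  also have "\<dots> = (\<Sum>a\<in>UNIV. \<Sum>b\<in>UNIV. \<integral>\<omega>. of_bool (i \<in> {a, b}) * indicat_real (pair_event k a b) \<omega> \<partial>M)"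
    using ev by (intro sum.cong refl Bochner_Integration.integral_sum integrable_mult_right)
      (auto simp: less_top[symmetric])
  also have "\<dots> = (\<Sum>a\<in>UNIV. \<Sum>b\<in>UNIV. (if a = i then pair_prob a b else 0) + (if b = i then pair_prob a b else 0))"
    using ev pair_prob_diag by (intro sum.cong refl) (auto simp: prob_pair_event[OF k])
  also have "\<dots> = (\<Sum>a\<in>UNIV. (if a = i then (\<Sum>b\<in>UNIV. pair_prob a b) else 0) + pair_prob a i)"
    by (intro sum.cong refl) (simp add: sum.distrib)
  also have "\<dots> = rate i" by (simp add: sum.distrib rate_def)
  finally show ?thesis .
qed

lemma updates_eq_sum: "real (updates i n \<omega>) = (\<Sum>k\<in>{1..n}. active i k \<omega>)"
  by (induction n) (auto simp: num_updates_Suc active_def)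

text \<open>Hoeffding's inequality for the independent indicators \<open>active i k\<close>. The
  exponent equals \<open>- 2 * sqrt (real n)\<close>, so the bounds are summable over
  \<open>n\<close>.\<close>

lemma updates_deviation:
  assumes n: "n \<ge> 1"
  shows "prob {\<omega> \<in> space M. \<bar>real (updates i n \<omega>) - rate i * real n\<bar> \<ge> real n powr (3/4)}
    \<le> 2 * exp (- 2 * (real n powr (3/4))\<^sup>2 / real n)"
proof -
  have indep: "indep_vars (\<lambda>_. borel) (active i) {1..n}"
  proof (rule indep_vars_subset)
    have "indep_vars (\<lambda>_. borel) (\<lambda>k \<omega>. (\<lambda>(a, b). if i \<in> {a, b} then 1 else 0 :: real) (I k \<omega>, J k \<omega>)) {1..}"
      by (rule indep_vars_compose2[OF gossip_indep_vars]) simp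
    then show "indep_vars (\<lambda>_. borel) (active i) {1..}" by (simp add: active_def[abs_def])
  qed auto
  interpret Hoeffding_ineq M "{1..n}" "active i" "\<lambda>_. 0" "\<lambda>_. 1" "\<Sum>k\<in>{1..n}. expectation (active i k)"
  proof unfold_locales
    show "indep_vars (\<lambda>_. borel) (active i) {1..n}" by (rule indep)
    show "AE \<omega> in M. active i k \<omega> \<in> {0..1}" for k by (simp add: active_def)
  qed simp_all
  have "(\<Sum>k\<in>{1..n}. expectation (active i k)) = rate i * real n" by (simp add: expectation_active)
  then show ?thesis
    using Hoeffding_ineq_abs_ge[of "real n powr (3/4)"] n by (simp add: updates_eq_sum)
qed

lemma AE_update_frequency:
  "AE \<omega> in M. \<forall>i. \<forall>\<^sub>F n in sequentially. \<bar>real (updates i n \<omega>) - rate i * real n\<bar> \<le> real n powr (3/4)"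
proof -
  have "AE \<omega> in M. \<forall>\<^sub>F n in sequentially. \<bar>real (updates i n \<omega>) - rate i * real n\<bar> \<le> real n powr (3/4)" for i
  proof -
    define A where "A n = {\<omega> \<in> space M. \<bar>real (updates i n \<omega>) - rate i * real n\<bar> \<ge> real n powr (3/4)}" for n
    have meas: "(\<lambda>\<omega>. real (updates i n \<omega>)) \<in> borel_measurable M" for n
      by (rule measurable_from_subalg[OF subalgebra_info updates_measurable_info[of _ "{1..}"]]) auto
    have A: "A n \<in> events" for n unfolding A_def using meas by measurable
    have "AE \<omega> in M. \<forall>\<^sub>F n in sequentially. \<omega> \<in> space M - A n"
    proof (rule borel_cantelli_AE1[OF A])
      show "emeasure M (A n) < \<infinity>" for n by (simp add: less_top[symmetric])
      show "summable (\<lambda>n. prob (A n))"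
      proof (rule summable_comparison_test_ev)
        have "\<forall>\<^sub>F n::nat in sequentially. 2 * exp (- 2 * (real n powr (3/4))\<^sup>2 / real n) \<le> inverse (real n ^ 2)"
          by real_asymp
        then show "\<forall>\<^sub>F n in sequentially. norm (prob (A n)) \<le> inverse (real n ^ 2)"
          using eventually_ge_at_top[of 1]
        proof eventually_elim
          case (elim n)
          then show ?case using updates_deviation[of n i] unfolding A_def by simp
        qed
        show "summable (\<lambda>n. inverse (real n ^ 2))" by (rule inverse_power_summable) simp
      qed
    qed
    then show ?thesis
      by eventually_elim (auto elim!: eventually_mono simp: A_def)
  qed
  then show ?thesis unfolding AE_all_countable by blast
qed

text \<open>The initial points, and \<open>k\<close> times the stepsizes, are not bounded uniformly in \<open>\<omega>\<close>, so
  expectations are taken over these events: they decrease in \<open>k\<close>, are known at time \<open>k\<close>, and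
  almost every \<open>\<omega>\<close> lies in \<open>good R K k\<close> for all \<open>k\<close> once \<open>R\<close> and \<open>K\<close> are large.\<close>

definition good :: "nat \<Rightarrow> nat \<Rightarrow> nat \<Rightarrow> 'w set" where
  "good R K k = {\<omega> \<in> space M. (\<forall>i. norm (x i 0 \<omega> - anchor) \<le> real R) \<and>
     (\<forall>t\<in>{K..k}. \<forall>i. rate i / 2 * real (Suc t) \<le> real (updates i t \<omega>) + 1)}"

lemma good_in_info: "good R K k \<in> sets (info {1..k} {1..k})"
proof -
  let ?F = "info {1..k} {1..k}"
  have init: "{\<omega> \<in> space ?F. norm (x i 0 \<omega> - anchor) \<le> real R} \<in> sets ?F" for i
    using initial_measurable_info[of i "{1..k}" "{1..k}"] by measurable
  have upd: "{\<omega> \<in> space ?F. rate i / 2 * real (Suc t) \<le> real (updates i t \<omega>) + 1} \<in> sets ?F" if "t \<in> {K..k}" for t i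
  proof -
    have "(\<lambda>\<omega>. real (updates i t \<omega>)) \<in> borel_measurable ?F" using that by (intro updates_measurable_info) auto
    then show ?thesis by measurable
  qed
  have "{\<omega> \<in> space ?F. (\<forall>i\<in>UNIV. norm (x i 0 \<omega> - anchor) \<le> real R) \<and>
     (\<forall>t\<in>{K..k}. \<forall>i\<in>UNIV. rate i / 2 * real (Suc t) \<le> real (updates i t \<omega>) + 1)} \<in> sets ?F"
  proof (rule sets.sets_Collect_conj)
    show "{\<omega> \<in> space ?F. \<forall>i\<in>UNIV. norm (x i 0 \<omega> - anchor) \<le> real R} \<in> sets ?F"
      by (rule sets.sets_Collect_finite_All[OF init]) simp
    show "{\<omega> \<in> space ?F. \<forall>t\<in>{K..k}. \<forall>i\<in>UNIV. rate i / 2 * real (Suc t) \<le> real (updates i t \<omega>) + 1} \<in> sets ?F"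
    proof (rule sets.sets_Collect_finite_All)
      show "{\<omega> \<in> space ?F. \<forall>i\<in>UNIV. rate i / 2 * real (Suc t) \<le> real (updates i t \<omega>) + 1} \<in> sets ?F"
        if "t \<in> {K..k}" for t
        by (rule sets.sets_Collect_finite_All[OF upd[OF that]]) simp
    qed simp
  qed
  then show ?thesis by (simp add: good_def)
qed

lemma good_in_events: "good R K k \<in> events"
  using good_in_info[of R K k] subalgebra_info[of "{1..k}" "{1..k}"] by (auto simp: subalgebra_def)

lemma good_Suc_subset: "good R K (Suc k) \<subseteq> good R K k"
  by (auto simp: good_def)

lemma stepsize_on_good:
  assumes "\<omega> \<in> good R K k" "K \<le> k" "i \<in> {I (Suc k) \<omega>, J (Suc k) \<omega>}"
  shows "1 / real (updates i (Suc k) \<omega>) \<le> (\<Sum>j\<in>UNIV. 2 / rate j) / real (Suc k)"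
proof -
  have pos: "rate i / 2 * real (Suc k) > 0" using rate_pos[of i] by simp
  \<comment> \<open>The \<open>+ 1\<close> in \<open>good\<close> stands for this update; it lets an
    event known at time \<open>k\<close> bound the count of an active agent at time
    \<open>Suc k\<close>.\<close>
  have "updates i (Suc k) \<omega> = updates i k \<omega> + 1" using assms(3) by (simp add: num_updates_Suc)
  moreover have "rate i / 2 * real (Suc k) \<le> real (updates i k \<omega>) + 1"
    using assms(1,2) by (auto simp: good_def simp del: of_nat_Suc)
  ultimately have le: "rate i / 2 * real (Suc k) \<le> real (updates i (Suc k) \<omega>)" by simp
  have "1 / real (updates i (Suc k) \<omega>) \<le> 1 / (rate i / 2 * real (Suc k))"
    by (rule divide_left_mono[OF le _ mult_pos_pos[OF less_le_trans[OF pos le] pos]]) simp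
  also have "\<dots> = (2 / rate i) / real (Suc k)" by simp
  also have "\<dots> \<le> (\<Sum>j\<in>UNIV. 2 / rate j) / real (Suc k)"
    using rate_pos by (intro divide_right_mono member_le_sum) (auto intro: less_imp_le)
  finally show ?thesis .
qed

section \<open>Almost sure summability of the potential\<close>

lemma expected_potential_summable:
  "\<exists>\<kappa>>0. \<forall>R K. summable (\<lambda>k. real k powr (3/4) * (\<integral>\<omega>\<in>good R K k. pot \<kappa> k \<omega> \<partial>M))"
proof -
  obtain \<delta> where \<delta>: "0 < \<delta>" "\<delta> \<le> 1"
    "\<And>z::'v \<Rightarrow> 'a. \<delta> * disagreement z \<le> (\<Sum>a\<in>UNIV. \<Sum>b\<in>UNIV. pair_prob a b * (norm (z a - z b))\<^sup>2) / 2"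
    using disagreement_le_of_connected[OF graph(2), of pair_prob] pair_prob_edge pair_prob_nonneg by blast
  define cc where "cc = max c 1"
  define \<kappa> where "\<kappa> = 1 / (16 * cc * (1 + 2 / \<delta>) * (2 + L)\<^sup>2)"
  define D where "D = 2 * (12 * cc + 4) * G\<^sup>2 + 4 * \<kappa> * (1 + 2 / \<delta>) * G\<^sup>2"
  define \<rho> where "\<rho> = min (1 / real CARD('v) / (8 * cc)) (\<delta> / 2)"
  define A where "A = (\<Sum>j\<in>UNIV. 2 / rate j)"
  have cc: "cc \<ge> 1" by (simp add: cc_def)
  have \<kappa>: "\<kappa> > 0" using cc \<delta> L_nonneg by (simp add: \<kappa>_def add_pos_pos)
  have D: "D \<ge> 0" using cc \<kappa> \<delta> by (simp add: D_def)
  have \<rho>: "0 < \<rho>" "\<rho> \<le> 1" using cc \<delta> by (auto simp: \<rho>_def min_le_iff_disj)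
  have "summable (\<lambda>k. real k powr (3/4) * (\<integral>\<omega>\<in>good R K k. pot \<kappa> k \<omega> \<partial>M))" for R K
  proof (rule summable_powr_mult_of_contraction[OF _ _ \<rho>])
    show "0 \<le> (\<integral>\<omega>\<in>good R K k. pot \<kappa> k \<omega> \<partial>M)" for k
      unfolding set_lebesgue_integral_def using \<kappa>
      by (intro integral_nonneg_AE AE_I2) (auto simp: pot_nonneg)
    show "0 \<le> D * A\<^sup>2" using D by simp
    have "(\<lambda>k. A / real (Suc k)) \<longlonglongrightarrow> 0" by real_asymp
    then have "\<forall>\<^sub>F k in sequentially. A / real (Suc k) < 1 / (24 * cc * (L + 1))"
      using cc L_nonneg by (intro order_tendstoD) auto
    then show "\<forall>\<^sub>F k in sequentially. (\<integral>\<omega>\<in>good R K (Suc k). pot \<kappa> (Suc k) \<omega> \<partial>M)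
      \<le> (1 - \<rho>) * (\<integral>\<omega>\<in>good R K k. pot \<kappa> k \<omega> \<partial>M) + D * A\<^sup>2 / (real (Suc k))\<^sup>2"
      using eventually_ge_at_top[of K]
    proof eventually_elim
      case (elim k)
      define B where "B n = (1 + L) ^ n * (real R + real n * G)" for n
      have bound: "norm (x i n \<omega> - anchor) \<le> B n" if "\<omega> \<in> good R K k" for i n \<omega>
        unfolding B_def using that by (intro iterate_bounded) (auto simp: good_def)
      have int: "set_integrable M (good R K k) (pot \<kappa> (Suc k))"
        unfolding pot_def using potential_set_integrable[OF good_in_events bound]
        by (intro set_integral_add set_integrable_mult_right)
      \<comment> \<open>Since the potential is nonnegative, it may be integrated over the larger
        event \<open>good R K k\<close>, which is known before the step.\<close>
      have "(\<integral>\<omega>\<in>good R K (Suc k). pot \<kappa> (Suc k) \<omega> \<partial>M) \<le> (\<integral>\<omega>\<in>good R K k. pot \<kappa> (Suc k) \<omega> \<partial>M)"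
        unfolding set_lebesgue_integral_def
      proof (rule integral_mono)
        show "integrable M (\<lambda>\<omega>. indicat_real (good R K k) \<omega> *\<^sub>R pot \<kappa> (Suc k) \<omega>)"
          using int by (simp add: set_integrable_def)
        show "integrable M (\<lambda>\<omega>. indicat_real (good R K (Suc k)) \<omega> *\<^sub>R pot \<kappa> (Suc k) \<omega>)"
          using set_integrable_subset[OF int good_in_events good_Suc_subset] by (simp add: set_integrable_def)
        show "indicat_real (good R K (Suc k)) \<omega> *\<^sub>R pot \<kappa> (Suc k) \<omega> \<le> indicat_real (good R K k) \<omega> *\<^sub>R pot \<kappa> (Suc k) \<omega>" for \<omega>
          using good_Suc_subset[of R K k] pot_nonneg[of \<kappa>] \<kappa> by (auto simp: indicator_def)
      qed
      also have "\<dots> \<le> (1 - \<rho>) * (\<integral>\<omega>\<in>good R K k. pot \<kappa> k \<omega> \<partial>M) + D * (A / real (Suc k))\<^sup>2"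
        unfolding \<rho>_def D_def \<kappa>_def cc_def
        by (rule expected_potential_step[OF \<delta> good_in_info bound bound])
           (use elim stepsize_on_good in \<open>auto simp: A_def cc_def simp del: of_nat_Suc\<close>)
      finally show ?case by (simp add: power_divide del: of_nat_Suc)
    qed
  qed
  then show ?thesis using \<kappa> by blast
qed

lemma AE_potential_summable:
  "AE \<omega> in M. summable (\<lambda>k. real k powr (3/4) *
     (infeasibility Y (\<lambda>i. x i k \<omega>) + disagreement (\<lambda>i. x i k \<omega>)))"
proof -
  obtain \<kappa> where \<kappa>: "\<kappa> > 0"
    "\<And>R K. summable (\<lambda>k. real k powr (3/4) * (\<integral>\<omega>\<in>good R K k. pot \<kappa> k \<omega> \<partial>M))"
    using expected_potential_summable by blast
  have "AE \<omega> in M. summable (\<lambda>k. real k powr (3/4) * (indicat_real (good R K k) \<omega> * pot \<kappa> k \<omega>))" for R K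
  proof (rule AE_summable_of_summable_integral)
    fix k
    have bound: "norm (x i k \<omega> - anchor) \<le> (1 + L) ^ k * (real R + real k * G)" if "\<omega> \<in> good R K k" for i \<omega>
      using that by (intro iterate_bounded) (auto simp: good_def)
    have "set_integrable M (good R K k) (pot \<kappa> k)"
      unfolding pot_def using potential_set_integrable[OF good_in_events bound]
      by (intro set_integral_add set_integrable_mult_right)
    then show "integrable M (\<lambda>\<omega>. real k powr (3/4) * (indicat_real (good R K k) \<omega> * pot \<kappa> k \<omega>))"
      by (simp add: set_integrable_def)
  next
    show "0 \<le> real k powr (3/4) * (indicat_real (good R K k) \<omega> * pot \<kappa> k \<omega>)" for k \<omega>
      using \<kappa>(1) by (simp add: pot_nonneg)
    show "summable (\<lambda>k. \<integral>\<omega>. real k powr (3/4) * (indicat_real (good R K k) \<omega> * pot \<kappa> k \<omega>) \<partial>M)"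
      using \<kappa>(2)[of R K] by (simp add: set_lebesgue_integral_def)
  qed
  \<comment> \<open>\<open>R\<close> and \<open>K\<close> are natural numbers, so a single null set
    serves all of them.\<close>
  then have "AE \<omega> in M. \<forall>R K. summable (\<lambda>k. real k powr (3/4) * (indicat_real (good R K k) \<omega> * pot \<kappa> k \<omega>))"
    by (simp add: AE_all_countable)
  then show ?thesis
    using AE_update_frequency AE_space
  proof eventually_elim
    case (elim \<omega>)
    have "\<forall>\<^sub>F t in sequentially. \<forall>i. rate i / 2 * real t \<le> real (updates i t \<omega>)"
      using elim(2) eventually_linear_lower_bound[OF _ rate_pos] by (intro eventually_all_finite) auto
    then obtain K where K: "\<And>t i. t \<ge> K \<Longrightarrow> rate i / 2 * real t \<le> real (updates i t \<omega>)"
      unfolding eventually_sequentially by blast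
    obtain R :: nat where R: "(\<Sum>i\<in>UNIV. norm (x i 0 \<omega> - anchor)) \<le> real R" using real_arch_simple by blast
    have "norm (x i 0 \<omega> - anchor) \<le> real R" for i
      using member_le_sum[of i UNIV "\<lambda>i. norm (x i 0 \<omega> - anchor)"] R by simp
    \<comment> \<open>Passing from \<open>t\<close> to \<open>Suc t\<close> adds
      \<open>rate i / 2\<close>, which is at most 1.\<close>
    moreover have "rate i / 2 * real (Suc t) \<le> real (updates i t \<omega>) + 1" if "t \<ge> K" for t i
      using K[OF that, of i] rate_le[of i] by (simp add: algebra_simps)
    ultimately have in_good: "\<omega> \<in> good R K k" for k using elim(3) by (auto simp: good_def)
    \<comment> \<open>On this path the indicator is constantly 1; the factor
      \<open>1 + 1 / \<kappa>\<close> removes the weight \<open>\<kappa>\<close> from the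
      disagreement.\<close>
    have sum: "summable (\<lambda>k. (1 + 1 / \<kappa>) * (real k powr (3/4) * pot \<kappa> k \<omega>))"
      using elim(1)[rule_format, of R K] in_good by (intro summable_mult) simp
    show ?case
    proof (rule summable_comparison_test'[OF sum, of 0])
      fix k :: nat
      let ?S = "infeasibility Y (\<lambda>i. x i k \<omega>)" and ?D = "disagreement (\<lambda>i. x i k \<omega>)"
      have S: "?S \<ge> 0" and D: "?D \<ge> 0" by (rule infeasibility_nonneg, rule disagreement_nonneg)
      have "(1 + 1 / \<kappa>) * pot \<kappa> k \<omega> = ?S + ?D + (\<kappa> * ?D + ?S / \<kappa>)"
        using \<kappa>(1) by (simp add: pot_def field_simps)
      moreover have "\<kappa> * ?D + ?S / \<kappa> \<ge> 0" using \<kappa>(1) S D by simp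
      ultimately have "?S + ?D \<le> (1 + 1 / \<kappa>) * pot \<kappa> k \<omega>" by linarith
      then have "real k powr (3/4) * (?S + ?D) \<le> real k powr (3/4) * ((1 + 1 / \<kappa>) * pot \<kappa> k \<omega>)"
        by (rule mult_left_mono) simp
      then show "norm (real k powr (3/4) * (?S + ?D)) \<le> (1 + 1 / \<kappa>) * (real k powr (3/4) * pot \<kappa> k \<omega>)"
        using S D by (simp add: mult.left_commute)
    qed
  qed
qed

text \<open>Taking \<open>lim\<close> of the iterates of one agent as the limit point gives a
  function that is measurable on the whole space and equals the common limit wherever the paths
  converge.\<close>

theorem AE_convergence:
  assumes "optimal_set total Y \<noteq> {}"
  shows "\<exists>x_star \<in> borel_measurable M. AE \<omega> in M.
    x_star \<omega> \<in> optimal_set total Y \<and> (\<forall>i. (\<lambda>k. x i k \<omega>) \<longlonglongrightarrow> x_star \<omega>)"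
proof
  fix i0 :: 'v
  let ?l = "\<lambda>\<omega>. lim (\<lambda>k. x i0 k \<omega>)"
  show "?l \<in> borel_measurable M" by (rule borel_measurable_lim_metric[OF iterate_measurable])
  show "AE \<omega> in M. ?l \<omega> \<in> optimal_set total Y \<and> (\<forall>i. (\<lambda>k. x i k \<omega>) \<longlonglongrightarrow> ?l \<omega>)"
    using AE_potential_summable AE_update_frequency AE_distinct_pair AE_space
  proof eventually_elim
    case (elim \<omega>)
    have "\<exists>z\<in>optimal_set total Y. \<forall>i. (\<lambda>k. (\<lambda>i. x i k \<omega>) i) \<longlonglongrightarrow> z"
    proof (rule path_converges_to_optimum)
      show "gossip_step (I (Suc k) \<omega>) (J (Suc k) \<omega>) (\<lambda>i. X i (\<Omega> i (Suc k) \<omega>)) g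
          (\<lambda>i. 1 / real (updates i (Suc k) \<omega>)) (\<lambda>i. x i k \<omega>) (\<lambda>i. x i (Suc k) \<omega>)" for k
        by (rule algorithm_step[OF elim(4)])
      show "closed (X i (\<Omega> i (Suc k) \<omega>))" "convex (X i (\<Omega> i (Suc k) \<omega>))" "Y \<subseteq> X i (\<Omega> i (Suc k) \<omega>)" for i k
        using component_set[OF choice_in_space[of "Suc k", OF _ elim(4)]] by auto
    qed (use elim rate_pos assms in auto)
    then obtain z where z: "z \<in> optimal_set total Y" "\<And>i. (\<lambda>k. x i k \<omega>) \<longlonglongrightarrow> z" by auto
    then show ?case using limI[OF z(2)[of i0]] by auto
  qed
qed

end

theorem proposition1:
  fixes M :: "'w measure"
    and E :: "'v::finite set set"
    and P :: "'v \<Rightarrow> 'v \<Rightarrow> real"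
    and I J :: "nat \<Rightarrow> 'w \<Rightarrow> 'v"
    and N :: "'v \<Rightarrow> 'j measure"
    and X :: "'v \<Rightarrow> 'j \<Rightarrow> (real^'d) set"
    and \<Omega> :: "'v \<Rightarrow> nat \<Rightarrow> 'w \<Rightarrow> 'j"
    and f :: "'v \<Rightarrow> real^'d \<Rightarrow> real"
    and g :: "'v \<Rightarrow> real^'d \<Rightarrow> real^'d"
    and L :: "'v \<Rightarrow> real"
    and G\<^sub>f c :: real
    and x :: "'v \<Rightarrow> nat \<Rightarrow> 'w \<Rightarrow> real^'d"
  assumes "prob_space M"
    and graph: "simple_graph E" "connected_graph E"
    and stochastic: "\<And>i j. P i j \<ge> 0" "\<And>i. (\<Sum>j\<in>UNIV. P i j) = 1"
    and support: "\<And>i j. {i, j} \<in> E \<Longrightarrow> P j i > 0" "\<And>i j. {i, j} \<notin> E \<Longrightarrow> P j i = 0"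
    and gossip: "gossip_selection M P I J"
    and sets_closed_convex: "\<And>i j. j \<in> space (N i) \<Longrightarrow> closed (X i j) \<and> convex (X i j)"
    and dist_measurable: "\<And>i y. (\<lambda>j. infdist y (X i j)) \<in> borel_measurable (N i)"
    and feasible: "feasible_set N X \<noteq> {}"
    and convex: "\<And>i. convex_on UNIV (f i)"
    and gradient: "\<And>i y. GDERIV (f i) y :> g i y"
    and lipschitz: "\<And>i y z. norm (g i y - g i z) \<le> L i * norm (y - z)"
    and bounded_gradient: "\<And>i y. y \<in> feasible_set N X \<Longrightarrow> norm (g i y) \<le> G\<^sub>f"
    and choices: "\<And>i k. k \<ge> 1 \<Longrightarrow> \<Omega> i k \<in> measurable M (N i)"
    and c_pos: "c > 0"
    and regularity: "\<And>i k y. k \<ge> 1 \<Longrightarrow>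
        AE \<omega> in M. (infdist y (feasible_set N X))\<^sup>2 \<le>
          c * real_cond_exp M (past_choices M N \<Omega> k) (\<lambda>\<omega>. (infdist y (X i (\<Omega> i k \<omega>)))\<^sup>2) \<omega>"
    and optimum: "optimal_set (\<lambda>y. \<Sum>i\<in>UNIV. f i y) (feasible_set N X) \<noteq> {}"
    and initial: "\<And>i. x i 0 \<in> borel_measurable M"
    and sources: "independent_sources M N (\<lambda>i. x i 0) I J \<Omega>"
    and algorithm: "\<And>\<omega>. \<omega> \<in> space M \<Longrightarrow>
        grp_path (\<lambda>k. I k \<omega>) (\<lambda>k. J k \<omega>) (\<lambda>i k. X i (\<Omega> i k \<omega>)) g
          (\<lambda>i k. 1 / real (num_updates (\<lambda>t. I t \<omega>) (\<lambda>t. J t \<omega>) i k))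
          (\<lambda>i k. x i k \<omega>)"
  shows "\<exists>x_star \<in> borel_measurable M. AE \<omega> in M.
           x_star \<omega> \<in> optimal_set (\<lambda>y. \<Sum>i\<in>UNIV. f i y) (feasible_set N X) \<and>
           (\<forall>i. (\<lambda>k. x i k \<omega>) \<longlonglongrightarrow> x_star \<omega>)"
proof -
  \<comment> \<open>One constant for all agents; the absolute values keep it nonnegative and above
    each \<open>L i\<close>.\<close>
  let ?L = "\<Sum>i\<in>UNIV. \<bar>L i\<bar>"
  have feasible_closed_convex: "closed (feasible_set N X)" "convex (feasible_set N X)"
    unfolding feasible_set_def using sets_closed_convex by (auto intro!: closed_INT convex_INT)
  have lipschitz': "norm (g i y - g i z) \<le> ?L * norm (y - z)" for i y z
  proof -
    have "L i \<le> \<bar>L i\<bar>" by simp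
    also have "\<dots> \<le> ?L" by (rule member_le_sum) auto
    finally show ?thesis using lipschitz[of i y z] mult_right_mono[of "L i" ?L "norm (y - z)"] by simp
  qed
  interpret prob_space M by fact
  interpret grp_process M N X f g ?L G\<^sub>f E P I J \<Omega> c x
    by unfold_locales
      (use feasible_closed_convex lipschitz' assms in \<open>auto intro: sum_nonneg\<close>)
  show ?thesis by (rule AE_convergence[OF optimum])
qed

end
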